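(* Let $R>0$ and let $D$ be a disk of radius $R$ in the hyperbolic plane $\mathbb{H}^2$ (of constant Gaussian curvature $-1$). Then there exists a $W^{2,2}$ isometric immersion $\mathbf{x}:D\rightarrow U\subset\mathbb{R}^3$ such that $U=\mathbf{x}(D)$ is a subset of a periodic Amsler surface (with $n$ waves, for some integer $n\ge 2$).
   Context: A disk of radius $R$ is a geodesic disk $D=\{q\in\mathbb{H}^2:d(p,q)<R\}$. A $W^{2,2}$ isometric immersion is a map $\mathbf{x}\in W^{2,2}(D,\mathbb{R}^3)$ with $D\mathbf{x}^TD\mathbf{x}=\mathbf{g}$, where $\mathbf{g}$ is the hyperbolic metric on $D$. It need not be injective. Periodic Amsler surfaces. Let $n\ge 2$ be an integer and let $\varphi_n$ be the solution of $$\varphi''(z)+\frac1z\varphi'(z)-\sin\varphi(z)=0,\qquad \varphi(0)=\frac{\pi}{n},\quad \varphi'(0)=0,$$ for $z\ge0$, up to the first point $z_n=\varphi_n^{-1}(\pi)$ at which $\varphi_n=\pi$. On $Q_n=\{(u,v):u\ge0,\ v\ge0,\ 2\sqrt{uv}<z_n\}$ put $\phi(u,v)=\varphi_n(2\sqrt{uv})$; then $\phi$ takes values in $(0,\pi)$ and satisfies the sine-Gordon equation $\phi_{uv}=\sin\phi$. The corresponding piece of Amsler surface is the surface $P_0\subset\mathbb{R}^3$ parameterized by $Q_n$ (unique up to rigid motion) with first fundamental form $du^2+2\cos\phi\,du\,dv+dv^2$ and second fundamental form $2\sin\phi\,du\,dv$. It has Gaussian curvature $-1$, its coordinate curves are asymptotic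 curves, and the half-axes $v=0$ and $u=0$ are mapped to straight rays issuing from the image of $(0,0)$ and making an angle $\pi/n$. Place $P_0$ so that $(0,0)$ is mapped to the origin, and these two rays are $\ell_0$ and $\ell_1$, where $\ell_k$ denotes the ray from the origin in the $xy$-plane at polar angle $k\pi/n$. For $k=1,\dots,2n-1$ let $P_k$ be the image of $P_{k-1}$ under the rotation of $\mathbb{R}^3$ by angle $\pi$ about the line containing $\ell_k$ (so $P_k$ is bounded by $\ell_k$ and $\ell_{k+1}$, with $\ell_{2n}=\ell_0$). The periodic Amsler surface with $n$ waves is the union $P_0\cup P_1\cup\dots\cup P_{2n-1}$ (the "odd periodic extension" of $P_0$ about its two bounding asymptotic lines). *)

theory Defs
  imports "HOL-Analysis.Analysis"
begin

section \<open>The hyperbolic plane\<close>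

text \<open>Poincare disk model, with its metric tensor of constant curvature \<open>-1\<close> (as a matrix in the
  standard coordinates of the unit disk) and the closed form of the associated geodesic distance.\<close>

definition hyperbolic_plane :: "(real^2) set" where
  "hyperbolic_plane = ball 0 1"

definition hyperbolic_metric :: "real^2 \<Rightarrow> real^2^2" where
  "hyperbolic_metric z = mat (4 / (1 - (norm z)\<^sup>2)\<^sup>2)"

definition hyperbolic_dist :: "real^2 \<Rightarrow> real^2 \<Rightarrow> real" where
  "hyperbolic_dist p q =
     arcosh (1 + 2 * (norm (p - q))\<^sup>2 / ((1 - (norm p)\<^sup>2) * (1 - (norm q)\<^sup>2)))"

definition hyperbolic_disk :: "real^2 \<Rightarrow> real \<Rightarrow> (real^2) set" where
  "hyperbolic_disk p R = {q \<in> hyperbolic_plane. hyperbolic_dist p q < R}"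

section \<open>Sobolev maps\<close>

definition partial_deriv :: "'n \<Rightarrow> (real^'n \<Rightarrow> real) \<Rightarrow> real^'n \<Rightarrow> real" where
  "partial_deriv i f x = frechet_derivative f (at x) (axis i 1)"

primrec Ck :: "nat \<Rightarrow> (real^'n \<Rightarrow> real) \<Rightarrow> bool" where
  "Ck 0 f \<longleftrightarrow> continuous_on UNIV f"
| "Ck (Suc k) f \<longleftrightarrow> f differentiable_on UNIV \<and> (\<forall>i. Ck k (partial_deriv i f))"

definition test_function :: "(real^'n) set \<Rightarrow> (real^'n \<Rightarrow> real) \<Rightarrow> bool" where
  "test_function \<Omega> \<psi> \<longleftrightarrow>
     (\<forall>k. Ck k \<psi>) \<and> compact (closure {x. \<psi> x \<noteq> 0}) \<and> closure {x. \<psi> x \<noteq> 0} \<subseteq> \<Omega>"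

definition locally_integrable :: "(real^'n) set \<Rightarrow> (real^'n \<Rightarrow> real) \<Rightarrow> bool" where
  "locally_integrable \<Omega> f \<longleftrightarrow> (\<forall>K. compact K \<and> K \<subseteq> \<Omega> \<longrightarrow> integrable (lebesgue_on K) f)"

definition square_integrable :: "(real^'n) set \<Rightarrow> (real^'n \<Rightarrow> real) \<Rightarrow> bool" where
  "square_integrable \<Omega> f \<longleftrightarrow>
     f \<in> borel_measurable (lebesgue_on \<Omega>) \<and> integrable (lebesgue_on \<Omega>) (\<lambda>x. (f x)\<^sup>2)"

definition weak_partial ::
    "(real^'n) set \<Rightarrow> 'n \<Rightarrow> (real^'n \<Rightarrow> real) \<Rightarrow> (real^'n \<Rightarrow> real) \<Rightarrow> bool" where
  "weak_partial \<Omega> i f g \<longleftrightarrow>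
     locally_integrable \<Omega> f \<and> locally_integrable \<Omega> g \<and>
     (\<forall>\<psi>. test_function \<Omega> \<psi> \<longrightarrow>
        integral\<^sup>L (lebesgue_on \<Omega>) (\<lambda>x. f x * partial_deriv i \<psi> x)
          = - integral\<^sup>L (lebesgue_on \<Omega>) (\<lambda>x. g x * \<psi> x))"

text \<open>\<open>W\<^sup>2\<^sup>,\<^sup>2\<close> is taken in the coordinates of the unit disk. A hyperbolic disk has compact closure in
  the hyperbolic plane, so the metric and its Christoffel symbols are bounded there (and the metric
  is bounded away from zero), and this is the same space as the one defined with the hyperbolic area
  and covariant derivatives.\<close>

definition W22 :: "(real^'n) set \<Rightarrow> (real^'n \<Rightarrow> real) \<Rightarrow> bool" where
  "W22 \<Omega> f \<longleftrightarrow> square_integrable \<Omega> f \<and>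
     (\<exists>df d2f.
        (\<forall>i. weak_partial \<Omega> i f (df i) \<and> square_integrable \<Omega> (df i)) \<and>
        (\<forall>i j. weak_partial \<Omega> j (df i) (d2f i j) \<and> square_integrable \<Omega> (d2f i j)))"

text \<open>A two-dimensional \<open>W\<^sup>2\<^sup>,\<^sup>2\<close> map has a unique continuous representative; \<open>continuous_on\<close> selects
  it, so that the image \<open>x ` \<Omega>\<close> is meaningful. \<open>J\<close> is the weak differential \<open>Dx\<close>, unique
  almost everywhere.\<close>

definition W22_isometric_immersion ::
    "(real^2) set \<Rightarrow> (real^2 \<Rightarrow> real^2^2) \<Rightarrow> (real^2 \<Rightarrow> real^3) \<Rightarrow> bool" where
  "W22_isometric_immersion \<Omega> g x \<longleftrightarrow>
     continuous_on \<Omega> x \<and> (\<forall>k. W22 \<Omega> (\<lambda>z. x z $ k)) \<and>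
     (\<exists>J :: real^2 \<Rightarrow> real^2^3.
        (\<forall>k i. weak_partial \<Omega> i (\<lambda>z. x z $ k) (\<lambda>z. J z $ k $ i)) \<and>
        (AE z in lebesgue_on \<Omega>. transpose (J z) ** J z = g z))"

section \<open>Periodic Amsler surfaces\<close>

definition amsler_profile :: "nat \<Rightarrow> (real \<Rightarrow> real) \<Rightarrow> real \<Rightarrow> bool" where
  "amsler_profile n \<phi> zn \<longleftrightarrow>
     0 < zn \<and> \<phi> zn = pi \<and> (\<forall>z\<in>{0..<zn}. \<phi> z \<noteq> pi) \<and>
     (\<exists>\<phi>' \<phi>''.
        (\<forall>z\<in>{0..zn}. (\<phi> has_real_derivative \<phi>' z) (at z within {0..zn})) \<and>
        (\<forall>z\<in>{0<..zn}. (\<phi>' has_real_derivative \<phi>'' z) (at z within {0..zn})) \<and>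
        (\<forall>z\<in>{0<..zn}. \<phi>'' z + (1 / z) * \<phi>' z - sin (\<phi> z) = 0) \<and>
        \<phi> 0 = pi / real n \<and> \<phi>' 0 = 0)"

definition amsler_domain :: "real \<Rightarrow> (real \<times> real) set" where
  "amsler_domain zn = {(u, v). 0 \<le> u \<and> 0 \<le> v \<and> 2 * sqrt (u * v) < zn}"

text \<open>Partial derivatives within \<open>Q\<close>, hence one-sided on the part of the boundary belonging to \<open>Q\<close>.\<close>

definition partial_u_on ::
    "(real \<times> real) set \<Rightarrow> (real \<times> real \<Rightarrow> real^3) \<Rightarrow> (real \<times> real \<Rightarrow> real^3) \<Rightarrow> bool" where
  "partial_u_on Q r ru \<longleftrightarrow> (\<forall>(u, v)\<in>Q.
     ((\<lambda>t. r (t, v)) has_vector_derivative ru (u, v)) (at u within {t. (t, v) \<in> Q}))"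

definition partial_v_on ::
    "(real \<times> real) set \<Rightarrow> (real \<times> real \<Rightarrow> real^3) \<Rightarrow> (real \<times> real \<Rightarrow> real^3) \<Rightarrow> bool" where
  "partial_v_on Q r rv \<longleftrightarrow> (\<forall>(u, v)\<in>Q.
     ((\<lambda>t. r (u, t)) has_vector_derivative rv (u, v)) (at v within {t. (u, t) \<in> Q}))"

text \<open>A \<open>C\<^sup>2\<close> parametrisation with first fundamental form \<open>E du\<^sup>2 + 2F du dv + G dv\<^sup>2\<close> and second
  fundamental form \<open>L du\<^sup>2 + 2M du dv + N dv\<^sup>2\<close> with respect to the unit normal in the direction of
  \<open>r\<^sub>u \<times> r\<^sub>v\<close>.\<close>

definition has_fundamental_forms ::
    "(real \<times> real) set \<Rightarrow> (real \<times> real \<Rightarrow> real^3) \<Rightarrow>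
     (real \<times> real \<Rightarrow> real) \<Rightarrow> (real \<times> real \<Rightarrow> real) \<Rightarrow> (real \<times> real \<Rightarrow> real) \<Rightarrow>
     (real \<times> real \<Rightarrow> real) \<Rightarrow> (real \<times> real \<Rightarrow> real) \<Rightarrow> (real \<times> real \<Rightarrow> real) \<Rightarrow> bool" where
  "has_fundamental_forms Q r E F G L M N \<longleftrightarrow>
     (\<exists>ru rv ruu ruv rvv.
        partial_u_on Q r ru \<and> partial_v_on Q r rv \<and>
        partial_u_on Q ru ruu \<and> partial_v_on Q ru ruv \<and>
        partial_u_on Q rv ruv \<and> partial_v_on Q rv rvv \<and>
        continuous_on Q r \<and> continuous_on Q ru \<and> continuous_on Q rv \<and>
        continuous_on Q ruu \<and> continuous_on Q ruv \<and> continuous_on Q rvv \<and>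
        (\<forall>w\<in>Q. cross3 (ru w) (rv w) \<noteq> 0 \<and>
          ru w \<bullet> ru w = E w \<and> ru w \<bullet> rv w = F w \<and> rv w \<bullet> rv w = G w \<and>
          (let \<nu> = sgn (cross3 (ru w) (rv w)) in
             ruu w \<bullet> \<nu> = L w \<and> ruv w \<bullet> \<nu> = M w \<and> rvv w \<bullet> \<nu> = N w)))"

definition ray_dir :: "nat \<Rightarrow> nat \<Rightarrow> real^3" where
  "ray_dir n k = vector [cos (real k * pi / real n), sin (real k * pi / real n), 0]"

definition amsler_ray :: "nat \<Rightarrow> nat \<Rightarrow> (real^3) set" where
  "amsler_ray n k = {t *\<^sub>R ray_dir n k | t. 0 \<le> t}"

definition amsler_piece :: "nat \<Rightarrow> (real^3) set \<Rightarrow> bool" where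
  "amsler_piece n P \<longleftrightarrow>
     (\<exists>\<phi> zn r. let Q = amsler_domain zn; \<theta> = (\<lambda>(u, v). \<phi> (2 * sqrt (u * v))) in
        amsler_profile n \<phi> zn \<and>
        has_fundamental_forms Q r
          (\<lambda>_. 1) (\<lambda>w. cos (\<theta> w)) (\<lambda>_. 1)
          (\<lambda>_. 0) (\<lambda>w. sin (\<theta> w)) (\<lambda>_. 0) \<and>
        r (0, 0) = 0 \<and>
        r ` {(u, v) \<in> Q. v = 0} = amsler_ray n 0 \<and>
        r ` {(u, v) \<in> Q. u = 0} = amsler_ray n 1 \<and>
        P = r ` Q)"

text \<open>Rotation by the angle \<open>\<pi>\<close> about the line spanned by the unit vector \<open>e\<close>.\<close>

definition half_turn :: "real^3 \<Rightarrow> real^3 \<Rightarrow> real^3" where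
  "half_turn e w = (2 * (w \<bullet> e)) *\<^sub>R e - w"

primrec amsler_copy :: "nat \<Rightarrow> (real^3) set \<Rightarrow> nat \<Rightarrow> (real^3) set" where
  "amsler_copy n P 0 = P"
| "amsler_copy n P (Suc k) = half_turn (ray_dir n (Suc k)) ` amsler_copy n P k"

definition periodic_amsler_surface :: "nat \<Rightarrow> (real^3) set \<Rightarrow> bool" where
  "periodic_amsler_surface n S \<longleftrightarrow>
     2 \<le> n \<and> (\<exists>P. amsler_piece n P \<and> S = (\<Union>k<2 * n. amsler_copy n P k))"

end

theory Submission
  imports Defs
begin

text \<open>A single smooth piece of an Amsler surface already contains isometric copies of arbitrarily large
  disks when the number \<open>n\<close> of waves is huge. Indeed, the profile solves a pendulum equation with
  friction \<open>\<phi>' / z\<close>; since \<open>\<phi>(0) = \<pi> / n\<close> is small, \<open>\<phi>\<close> leaves a neighbourhood of \<open>0\<close> only at large \<open>z\<close>, where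
  the friction is negligible, and there it follows the separatrix \<open>4 arctan (exp (z - z\<^sub>0))\<close> up to its
  singular value \<open>\<pi>\<close>. Hence near the singular edge the piece is close to a pseudosphere, in the
  asymptotic coordinates and with one derivative of the angle. The pseudosphere is intrinsically a
  horodisk, which contains every disk of given radius. The developing map of the piece into the
  hyperbolic plane is therefore a \<open>C\<^sup>1\<close>-small perturbation of an explicit chart, so it can be inverted
  over the disk, and the inverse followed by the parametrisation of the piece is a \<open>C\<^sup>2\<close> isometric
  immersion.

  The moving frame of the surface in \<open>\<real>\<^sup>3\<close> and the developing map (a moving frame of the hyperboloid
  in Minkowski space) solve the same linear system up to a sign \<open>e = -1\<close> or \<open>e = 1\<close>. It is solved
  through a Goursat problem for its first component.\<close>

section \<open>Oriented primitives and a weighted fixed point theorem\<close>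

text \<open>The centre of the disk does not matter: every hyperbolic disk lies in a closed Euclidean
  ball of radius \<open>\<rho>\<close> < 1 about the origin of the unit disk, so it suffices to
  invert the chart over such balls. The radius fixes all other data in a chain. It determines the
  shift \<open>A\<close> of the separatrix, that is, how far before the edge of the pseudosphere the
  base point lies; then the Lipschitz constant of the inverse chart and the bound \<open>K\<close>
  of the frames; then the tolerances \<open>\<epsilon>\<close> and \<open>\<eta>\<close>; and last
  the number of waves. The base point goes to a diagonal point \<open>(m, m)\<close> with
  \<open>m\<close> large, where \<open>2 * sqrt ((m + s) * (m + t))\<close> is nearly
  \<open>2 * m + s + t\<close>, so that an angle depending on the product of the coordinates looks
  like one depending on their sum. The obstacle is the edge: angle and frames are defined over the
  whole plane, but the surface is regular only where the sine of the angle is nonzero. Hence the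
  ball is kept at a fixed distance from the edge of the pseudosphere, and the tolerances are small
  against that margin. Weighted norms give solutions over the whole plane at once, without
  continuation.\<close>

definition prim :: "(real \<Rightarrow> real) \<Rightarrow> real \<Rightarrow> real" where
  "prim h x = x * integral {0..1} (\<lambda>s. h (x * s))"

definition cont2 :: "(real \<Rightarrow> real \<Rightarrow> real) \<Rightarrow> bool" where
  "cont2 f \<longleftrightarrow> continuous_on UNIV (\<lambda>z. f (fst z) (snd z))"

lemma cont2_compose:
  assumes "cont2 f" "continuous_on S g" "continuous_on S h"
  shows "continuous_on S (\<lambda>x. f (g x) (h x))"
  using continuous_on_compose2[OF assms(1)[unfolded cont2_def], of S "\<lambda>x. (g x, h x)"] assms(2,3)
  by (auto intro!: continuous_intros)

lemma continuous_real_deriv: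
  "(\<And>x. (f has_real_derivative f' x) (at x)) \<Longrightarrow> continuous_on S f"
  by (meson DERIV_isCont continuous_at_imp_continuous_on)

lemma abs_sin_diff_le: "\<bar>sin x - sin y\<bar> \<le> \<bar>x - y\<bar>" for x y :: real
  using field_differentiable_bound[of UNIV sin cos 1 x y] by (auto intro: DERIV_sin)

lemma abs_cos_diff_le: "\<bar>cos x - cos y\<bar> \<le> \<bar>x - y\<bar>" for x y :: real
  using field_differentiable_bound[of UNIV cos "\<lambda>x. - sin x" 1 x y] by (auto intro: DERIV_cos)

lemma prim_0 [simp]: "prim h 0 = 0"
  by (simp add: prim_def)

text \<open>Substituting \<open>y = x * s\<close> shows that \<open>prim\<close> is the oriented
  integral from 0 to \<open>x\<close>. The pullback to the fixed interval from 0 to 1 spares a case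
  distinction on the sign of \<open>x\<close> and allows differentiation under the integral in a
  parameter.\<close>

lemma prim_eq_diff:
  assumes "\<And>x. (H has_real_derivative h x) (at x)" "continuous_on UNIV h"
  shows "prim h x = H x - H 0"
proof -
  have "((\<lambda>s. h (x * s) * x) has_integral (H (x * 1) - H (x * 0))) {0..1}"
  proof (rule fundamental_theorem_of_calculus)
    fix s :: real
    have "((\<lambda>s. H (x * s)) has_real_derivative h (x * s) * x) (at s)"
      by (rule DERIV_chain2[OF assms(1)]) (auto intro!: derivative_eq_intros)
    then show "((\<lambda>s. H (x * s)) has_vector_derivative h (x * s) * x) (at s within {0..1})"
      by (auto simp: has_real_derivative_iff_has_vector_derivative intro: has_vector_derivative_at_within)
  qed simp
  then have "integral {0..1} (\<lambda>s. h (x * s) * x) = H x - H 0"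
    by (rule integral_unique[THEN trans]) simp
  then show ?thesis
    by (simp add: prim_def mult.commute)
qed

lemma prim_deriv:
  assumes "continuous_on UNIV h"
  shows "(prim h has_real_derivative h x) (at x)"
proof -
  define H where "H u = (LBINT y=0..u. h y)" for u :: real
  have H: "(H has_real_derivative h u) (at u)" for u
  proof -
    have "((\<lambda>u. LBINT y=0..u. h y) has_vector_derivative h u) (at u within {-\<bar>u\<bar>-1..\<bar>u\<bar>+1})"
      using interval_integral_FTC2[of "-\<bar>u\<bar>-1" 0 "\<bar>u\<bar>+1" h u] continuous_on_subset[OF assms]
      by (auto simp: zero_ereal_def)
    then show ?thesis
      by (subst (asm) at_within_interior)
        (auto simp: H_def[abs_def] has_real_derivative_iff_has_vector_derivative)
  qed
  have "prim h = (\<lambda>x. H x - H 0)"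
    using prim_eq_diff[OF H assms] by auto
  then show ?thesis
    using H by (auto intro!: derivative_eq_intros)
qed

lemma prim_diff:
  assumes "continuous_on UNIV f" "continuous_on UNIV g"
  shows "prim (\<lambda>s. f s - g s) x = prim f x - prim g x"
  using prim_eq_diff[OF DERIV_diff[OF prim_deriv[OF assms(1)] prim_deriv[OF assms(2)]]] assms
  by (auto intro!: continuous_intros)

text \<open>Integration against the weight \<open>exp (k * \<bar>x\<bar>)\<close> gains the factor
  \<open>1 / k\<close>. With \<open>k = 2\<close> this makes the integral operators below
  contractions on the whole line.\<close>

lemma prim_abs_le:
  assumes h: "continuous_on UNIV h" and k: "k > 0" and le: "\<And>s. \<bar>h s\<bar> \<le> M * exp (k * \<bar>s\<bar>)"
  shows "\<bar>prim h x\<bar> \<le> M / k * exp (k * \<bar>x\<bar>)"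
proof -
  have M: "M \<ge> 0" using le[of 0] by simp
  define c where "c = k * \<bar>x\<bar>"
  have "((\<lambda>s. exp (c * s) * c) has_integral (exp (c * 1) - exp (c * 0))) {0..1}"
    by (rule fundamental_theorem_of_calculus)
      (auto intro!: derivative_eq_intros simp flip: has_real_derivative_iff_has_vector_derivative)
  from has_integral_mult_right[OF this, of "M / k"]
  have I: "((\<lambda>s. M / k * (exp (c * s) * c)) has_integral M / k * (exp c - 1)) {0..1}"
    by simp
  have "norm (integral {0..1} (\<lambda>s. x * h (x * s))) \<le> integral {0..1} (\<lambda>s. M / k * (exp (c * s) * c))"
  proof (rule integral_norm_bound_integral)
    show "(\<lambda>s. x * h (x * s)) integrable_on {0..1}"
      by (intro integrable_continuous_interval continuous_intros continuous_on_compose2[OF h]) auto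
    show "(\<lambda>s. M / k * (exp (c * s) * c)) integrable_on {0..1}"
      using I by blast
    fix s :: real assume "s \<in> {0..1}"
    then have "\<bar>x\<bar> * \<bar>h (x * s)\<bar> \<le> \<bar>x\<bar> * (M * exp (k * (\<bar>x\<bar> * s)))"
      using le[of "x * s"] by (intro mult_left_mono) (auto simp: abs_mult)
    then show "norm (x * h (x * s)) \<le> M / k * (exp (c * s) * c)"
      using k by (simp add: abs_mult c_def algebra_simps)
  qed
  also have "\<dots> = M / k * (exp c - 1)" using I by (rule integral_unique)
  also have "\<dots> \<le> M / k * exp c" using M k by (intro mult_left_mono) auto
  finally show ?thesis by (simp add: prim_def c_def)
qed

lemma prim_continuous:
  assumes "cont2 f"
  shows "cont2 (\<lambda>y. prim (f y))"
proof -
  have "continuous_on UNIV (\<lambda>z. integral (cbox 0 1) (\<lambda>s. f (fst z) (snd z * s)))"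
    by (intro integral_continuous_on_param)
      (auto simp: split_beta intro!: cont2_compose[OF assms] continuous_intros)
  then show ?thesis
    by (auto simp: cont2_def prim_def intro!: continuous_intros)
qed

lemma cont2_imp_cont:
  assumes "cont2 f"
  shows "continuous_on S (f x)" "continuous_on S (\<lambda>x. f x y)"
  by (auto intro!: cont2_compose[OF assms] continuous_intros)

lemma prim_param_deriv:
  assumes f: "cont2 f" and fx: "cont2 fx"
    and d: "\<And>x t. ((\<lambda>x. f x t) has_real_derivative fx x t) (at x)"
  shows "((\<lambda>x. prim (f x) y) has_real_derivative prim (fx x) y) (at x)"
proof -
  have "((\<lambda>x. integral (cbox 0 1) (\<lambda>s. f x (y * s))) has_field_derivative
       integral (cbox 0 1) (\<lambda>s. fx x (y * s))) (at x within UNIV)"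
    by (rule leibniz_rule_field_derivative)
      (auto simp: split_beta d intro!: integrable_continuous_real cont2_compose[OF f] cont2_compose[OF fx]
         continuous_intros)
  then show ?thesis
    by (auto simp: prim_def intro!: derivative_eq_intros)
qed

text \<open>Banach's theorem in the norm sup \<open>\<bar>f\<bar> / w\<close>. The functions
  \<open>w * b\<close> with \<open>b\<close> bounded and continuous form the weighted space;
  conjugation of \<open>T\<close> with multiplication by \<open>w\<close> gives a contraction
  \<open>U\<close> of the complete space of bounded continuous functions.\<close>

lemma weighted_fixpoint:
  fixes T :: "('a::metric_space \<Rightarrow> real) \<Rightarrow> 'a \<Rightarrow> real"
  assumes w: "continuous_on UNIV w" "\<And>x. w x > 0" and q: "0 \<le> q" "q < 1"
    and cont: "\<And>f. continuous_on UNIV f \<Longrightarrow> continuous_on UNIV (T f)"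
    and contr: "\<And>f g M x. continuous_on UNIV f \<Longrightarrow> continuous_on UNIV g \<Longrightarrow>
      (\<And>x. \<bar>f x - g x\<bar> \<le> M * w x) \<Longrightarrow> \<bar>T f x - T g x\<bar> \<le> q * M * w x"
    and T0: "\<And>x. \<bar>T (\<lambda>_. 0) x\<bar> \<le> M0 * w x"
  obtains f where "continuous_on UNIV f" "\<And>x. T f x = f x"
proof -
  define U where "U b = (\<lambda>x. T (\<lambda>x. w x * apply_bcontfun b x) x / w x)" for b :: "'a \<Rightarrow>\<^sub>C real"
  have c: "continuous_on UNIV (\<lambda>x. w x * apply_bcontfun b x)" for b :: "'a \<Rightarrow>\<^sub>C real"
    using w by (intro continuous_intros) auto
  have w0: "w x \<noteq> 0" for x using w(2)[of x] by simp
  have U_dist: "\<bar>U b x - U b' x\<bar> \<le> q * dist b b'" for b b' x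
  proof -
    have "\<bar>T (\<lambda>x. w x * apply_bcontfun b x) x - T (\<lambda>x. w x * apply_bcontfun b' x) x\<bar> \<le> q * dist b b' * w x"
    proof (rule contr[OF c c])
      fix x
      have "\<bar>apply_bcontfun b x - apply_bcontfun b' x\<bar> \<le> dist b b'"
        using dist_bounded[of b x b'] by (simp add: dist_real_def)
      then show "\<bar>w x * apply_bcontfun b x - w x * apply_bcontfun b' x\<bar> \<le> dist b b' * w x"
        using w(2)[of x] by (simp add: abs_mult flip: right_diff_distrib)
    qed
    then show ?thesis
      using w(2)[of x] by (simp add: U_def field_simps flip: diff_divide_distrib)
  qed
  have U0: "\<bar>U 0 x\<bar> \<le> M0" for x
    using T0[of x] w(2)[of x] by (simp add: U_def zero_bcontfun.rep_eq field_simps)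
  have U_mem: "U b \<in> bcontfun" for b
  proof (rule bcontfun_normI)
    show "continuous_on UNIV (U b)"
      unfolding U_def using w w0 by (intro continuous_intros cont c) auto
    show "norm (U b x) \<le> M0 + q * dist b 0" for x
      using U_dist[of b x 0] U0[of x] by auto
  qed
  define V where "V b = Bcontfun (U b)" for b
  have V: "apply_bcontfun (V b) x = U b x" for b x
    using U_mem by (simp add: V_def Bcontfun_inverse)
  have "\<exists>!b. V b = b"
    by (rule banach_fix_type[OF q, of V, rule_format]) (auto intro!: dist_bound simp: V dist_real_def U_dist)
  then obtain b where b: "V b = b" by blast
  show ?thesis
  proof (rule that[OF c[of b]])
    fix x
    have "U b x = apply_bcontfun b x" using V[of b x] b by simp
    then show "T (\<lambda>x. w x * apply_bcontfun b x) x = w x * apply_bcontfun b x"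
      using w0[of x] by (simp add: U_def field_simps)
  qed
qed

section \<open>The Amsler angle as a function of the product of the asymptotic coordinates\<close>

text \<open>With \<open>w = z\<^sup>2 / 4\<close>, which is the product of the asymptotic
  coordinates, the singular equation of the profile becomes
  \<open>(w * \<psi>')' = sin \<psi>\<close>. Integrating once and dividing by \<open>w\<close>
  gives \<open>\<psi>' w\<close> as the mean \<open>J\<close> of \<open>sin (\<psi> (w * t))\<close>
  over \<open>t\<close> in [0, 1], which is regular at 0 and bounded by 1. A second integration is
  the fixed point equation for \<open>T\<close>.\<close>

lemma amsler_angle_exists:
  fixes c :: real
  obtains \<psi> \<psi>1 :: "real \<Rightarrow> real" where
    "\<psi> 0 = c" "\<psi>1 0 = sin c" "\<And>w. (\<psi> has_real_derivative \<psi>1 w) (at w)" "continuous_on UNIV \<psi>1"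
    "\<And>w. ((\<lambda>w. w * \<psi>1 w) has_real_derivative sin (\<psi> w)) (at w)" "\<And>w. \<bar>\<psi>1 w\<bar> \<le> 1"
proof -
  define J where "J f = (\<lambda>s. integral {0..1} (\<lambda>t. sin (f (s * t))))" for f :: "real \<Rightarrow> real"
  define T where "T f = (\<lambda>w. c + prim (J f) w)" for f
  have Jc: "continuous_on UNIV (J f)" if f: "continuous_on UNIV f" for f
  proof -
    have "continuous_on UNIV (\<lambda>s. integral (cbox 0 1) (\<lambda>t. sin (f (s * t))))"
      by (intro integral_continuous_on_param)
        (auto simp: split_beta intro!: continuous_intros continuous_on_compose2[OF f])
    then show ?thesis by (simp add: J_def)
  qed
  have int: "(\<lambda>t. sin (f (s * t))) integrable_on {0..1}" if f: "continuous_on UNIV f" for f :: "real \<Rightarrow> real" and s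
    by (intro integrable_continuous_interval continuous_intros continuous_on_compose2[OF f]) auto
  have Jb: "\<bar>J f s\<bar> \<le> 1" if f: "continuous_on UNIV f" for f s
  proof -
    have "norm (integral {0..1} (\<lambda>t. sin (f (s * t)))) \<le> integral {0..1} (\<lambda>_::real. 1::real)"
      by (rule integral_norm_bound_integral[OF int[OF f]]) auto
    then show ?thesis by (simp add: J_def)
  qed
  have Tc: "continuous_on UNIV (T f)" if "continuous_on UNIV f" for f
    unfolding T_def
    by (intro continuous_intros continuous_real_deriv[OF prim_deriv[OF Jc[OF that]]])
  obtain f where f: "continuous_on UNIV f" "\<And>x. T f x = f x"
  proof (rule weighted_fixpoint[of "\<lambda>x. exp (2 * \<bar>x\<bar>)" "1/2" T "\<bar>c\<bar> + 1"])
    fix f g :: "real \<Rightarrow> real" and M x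
    assume f: "continuous_on UNIV f" and g: "continuous_on UNIV g"
      and le: "\<And>x. \<bar>f x - g x\<bar> \<le> M * exp (2 * \<bar>x\<bar>)"
    have M: "M \<ge> 0" using le[of 0] by simp
    have d: "\<bar>J f s - J g s\<bar> \<le> M * exp (2 * \<bar>s\<bar>)" for s
    proof -
      have "J f s - J g s = integral {0..1} (\<lambda>t. sin (f (s * t)) - sin (g (s * t)))"
        unfolding J_def by (rule integral_diff[symmetric]) (intro int f g)+
      moreover have "norm (integral {0..1} (\<lambda>t. sin (f (s * t)) - sin (g (s * t))))
          \<le> integral {0..1} (\<lambda>_::real. M * exp (2 * \<bar>s\<bar>))"
      proof (rule integral_norm_bound_integral)
        show "(\<lambda>t. sin (f (s * t)) - sin (g (s * t))) integrable_on {0..1}"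
          by (intro integrable_diff int f g)
        fix t :: real assume t: "t \<in> {0..1}"
        have "\<bar>sin (f (s * t)) - sin (g (s * t))\<bar> \<le> M * exp (2 * \<bar>s * t\<bar>)"
          using abs_sin_diff_le le by (rule order_trans)
        also have "\<dots> \<le> M * exp (2 * \<bar>s\<bar>)"
          using t M by (intro mult_left_mono) (auto simp: abs_mult mult_left_le)
        finally show "norm (sin (f (s * t)) - sin (g (s * t))) \<le> M * exp (2 * \<bar>s\<bar>)" by simp
      qed (auto intro!: integrable_continuous_interval)
      ultimately show ?thesis by simp
    qed
    have "prim (J f) x - prim (J g) x = prim (\<lambda>s. J f s - J g s) x"
      using prim_diff[OF Jc[OF f] Jc[OF g]] by simp
    then show "\<bar>T f x - T g x\<bar> \<le> 1/2 * M * exp (2 * \<bar>x\<bar>)"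
      using prim_abs_le[of "\<lambda>s. J f s - J g s" 2 M x] d Jc[OF f] Jc[OF g]
      by (auto simp: T_def intro!: continuous_intros)
  next
    fix x :: real
    have "\<bar>c\<bar> * 1 \<le> \<bar>c\<bar> * exp (2 * \<bar>x\<bar>)" by (intro mult_left_mono) auto
    then show "\<bar>T (\<lambda>_. 0) x\<bar> \<le> (\<bar>c\<bar> + 1) * exp (2 * \<bar>x\<bar>)"
      by (simp add: T_def J_def prim_def algebra_simps add_increasing)
  qed (auto intro!: continuous_intros Tc)
  have fd: "(f has_real_derivative J f w) (at w)" for w
  proof -
    have "f = (\<lambda>w. c + prim (J f) w)" using f(2) by (auto simp: T_def)
    then show ?thesis
      using DERIV_add[OF DERIV_const[of c] prim_deriv[OF Jc[OF f(1)], of w]] by simp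
  qed
  show ?thesis
  proof (rule that[of f "J f"])
    show f0: "f 0 = c" using f(2)[of 0] by (simp add: T_def)
    show "J f 0 = sin c" using f0 by (simp add: J_def)
    show "((\<lambda>w. w * J f w) has_real_derivative sin (f w)) (at w)" for w
    proof -
      have "(\<lambda>w. w * J f w) = prim (\<lambda>s. sin (f s))" by (auto simp: J_def prim_def)
      then show ?thesis using prim_deriv[of "\<lambda>s. sin (f s)" w] f(1) by (auto intro!: continuous_intros)
    qed
  qed (auto intro: fd Jc f Jb)
qed

section \<open>Flat frame systems over the asymptotic coordinates\<close>

text \<open>The sine-Gordon equation in first order form, with \<open>\<phi>1\<close> as the
  \<open>u\<close>-derivative of the angle. Constancy on the axes makes the frame equations there
  solvable by elementary functions.\<close>

locale flat_angle =
  fixes \<phi> \<phi>1 :: "real \<Rightarrow> real \<Rightarrow> real" and c :: real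
  assumes \<phi>_cont: "cont2 \<phi>" and \<phi>1_cont: "cont2 \<phi>1"
    and \<phi>_u: "\<And>u v. ((\<lambda>u. \<phi> u v) has_real_derivative \<phi>1 u v) (at u)"
    and \<phi>1_v: "\<And>u v. ((\<lambda>v. \<phi>1 u v) has_real_derivative sin (\<phi> u v)) (at v)"
    and \<phi>_axis: "\<And>u. \<phi> u 0 = c" "\<And>v. \<phi> 0 v = c"

text \<open>A triple is one coordinate of a moving frame. For \<open>e = -1\<close>,
  \<open>n\<close> belongs to the unit normal of the surface, \<open>p\<close> to its
  \<open>u\<close>-derivative and \<open>s\<close> to the unit tangent of the
  \<open>u\<close>-curves. For \<open>e = 1\<close>, \<open>n\<close> belongs to the point of the
  hyperboloid, \<open>p\<close> to the unit tangent of the \<open>u\<close>-curve, and the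
  \<open>v\<close>-curve makes the angle \<open>\<phi>\<close> with it.\<close>

definition frame_system :: "real \<Rightarrow> (real \<Rightarrow> real \<Rightarrow> real) \<Rightarrow> (real \<Rightarrow> real \<Rightarrow> real) \<Rightarrow>
    (real \<Rightarrow> real \<Rightarrow> real) \<Rightarrow> (real \<Rightarrow> real \<Rightarrow> real) \<Rightarrow> (real \<Rightarrow> real \<Rightarrow> real) \<Rightarrow> bool" where
  "frame_system e \<phi> \<phi>1 n p s \<longleftrightarrow> cont2 n \<and> cont2 p \<and> cont2 s \<and>
    (\<forall>u v. ((\<lambda>u. n u v) has_real_derivative p u v) (at u) \<and>
           ((\<lambda>u. p u v) has_real_derivative e * n u v - \<phi>1 u v * s u v) (at u) \<and>
           ((\<lambda>u. s u v) has_real_derivative \<phi>1 u v * p u v) (at u) \<and>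
           ((\<lambda>v. n u v) has_real_derivative e * (cos (\<phi> u v) * p u v + sin (\<phi> u v) * s u v)) (at v) \<and>
           ((\<lambda>v. p u v) has_real_derivative cos (\<phi> u v) * n u v) (at v) \<and>
           ((\<lambda>v. s u v) has_real_derivative sin (\<phi> u v) * n u v) (at v))"

lemma frame_systemD:
  assumes "frame_system e \<phi> \<phi>1 n p s"
  shows "cont2 n" "cont2 p" "cont2 s"
    "((\<lambda>u. n u v) has_real_derivative p u v) (at u)"
    "((\<lambda>u. p u v) has_real_derivative e * n u v - \<phi>1 u v * s u v) (at u)"
    "((\<lambda>u. s u v) has_real_derivative \<phi>1 u v * p u v) (at u)"
    "((\<lambda>v. n u v) has_real_derivative e * (cos (\<phi> u v) * p u v + sin (\<phi> u v) * s u v)) (at v)"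
    "((\<lambda>v. p u v) has_real_derivative cos (\<phi> u v) * n u v) (at v)"
    "((\<lambda>v. s u v) has_real_derivative sin (\<phi> u v) * n u v) (at v)"
  using assms unfolding frame_system_def by auto

lemma const_in_2_variables:
  fixes f :: "real \<Rightarrow> real \<Rightarrow> real"
  assumes "\<And>u v. ((\<lambda>u. f u v) has_real_derivative 0) (at u)"
    and "\<And>u v. ((\<lambda>v. f u v) has_real_derivative 0) (at v)"
  shows "f u v = f a b"
proof -
  have "f u v = f a v" using DERIV_isconst_all[of "\<lambda>u. f u v" u a] assms(1) by auto
  also have "\<dots> = f a b" using DERIV_isconst_all[of "\<lambda>v. f a v" v b] assms(2) by auto
  finally show ?thesis .
qed

text \<open>The coefficient matrices of the system are skew for this form, which is definite for
  \<open>e = -1\<close> and Lorentzian for \<open>e = 1\<close>. Its invariance keeps frames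
  orthonormal.\<close>

lemma frame_system_form_const:
  assumes F: "frame_system e \<phi> \<phi>1 n p s" and G: "frame_system e \<phi> \<phi>1 n' p' s'" and e: "e = 1 \<or> e = -1"
  shows "n u v * n' u v - e * (p u v * p' u v + s u v * s' u v)
       = n a b * n' a b - e * (p a b * p' a b + s a b * s' a b)"
proof (rule const_in_2_variables[where f = "\<lambda>u v. n u v * n' u v - e * (p u v * p' u v + s u v * s' u v)"])
  fix u v
  show "((\<lambda>u. n u v * n' u v - e * (p u v * p' u v + s u v * s' u v)) has_real_derivative 0) (at u)"
    using e by (elim disjE) (auto intro!: derivative_eq_intros frame_systemD(4-6)[OF F] frame_systemD(4-6)[OF G]
       simp: algebra_simps)
  show "((\<lambda>v. n u v * n' u v - e * (p u v * p' u v + s u v * s' u v)) has_real_derivative 0) (at v)"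
    using e by (elim disjE) (auto intro!: derivative_eq_intros frame_systemD(7-9)[OF F] frame_systemD(7-9)[OF G]
       simp: algebra_simps)
qed

lemma frame_system_lincomb:
  assumes F: "frame_system e \<phi> \<phi>1 n p s" and G: "frame_system e \<phi> \<phi>1 n' p' s'"
  shows "frame_system e \<phi> \<phi>1 (\<lambda>u v. a * n u v + b * n' u v) (\<lambda>u v. a * p u v + b * p' u v)
     (\<lambda>u v. a * s u v + b * s' u v)"
  unfolding frame_system_def
  using frame_systemD(1-3)[OF F] frame_systemD(1-3)[OF G]
  by (auto simp: cont2_def algebra_simps
      intro!: continuous_intros derivative_eq_intros frame_systemD(4-9)[OF F] frame_systemD(4-9)[OF G])

section \<open>The Goursat problem and the existence of frames\<close>

lemma goursat_homogeneous:
  fixes Y W :: "real \<Rightarrow> real \<Rightarrow> real"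
  assumes Y: "cont2 Y" and W: "cont2 W" and k: "cont2 k" "\<And>u v. \<bar>k u v\<bar> \<le> 1"
    and Yv: "\<And>u v. ((\<lambda>v. Y u v) has_real_derivative e * W u v) (at v)"
    and Wu: "\<And>u v. ((\<lambda>u. W u v) has_real_derivative e * k u v * Y u v) (at u)"
    and e: "\<bar>e\<bar> = 1" and axis: "\<And>u. Y u 0 = 0" "\<And>v. W 0 v = 0"
  shows "Y u v = 0 \<and> W u v = 0"
proof -
  define L where "L = \<bar>u\<bar> + \<bar>v\<bar>"
  define w where "w x y = exp (2 * (\<bar>x\<bar> + \<bar>y\<bar>))" for x y :: real
  define K where "K = cbox (-L, -L) (L, L)"
  have L: "L \<ge> 0" by (simp add: L_def)
  text \<open>Each of the two integrations halves the weighted bound \<open>M w\<close> of \<open>Y\<close> on the square \<open>K\<close>.\<close>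
  have "continuous_on K (\<lambda>z. \<bar>Y (fst z) (snd z)\<bar> / w (fst z) (snd z))"
    using Y unfolding cont2_def w_def
    by (intro continuous_intros continuous_on_subset[OF Y[unfolded cont2_def]]) auto
  moreover have "compact K" unfolding K_def by (rule compact_cbox)
  moreover have "K \<noteq> {}" using L by (auto simp: K_def cbox_Pair_eq)
  ultimately obtain z0 where z0: "z0 \<in> K"
    and max: "\<And>z. z \<in> K \<Longrightarrow> \<bar>Y (fst z) (snd z)\<bar> / w (fst z) (snd z) \<le> \<bar>Y (fst z0) (snd z0)\<bar> / w (fst z0) (snd z0)"
    using continuous_attains_sup[of K] by blast
  define M where "M = \<bar>Y (fst z0) (snd z0)\<bar> / w (fst z0) (snd z0)"
  have M0: "M \<ge> 0" by (simp add: M_def w_def)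
  have bY: "\<bar>Y x y\<bar> \<le> M * w x y" if "\<bar>x\<bar> \<le> L" "\<bar>y\<bar> \<le> L" for x y
  proof -
    have "(x, y) \<in> K" using that by (auto simp: K_def cbox_Pair_eq abs_le_iff)
    from max[OF this] have "\<bar>Y x y\<bar> / w x y \<le> M" by (simp add: M_def)
    then show ?thesis by (simp add: w_def divide_le_eq)
  qed
  \<comment> \<open>The integral estimate \<open>prim_abs_le\<close> asks for a bound on the whole
    line, while \<open>Y\<close> and \<open>W\<close> are controlled on the square only. Clamping
    the argument changes no integral that stays inside the square.\<close>
  define cl where "cl x = max (-L) (min L x)" for x
  have cl: "\<bar>cl x\<bar> \<le> L" "\<bar>cl x\<bar> \<le> \<bar>x\<bar>" for x using L by (auto simp: cl_def)
  have clid: "cl x = x" if "\<bar>x\<bar> \<le> L" for x using that by (auto simp: cl_def)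
  have clc: "continuous_on S (\<lambda>x. cl x)" for S unfolding cl_def by (intro continuous_intros)
  have prim_cl: "prim (\<lambda>x. h (cl x)) x = prim h x" if "\<bar>x\<bar> \<le> L" for h x
  proof -
    have "integral {0..1} (\<lambda>s. h (cl (x * s))) = integral {0..1} (\<lambda>s. h (x * s))"
    proof (rule integral_cong)
      fix s :: real assume "s \<in> {0..1}"
      then have "\<bar>x * s\<bar> \<le> L" using that by (auto simp: abs_mult intro: order_trans[OF mult_left_le])
      then show "h (cl (x * s)) = h (x * s)" by (simp add: clid)
    qed
    then show ?thesis by (simp add: prim_def)
  qed
  have bound: "\<bar>prim h x\<bar> \<le> m / 2 * exp (2 * \<bar>x\<bar>)"
    if "\<bar>x\<bar> \<le> L" "continuous_on UNIV h" "m \<ge> 0" "\<And>s. \<bar>s\<bar> \<le> L \<Longrightarrow> \<bar>h s\<bar> \<le> m * exp (2 * \<bar>s\<bar>)" for h x m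
  proof -
    have "\<bar>prim (\<lambda>x. h (cl x)) x\<bar> \<le> m / 2 * exp (2 * \<bar>x\<bar>)"
    proof (rule prim_abs_le)
      show "continuous_on UNIV (\<lambda>x. h (cl x))"
        by (rule continuous_on_compose2[OF that(2) clc]) auto
      fix s
      have "\<bar>h (cl s)\<bar> \<le> m * exp (2 * \<bar>cl s\<bar>)" using cl that(4) by blast
      also have "\<dots> \<le> m * exp (2 * \<bar>s\<bar>)" using cl(2)[of s] \<open>m \<ge> 0\<close> by (intro mult_left_mono) auto
      finally show "\<bar>h (cl s)\<bar> \<le> m * exp (2 * \<bar>s\<bar>)" .
    qed simp
    then show ?thesis using prim_cl[OF that(1)] by simp
  qed
  have bW: "\<bar>W x y\<bar> \<le> M / 2 * w x y" if x: "\<bar>x\<bar> \<le> L" and y: "\<bar>y\<bar> \<le> L" for x y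
  proof -
    have c: "continuous_on UNIV (\<lambda>x. e * k x y * Y x y)"
      by (intro continuous_intros cont2_imp_cont Y k)
    have "W x y = prim (\<lambda>x. e * k x y * Y x y) x"
      using prim_eq_diff[OF Wu c, of x] axis by simp
    also have "\<bar>\<dots>\<bar> \<le> (M * exp (2 * \<bar>y\<bar>)) / 2 * exp (2 * \<bar>x\<bar>)"
    proof (rule bound[OF x c])
      fix s assume s: "\<bar>s\<bar> \<le> L"
      have "\<bar>e * k s y * Y s y\<bar> \<le> 1 * (M * w s y)"
        unfolding abs_mult e using bY[OF s y] k(2) by (intro mult_mono) auto
      then show "\<bar>e * k s y * Y s y\<bar> \<le> M * exp (2 * \<bar>y\<bar>) * exp (2 * \<bar>s\<bar>)"
        by (simp add: w_def algebra_simps exp_add)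
    qed (use M0 in auto)
    finally show ?thesis by (simp add: w_def algebra_simps exp_add)
  qed
  have bY2: "\<bar>Y x y\<bar> \<le> M / 4 * w x y" if x: "\<bar>x\<bar> \<le> L" and y: "\<bar>y\<bar> \<le> L" for x y
  proof -
    have c: "continuous_on UNIV (\<lambda>y. e * W x y)"
      by (intro continuous_intros cont2_imp_cont W)
    have "Y x y = prim (\<lambda>y. e * W x y) y"
      using prim_eq_diff[OF Yv c, of y] axis by simp
    also have "\<bar>\<dots>\<bar> \<le> (M / 2 * exp (2 * \<bar>x\<bar>)) / 2 * exp (2 * \<bar>y\<bar>)"
    proof (rule bound[OF y c])
      fix s assume s: "\<bar>s\<bar> \<le> L"
      show "\<bar>e * W x s\<bar> \<le> M / 2 * exp (2 * \<bar>x\<bar>) * exp (2 * \<bar>s\<bar>)"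
        using bW[OF x s] e by (simp add: abs_mult w_def algebra_simps exp_add)
    qed (use M0 in auto)
    finally show ?thesis by (simp add: w_def algebra_simps exp_add)
  qed
  \<comment> \<open>At \<open>z0\<close> the maximum \<open>M\<close> is attained, so the improved
    bound contradicts \<open>M > 0\<close>.\<close>
  have "M \<le> M / 4"
    using bY2[of "fst z0" "snd z0"] z0 by (auto simp: M_def K_def cbox_Pair_eq w_def field_simps)
  then have "M = 0" using M0 by simp
  moreover have "\<bar>u\<bar> \<le> L" "\<bar>v\<bar> \<le> L" by (auto simp: L_def)
  ultimately show ?thesis using bY[of u v] bW[of u v] by simp
qed

text \<open>The integral form of \<open>n_uv = k * n\<close>. Each of the two integrations gains 1/2
  in the weight, so the contraction factor is 1/4 on the whole plane; the axis data \<open>d\<close>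
  only have to grow no faster than the weight.\<close>

lemma goursat_exists:
  fixes k :: "real \<Rightarrow> real \<Rightarrow> real"
  assumes k: "cont2 k" "\<And>u v. \<bar>k u v\<bar> \<le> 1"
    and d: "cont2 d" "\<And>u v. \<bar>d u v\<bar> \<le> M0 * exp (2 * (\<bar>u\<bar> + \<bar>v\<bar>))"
  obtains n where "cont2 n" "\<And>u v. n u v = d u v + prim (\<lambda>s. prim (\<lambda>t. k s t * n s t) v) u"
proof -
  define J where "J f s v = prim (\<lambda>t. k s t * f (s, t)) v" for f :: "real \<times> real \<Rightarrow> real" and s v
  define T where "T f z = d (fst z) (snd z) + prim (\<lambda>s. J f s (snd z)) (fst z)"
    for f :: "real \<times> real \<Rightarrow> real" and z
  define w where "w z = exp (2 * (\<bar>fst z\<bar> + \<bar>snd z\<bar>))" for z :: "real \<times> real"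
  have kf: "cont2 (\<lambda>s t. k s t * f (s, t))" if f: "continuous_on UNIV f" for f :: "real \<times> real \<Rightarrow> real"
    unfolding cont2_def by (intro continuous_intros cont2_compose[OF k(1)] continuous_on_compose2[OF f]) auto
  have Jc: "cont2 (J f)" if f: "continuous_on UNIV f" for f
    using prim_continuous[OF kf[OF f]] unfolding J_def[abs_def] by simp
  have PJc: "continuous_on UNIV (\<lambda>z. prim (\<lambda>s. J f s (snd z)) (fst z))" if f: "continuous_on UNIV f" for f
  proof -
    have "cont2 (\<lambda>y s. J f s y)" unfolding cont2_def
      by (intro cont2_compose[OF Jc[OF f]] continuous_intros)
    from cont2_compose[OF prim_continuous[OF this], of UNIV snd fst] show ?thesis
      using continuous_on_fst[OF continuous_on_id] continuous_on_snd[OF continuous_on_id] by blast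
  qed
  obtain f where f: "continuous_on UNIV f" "\<And>x. T f x = f x"
  proof (rule weighted_fixpoint[of w "1/4" T M0])
    show "continuous_on UNIV w" unfolding w_def by (intro continuous_intros)
    show "continuous_on UNIV (T f)" if "continuous_on UNIV f" for f
      unfolding T_def using d(1) by (intro continuous_intros PJc that) (simp add: cont2_def)
    show "\<bar>T (\<lambda>_. 0) x\<bar> \<le> M0 * w x" for x
      using d(2) by (simp add: T_def J_def w_def prim_def)
    fix f g :: "real \<times> real \<Rightarrow> real" and M x
    assume f: "continuous_on UNIV f" and g: "continuous_on UNIV g" and le: "\<And>x. \<bar>f x - g x\<bar> \<le> M * w x"
    have M: "M \<ge> 0" using le[of 0] by (simp add: w_def)
    have J: "\<bar>J f s t - J g s t\<bar> \<le> M * exp (2 * \<bar>s\<bar>) / 2 * exp (2 * \<bar>t\<bar>)" for s t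
    proof -
      have "J f s t - J g s t = prim (\<lambda>t. k s t * f (s, t) - k s t * g (s, t)) t"
        unfolding J_def using cont2_imp_cont(1)[OF kf[OF f]] cont2_imp_cont(1)[OF kf[OF g]]
        by (intro prim_diff[symmetric])
      also have "\<bar>\<dots>\<bar> \<le> M * exp (2 * \<bar>s\<bar>) / 2 * exp (2 * \<bar>t\<bar>)"
      proof (rule prim_abs_le)
        show "continuous_on UNIV (\<lambda>t. k s t * f (s, t) - k s t * g (s, t))"
          using cont2_imp_cont(1)[OF kf[OF f]] cont2_imp_cont(1)[OF kf[OF g]] by (rule continuous_on_diff)
        fix r
        have "\<bar>k s r * (f (s, r) - g (s, r))\<bar> \<le> 1 * (M * w (s, r))"
          unfolding abs_mult using k(2)[of s r] le[of "(s, r)"] by (intro mult_mono) auto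
        then show "\<bar>k s r * f (s, r) - k s r * g (s, r)\<bar> \<le> M * exp (2 * \<bar>s\<bar>) * exp (2 * \<bar>r\<bar>)"
          by (simp add: w_def algebra_simps exp_add)
      qed simp
      finally show ?thesis .
    qed
    have "T f x - T g x = prim (\<lambda>s. J f s (snd x) - J g s (snd x)) (fst x)"
      unfolding T_def using cont2_imp_cont(2)[OF Jc[OF f]] cont2_imp_cont(2)[OF Jc[OF g]]
      by (simp add: prim_diff)
    also have "\<bar>\<dots>\<bar> \<le> M * exp (2 * \<bar>snd x\<bar>) / 2 / 2 * exp (2 * \<bar>fst x\<bar>)"
    proof (rule prim_abs_le)
      show "continuous_on UNIV (\<lambda>s. J f s (snd x) - J g s (snd x))"
        using cont2_imp_cont(2)[OF Jc[OF f]] cont2_imp_cont(2)[OF Jc[OF g]] by (intro continuous_on_diff)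
      show "\<bar>J f s (snd x) - J g s (snd x)\<bar> \<le> M * exp (2 * \<bar>snd x\<bar>) / 2 * exp (2 * \<bar>s\<bar>)" for s
        using J[of s "snd x"] by (simp add: algebra_simps)
    qed simp
    finally show "\<bar>T f x - T g x\<bar> \<le> 1/4 * M * w x" by (simp add: w_def algebra_simps exp_add)
  qed (auto simp: w_def)
  show ?thesis
  proof (rule that[of "\<lambda>u v. f (u, v)"])
    show "cont2 (\<lambda>u v. f (u, v))" using f(1) by (simp add: cont2_def)
    show "f (u, v) = d u v + prim (\<lambda>s. prim (\<lambda>t. k s t * f (s, t)) v) u" for u v
      using f(2)[of "(u, v)"] by (simp add: T_def J_def)
  qed
qed


text \<open>From \<open>n_u = p\<close> and \<open>p_v = cos \<phi> * n\<close>, the component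
  \<open>n\<close> satisfies \<open>n_uv = cos \<phi> * n\<close> by itself, and its values on the
  axes are forced by the initial data. After solving this Goursat problem, \<open>p\<close> and
  \<open>s\<close> follow by integration in \<open>v\<close>; what is left is the compatibility with
  the three remaining equations.\<close>

lemma (in flat_angle) frame_system_exists_0:
  assumes e: "e = 1 \<or> e = -1"
  obtains n p s where "frame_system e \<phi> \<phi>1 n p s" "n 0 0 = n0" "p 0 0 = p0" "s 0 0 = s0"
proof -
  \<comment> \<open>\<open>C\<close> and \<open>S\<close> are the solutions of
    \<open>y'' = e * y\<close> with data (1, 0) and (0, 1), in which the values on the axes are
    expressed.\<close>
  define C where "C x = (if e = 1 then cosh x else cos x)" for x :: real
  define S where "S x = (if e = 1 then sinh x else sin x)" for x :: real
  have CS0: "C 0 = 1" "S 0 = 0" by (auto simp: C_def S_def)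
  have Cd: "(C has_real_derivative e * S x) (at x)" and Sd: "(S has_real_derivative C x) (at x)" for x
    using e by (auto simp: C_def[abs_def] S_def[abs_def] intro!: derivative_eq_intros)
  note CSd = DERIV_chain2[OF Cd] DERIV_chain2[OF Sd]
  have cb: "\<bar>cosh x\<bar> \<le> exp (2 * \<bar>x\<bar>)" "\<bar>sinh x\<bar> \<le> exp (2 * \<bar>x\<bar>)" for x :: real
  proof -
    define E where "E = exp (2 * \<bar>x\<bar>)"
    have "exp x \<le> E" "exp (-x) \<le> E" "0 < exp x" "0 < exp (-x)"
      by (auto simp: E_def)
    moreover have "\<bar>(a + b) / 2\<bar> \<le> E \<and> \<bar>(a - b) / 2\<bar> \<le> E"
      if "a \<le> E" "b \<le> E" "0 < a" "0 < b" for a b E :: real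
      using that by (auto simp: abs_le_iff field_simps)
    ultimately show "\<bar>cosh x\<bar> \<le> exp (2 * \<bar>x\<bar>)" "\<bar>sinh x\<bar> \<le> exp (2 * \<bar>x\<bar>)"
      unfolding cosh_field_def sinh_field_def E_def by blast+
  qed
  have ge1: "\<bar>x\<bar> \<le> 1 \<Longrightarrow> \<bar>x\<bar> \<le> exp (2 * \<bar>y\<bar>)" for x y :: real
    by (rule order_trans[of _ 1]) auto
  have CSb: "\<bar>C x\<bar> \<le> exp (2 * \<bar>x\<bar>)" "\<bar>S x\<bar> \<le> exp (2 * \<bar>x\<bar>)" for x
    using cb ge1 by (auto simp: C_def S_def)
  have Cc: "continuous_on X C" "continuous_on X S" for X
    by (auto intro!: continuous_real_deriv Cd Sd)
  \<comment> \<open>The \<open>v\<close>-derivative of \<open>n\<close> at the origin must be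
    \<open>e * q0\<close>. The function \<open>d\<close> below is the sum of the values of
    \<open>n\<close> on the two axes minus the corner value counted twice.\<close>
  define q0 where "q0 = cos c * p0 + sin c * s0"
  define d where "d u v = n0 * C u + p0 * S u + n0 * C v + e * q0 * S v - n0" for u v
  define D where "D = \<bar>n0\<bar> + \<bar>p0\<bar> + \<bar>n0\<bar> + \<bar>q0\<bar> + \<bar>n0\<bar>"
  have ee: "e * (e * x) = x" "\<bar>e\<bar> = 1" for x using e by auto
  have dc: "cont2 d"
    unfolding cont2_def d_def by (intro continuous_intros continuous_on_compose2[OF Cc(1)] continuous_on_compose2[OF Cc(2)]) auto
  have db: "\<bar>d u v\<bar> \<le> D * exp (2 * (\<bar>u\<bar> + \<bar>v\<bar>))" for u v
  proof -
    define E where "E = exp (2 * (\<bar>u\<bar> + \<bar>v\<bar>))"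
    have "exp (2 * \<bar>u\<bar>) \<le> E" "exp (2 * \<bar>v\<bar>) \<le> E" "1 \<le> E" by (auto simp: E_def)
    then have "\<bar>C u\<bar> \<le> E" "\<bar>S u\<bar> \<le> E" "\<bar>C v\<bar> \<le> E" "\<bar>S v\<bar> \<le> E" "1 \<le> E"
      using CSb[of u] CSb[of v] by linarith+
    then have "\<bar>n0 * C u\<bar> \<le> \<bar>n0\<bar> * E" "\<bar>p0 * S u\<bar> \<le> \<bar>p0\<bar> * E" "\<bar>n0 * C v\<bar> \<le> \<bar>n0\<bar> * E"
      "\<bar>e * q0 * S v\<bar> \<le> \<bar>q0\<bar> * E" "\<bar>n0\<bar> \<le> \<bar>n0\<bar> * E"
      using ee by (auto simp: abs_mult mult_left_mono mult_le_cancel_left1)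
    then have "\<bar>d u v\<bar> \<le> \<bar>n0\<bar> * E + \<bar>p0\<bar> * E + \<bar>n0\<bar> * E + \<bar>q0\<bar> * E + \<bar>n0\<bar> * E"
      unfolding d_def by linarith
    then show ?thesis by (simp add: D_def E_def algebra_simps)
  qed
  have cosc: "cont2 (\<lambda>u v. cos (\<phi> u v))" and sinc: "cont2 (\<lambda>u v. sin (\<phi> u v))"
    using \<phi>_cont unfolding cont2_def by (auto intro: continuous_intros)
  obtain n where nc: "cont2 n"
    and n: "\<And>u v. n u v = d u v + prim (\<lambda>s. prim (\<lambda>t. cos (\<phi> s t) * n s t) v) u"
    by (rule goursat_exists[OF cosc abs_cos_le_one dc db]) blast
  define k where "k u v = cos (\<phi> u v) * n u v" for u v
  define l where "l u v = sin (\<phi> u v) * n u v" for u v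
  have kc: "cont2 k" and lc: "cont2 l"
    using cosc sinc nc unfolding cont2_def k_def l_def by (auto intro: continuous_intros)
  \<comment> \<open>On the axis \<open>v = 0\<close> the derivative \<open>\<phi>1\<close> vanishes,
    so there \<open>s\<close> is constant and \<open>p\<close> is the derivative of
    \<open>n0 * C + p0 * S\<close>; from these values the \<open>v\<close>-equations are integrated.
    \<open>m\<close> will be the \<open>v\<close>-derivative of \<open>n\<close> as the integral
    equation gives it.\<close>
  define p where "p u v = n0 * (e * S u) + p0 * C u + prim (k u) v" for u v
  define s where "s u v = s0 + prim (l u) v" for u v
  define m where "m u v = n0 * (e * S v) + e * q0 * C v + prim (\<lambda>u. k u v) u" for u v
  have pkc: "cont2 (\<lambda>u v. prim (k u) v)" "cont2 (\<lambda>u v. prim (l u) v)"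
    using prim_continuous[OF kc] prim_continuous[OF lc] by auto
  have pc: "cont2 p"
    unfolding cont2_def p_def using pkc[unfolded cont2_def]
    by (intro continuous_intros continuous_on_compose2[OF Cc(1)] continuous_on_compose2[OF Cc(2)]) auto
  have sc: "cont2 s"
    unfolding cont2_def s_def using pkc[unfolded cont2_def] by (intro continuous_intros) auto
  have n_alt: "n u v = d u v + prim (\<lambda>s. prim (k s) v) u" for u v
    using n[of u v] by (simp add: k_def[abs_def])
  have nu: "((\<lambda>u. n u v) has_real_derivative p u v) (at u)" for u v
  proof -
    have "((\<lambda>u. d u v + prim (\<lambda>s. prim (k s) v) u) has_real_derivative p u v) (at u)"
      unfolding d_def p_def
      by (rule derivative_eq_intros CSd prim_deriv cont2_imp_cont(2)[OF pkc(1)] refl | simp)+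
    then show ?thesis by (simp add: n_alt)
  qed
  have kc': "cont2 (\<lambda>t u. k u t)"
    unfolding cont2_def by (intro cont2_compose[OF kc] continuous_intros)
  have nv: "((\<lambda>v. n u v) has_real_derivative m u v) (at v)" for u v
  proof -
    have "((\<lambda>v. prim (\<lambda>s. prim (k s) v) u) has_real_derivative prim (\<lambda>s. k s v) u) (at v)"
    proof (rule prim_param_deriv)
      show "cont2 (\<lambda>v s. prim (k s) v)"
        unfolding cont2_def by (intro cont2_compose[OF pkc(1)] continuous_intros)
      show "cont2 (\<lambda>v s. k s v)" by (rule kc')
    qed (intro prim_deriv cont2_imp_cont kc)
    then have "((\<lambda>v. d u v + prim (\<lambda>s. prim (k s) v) u) has_real_derivative m u v) (at v)"
      unfolding d_def m_def
      by - (rule derivative_eq_intros CSd refl | assumption | simp)+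
    then show ?thesis by (simp add: n_alt)
  qed
  have pv: "((\<lambda>v. p u v) has_real_derivative k u v) (at v)"
    and sv: "((\<lambda>v. s u v) has_real_derivative l u v) (at v)" for u v
    unfolding p_def s_def
    by (rule derivative_eq_intros prim_deriv cont2_imp_cont(1) kc lc refl | simp)+
  define ku where "ku u v = cos (\<phi> u v) * p u v - sin (\<phi> u v) * \<phi>1 u v * n u v" for u v
  define lu where "lu u v = sin (\<phi> u v) * p u v + cos (\<phi> u v) * \<phi>1 u v * n u v" for u v
  have kuc: "cont2 ku" "cont2 lu"
    unfolding cont2_def ku_def lu_def
    using cosc sinc nc pc \<phi>1_cont by (auto simp: cont2_def intro!: continuous_intros)
  have kd: "((\<lambda>u. k u v) has_real_derivative ku u v) (at u)"
    and ld: "((\<lambda>u. l u v) has_real_derivative lu u v) (at u)" for u v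
    unfolding k_def l_def ku_def lu_def
    by (auto intro!: derivative_eq_intros nu \<phi>_u)
  define pu where "pu u v = n0 * (e * C u) + p0 * (e * S u) + prim (ku u) v" for u v
  define su where "su u v = prim (lu u) v" for u v
  have pu: "((\<lambda>u. p u v) has_real_derivative pu u v) (at u)" for u v
    using prim_param_deriv[OF kc kuc(1) kd, of v u] unfolding p_def pu_def
    by - (rule derivative_eq_intros CSd refl | assumption | simp)+
  have su: "((\<lambda>u. s u v) has_real_derivative su u v) (at u)" for u v
    using prim_param_deriv[OF lc kuc(2) ld, of v u] unfolding s_def su_def
    by - (rule derivative_eq_intros refl | assumption | simp)+
  have puv: "((\<lambda>v. pu u v) has_real_derivative ku u v) (at v)"
    and suv: "((\<lambda>v. su u v) has_real_derivative lu u v) (at v)" for u v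
    unfolding pu_def su_def
    by (rule derivative_eq_intros prim_deriv cont2_imp_cont(1) kuc refl | simp)+
  have mu: "((\<lambda>u. m u v) has_real_derivative k u v) (at u)" for u v
    unfolding m_def
    by (rule derivative_eq_intros prim_deriv cont2_imp_cont(2) kc refl | simp)+
  have \<phi>10: "\<phi>1 u 0 = 0" for u
    using DERIV_unique[OF \<phi>_u[of 0 u]] \<phi>_axis(1) by (auto intro: derivative_eq_intros)
  text \<open>The first compatibility defect is constant in \<open>v\<close>; the other two satisfy a homogeneous
    Goursat problem.\<close>
  have X: "su u v = \<phi>1 u v * p u v" for u v
  proof -
    have "((\<lambda>v. su u v - \<phi>1 u v * p u v) has_real_derivative 0) (at v)" for v
      by (rule derivative_eq_intros suv \<phi>1_v pv refl)+ (simp add: lu_def k_def)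
    from DERIV_isconst_all[of "\<lambda>v. su u v - \<phi>1 u v * p u v" v 0] this
    have "su u v - \<phi>1 u v * p u v = su u 0 - \<phi>1 u 0 * p u 0" by blast
    then show ?thesis by (simp add: su_def \<phi>10)
  qed
  define Y where "Y u v = pu u v + \<phi>1 u v * s u v - e * n u v" for u v
  define W where "W u v = e * (cos (\<phi> u v) * p u v + sin (\<phi> u v) * s u v) - m u v" for u v
  have YW: "Y u v = 0 \<and> W u v = 0" for u v
  proof (rule goursat_homogeneous[where Y = Y and W = W and k = "\<lambda>u v. cos (\<phi> u v)" and e = e])
    have "cont2 pu"
      unfolding cont2_def pu_def using prim_continuous[OF kuc(1)]
      by (intro continuous_intros continuous_on_compose2[OF Cc(1)] continuous_on_compose2[OF Cc(2)]) (auto simp: cont2_def)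
    then show "cont2 Y" unfolding Y_def using \<phi>1_cont sc nc by (auto simp: cont2_def intro!: continuous_intros)
    have "cont2 (\<lambda>u v. prim (\<lambda>u. k u v) u)"
      unfolding cont2_def by (intro cont2_compose[OF prim_continuous[OF kc']] continuous_intros)
    then have "cont2 m"
      unfolding cont2_def m_def
      by (intro continuous_intros continuous_on_compose2[OF Cc(1)] continuous_on_compose2[OF Cc(2)]) (auto simp: cont2_def)
    then show "cont2 W" unfolding W_def using cosc sinc pc sc by (auto simp: cont2_def intro!: continuous_intros)
    show "cont2 (\<lambda>u v. cos (\<phi> u v))" by (rule cosc)
    show "((\<lambda>v. Y u v) has_real_derivative e * W u v) (at v)" for u v
      unfolding Y_def
      by (rule derivative_eq_intros puv \<phi>1_v sv nv refl)+
        (use e in \<open>auto simp: W_def ku_def l_def algebra_simps\<close>)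
    show "((\<lambda>u. W u v) has_real_derivative e * cos (\<phi> u v) * Y u v) (at u)" for u v
      unfolding W_def
      by (rule derivative_eq_intros pu su mu \<phi>_u refl)+
        (use e in \<open>auto simp: Y_def X k_def algebra_simps\<close>)
    show "Y u 0 = 0" for u
      by (simp add: Y_def pu_def \<phi>10 n_alt d_def CS0 prim_def algebra_simps)
    show "W 0 v = 0" for v
    proof -
      have n0v: "n 0 v = n0 * C v + e * q0 * S v" for v by (simp add: n_alt d_def CS0)
      have I: "prim (\<lambda>v. n 0 v) v = n0 * S v + q0 * (C v - 1)" for v
      proof -
        have "((\<lambda>v. n0 * S v + q0 * C v) has_real_derivative n 0 v) (at v)" for v
          by (rule derivative_eq_intros CSd refl)+ (simp add: n0v)
        from prim_eq_diff[OF this cont2_imp_cont(1)[OF nc]] show ?thesis by (simp add: CS0 algebra_simps)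
      qed
      have "prim (k 0) v = cos c * prim (\<lambda>v. n 0 v) v" "prim (l 0) v = sin c * prim (\<lambda>v. n 0 v) v"
        by (simp_all add: prim_def k_def l_def \<phi>_axis)
      moreover have "cos c * (cos c * a) + sin c * (sin c * a) = a" for a
      proof -
        have "cos c * (cos c * a) + sin c * (sin c * a) = ((sin c)\<^sup>2 + (cos c)\<^sup>2) * a"
          by (simp only: power2_eq_square distrib_right mult.assoc add.commute)
        then show ?thesis by simp
      qed
      ultimately have "cos c * prim (k 0) v + sin c * prim (l 0) v = prim (\<lambda>v. n 0 v) v"
        by (simp only:)
      then have "cos c * p 0 v + sin c * s 0 v = q0 + prim (\<lambda>v. n 0 v) v"
        by (simp add: p_def s_def CS0 q0_def distrib_left)
      then show ?thesis by (simp add: W_def m_def \<phi>_axis I algebra_simps)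
    qed
  qed (auto simp: ee)
  show ?thesis
  proof (rule that)
    show "frame_system e \<phi> \<phi>1 n p s"
      unfolding frame_system_def
    proof (intro conjI allI nc pc sc nu)
      fix u v
      have "pu u v = e * n u v - \<phi>1 u v * s u v" using YW[of u v] by (simp add: Y_def)
      with pu[of v u] show "((\<lambda>u. p u v) has_real_derivative e * n u v - \<phi>1 u v * s u v) (at u)" by simp
      show "((\<lambda>u. s u v) has_real_derivative \<phi>1 u v * p u v) (at u)" using su[of v u] X by simp
      have "m u v = e * (cos (\<phi> u v) * p u v + sin (\<phi> u v) * s u v)" using YW[of u v] by (simp add: W_def)
      with nv[of u v] show "((\<lambda>v. n u v) has_real_derivative e * (cos (\<phi> u v) * p u v + sin (\<phi> u v) * s u v)) (at v)" by simp
    qed (use pv sv in \<open>auto simp: k_def l_def\<close>)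
    show "n 0 0 = n0" "p 0 0 = p0" "s 0 0 = s0"
      by (auto simp: n_alt d_def p_def s_def CS0)
  qed
qed

text \<open>The values at \<open>(a, b)\<close> depend linearly on the data at the origin. The
  conserved form makes this linear map injective, hence surjective in dimension 3.\<close>

lemma (in flat_angle) frame_system_exists:
  assumes e: "e = 1 \<or> e = -1"
  obtains n p s where "frame_system e \<phi> \<phi>1 n p s" "n a b = n0" "p a b = p0" "s a b = s0"
proof -
  obtain n1 p1 s1 where 1: "frame_system e \<phi> \<phi>1 n1 p1 s1" "n1 0 0 = 1" "p1 0 0 = 0" "s1 0 0 = 0"
    using frame_system_exists_0[OF e] by blast
  obtain n2 p2 s2 where 2: "frame_system e \<phi> \<phi>1 n2 p2 s2" "n2 0 0 = 0" "p2 0 0 = 1" "s2 0 0 = 0"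
    using frame_system_exists_0[OF e] by blast
  obtain n3 p3 s3 where 3: "frame_system e \<phi> \<phi>1 n3 p3 s3" "n3 0 0 = 0" "p3 0 0 = 0" "s3 0 0 = 1"
    using frame_system_exists_0[OF e] by blast
  define N where "N x u v = 1 * (x $ 1 * n1 u v + x $ 2 * n2 u v) + x $ 3 * n3 u v" for x :: "real^3" and u v
  define P where "P x u v = 1 * (x $ 1 * p1 u v + x $ 2 * p2 u v) + x $ 3 * p3 u v" for x :: "real^3" and u v
  define S where "S x u v = 1 * (x $ 1 * s1 u v + x $ 2 * s2 u v) + x $ 3 * s3 u v" for x :: "real^3" and u v
  have F: "frame_system e \<phi> \<phi>1 (N x) (P x) (S x)" for x
    unfolding N_def[abs_def] P_def[abs_def] S_def[abs_def]
    by (intro frame_system_lincomb 1 2 3)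
  define L where "L x = (vector [N x a b, P x a b, S x a b] :: real^3)" for x
  have lin: "linear L"
    by (rule linearI) (simp_all add: L_def N_def P_def S_def vec_eq_iff forall_3 algebra_simps)
  \<comment> \<open>Pairing with the basis solutions reads off the coordinates of \<open>x\<close>
    at the origin, up to sign, while the same pairing at \<open>(a, b)\<close> is 0.\<close>
  have "x = 0" if "L x = 0" for x
  proof -
    have z: "N x a b = 0" "P x a b = 0" "S x a b = 0"
      using that by (simp_all add: L_def vec_eq_iff forall_3)
    have "x $ 1 = 0" using frame_system_form_const[OF F 1(1) e, of x 0 0 a b] 1 2 3 z
      by (simp add: N_def P_def S_def)
    moreover have "x $ 2 = 0" using frame_system_form_const[OF F 2(1) e, of x 0 0 a b] 1 2 3 z e
      by (auto simp: N_def P_def S_def)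
    moreover have "x $ 3 = 0" using frame_system_form_const[OF F 3(1) e, of x 0 0 a b] 1 2 3 z e
      by (auto simp: N_def P_def S_def)
    ultimately show "x = 0" by (simp add: vec_eq_iff forall_3)
  qed
  then have "inj L" using lin linear_injective_0 by blast
  then have "surj L" using lin linear_injective_imp_surjective by blast
  then obtain x where "L x = vector [n0, p0, s0]" by (metis surjD)
  then show ?thesis
    using that[OF F, of x] by (simp add: L_def vec_eq_iff forall_3)
qed

lemma amsler_flat_angle:
  assumes "\<psi> 0 = c" "\<And>w. (\<psi> has_real_derivative \<psi>1 w) (at w)" "continuous_on UNIV \<psi>1"
    "\<And>w. ((\<lambda>w. w * \<psi>1 w) has_real_derivative sin (\<psi> w)) (at w)" "\<psi>1 0 = sin c"
  shows "flat_angle (\<lambda>u v. \<psi> (u * v)) (\<lambda>u v. v * \<psi>1 (u * v)) c"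
proof
  have c: "continuous_on UNIV \<psi>" using assms(2) by (rule continuous_real_deriv)
  show "cont2 (\<lambda>u v. \<psi> (u * v))" "cont2 (\<lambda>u v. v * \<psi>1 (u * v))"
    unfolding cont2_def
    by (auto intro!: continuous_intros continuous_on_compose2[OF c] continuous_on_compose2[OF assms(3)])
  fix u v :: real
  have "((\<lambda>u. \<psi> (u * v)) has_real_derivative \<psi>1 (u * v) * v) (at u)"
    by (rule DERIV_chain2[OF assms(2)]) (auto intro!: derivative_eq_intros)
  then show "((\<lambda>u. \<psi> (u * v)) has_real_derivative v * \<psi>1 (u * v)) (at u)"
    by (simp add: mult.commute)
  show "((\<lambda>v. v * \<psi>1 (u * v)) has_real_derivative sin (\<psi> (u * v))) (at v)"
  \<comment> \<open>For nonzero \<open>u\<close> the function is \<open>1 / u\<close> times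
    \<open>w * \<psi>1 w\<close> at \<open>w = u * v\<close>, whose derivative is known. At
    \<open>u = 0\<close> it is linear in \<open>v\<close> with slope
    \<open>\<psi>1 0 = sin c\<close>.\<close>
  proof (cases "u = 0")
    case True
    then show ?thesis using assms(1,5) by (auto intro!: derivative_eq_intros)
  next
    case False
    have "((\<lambda>v. 1 / u * ((u * v) * \<psi>1 (u * v))) has_real_derivative 1 / u * (sin (\<psi> (u * v)) * u)) (at v)"
      by (rule DERIV_cmult, rule DERIV_chain2[OF assms(4)]) (auto intro!: derivative_eq_intros)
    then show ?thesis using False by (simp add: mult.assoc)
  qed
qed (auto simp: assms)

section \<open>The profile function\<close>

locale amsler =
  fixes n :: nat and \<psi> \<psi>1 :: "real \<Rightarrow> real"
  assumes n: "n \<ge> 2" and \<psi>0: "\<psi> 0 = pi / real n" and \<psi>10: "\<psi>1 0 = sin (pi / real n)"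
    and \<psi>_deriv: "\<And>w. (\<psi> has_real_derivative \<psi>1 w) (at w)"
    and \<psi>1_cont: "continuous_on UNIV \<psi>1"
    and \<psi>_ode: "\<And>w. ((\<lambda>w. w * \<psi>1 w) has_real_derivative sin (\<psi> w)) (at w)"
    and \<psi>1_le: "\<And>w. \<bar>\<psi>1 w\<bar> \<le> 1"

lemma amsler_exists:
  assumes "n \<ge> 2"
  obtains \<psi> \<psi>1 where "amsler n \<psi> \<psi>1"
  using amsler_angle_exists[of "pi / real n"] assms unfolding amsler_def by metis

context amsler
begin

sublocale flat_angle "\<lambda>u v. \<psi> (u * v)" "\<lambda>u v. v * \<psi>1 (u * v)" "pi / real n"
  by (rule amsler_flat_angle) (fact \<psi>0 \<psi>10 \<psi>_deriv \<psi>1_cont \<psi>_ode)+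

lemma angle_bounds: "0 < pi / real n" "pi / real n < pi"
  using n by (auto simp: field_simps)

lemma \<psi>_cont: "continuous_on S \<psi>"
  by (rule continuous_real_deriv[OF \<psi>_deriv])

text \<open>The profile in its original variable \<open>z = 2 * sqrt (u * v)\<close>;
  \<open>q1\<close> is its derivative.\<close>

definition q :: "real \<Rightarrow> real" where "q z = \<psi> (z\<^sup>2 / 4)"
definition q1 :: "real \<Rightarrow> real" where "q1 z = z / 2 * \<psi>1 (z\<^sup>2 / 4)"

lemma q_0 [simp]: "q 0 = pi / real n" and q1_0 [simp]: "q1 0 = 0"
  by (auto simp: q_def q1_def \<psi>0)

lemma q_0_le_pi: "q 0 \<le> pi"
  using angle_bounds by simp

lemma q_deriv: "(q has_real_derivative q1 z) (at z)"
proof -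
  have "((\<lambda>z. \<psi> (z\<^sup>2 / 4)) has_real_derivative \<psi>1 (z\<^sup>2 / 4) * (2 * z / 4)) (at z)"
    by (rule DERIV_chain2[OF \<psi>_deriv]) (auto intro!: derivative_eq_intros)
  then show ?thesis by (simp add: q_def[abs_def] q1_def mult.commute)
qed

lemma zq1_deriv: "((\<lambda>z. z * q1 z) has_real_derivative z * sin (q z)) (at z)"
proof -
  have "((\<lambda>z. 2 * ((z\<^sup>2 / 4) * \<psi>1 (z\<^sup>2 / 4))) has_real_derivative 2 * (sin (\<psi> (z\<^sup>2 / 4)) * (2 * z / 4))) (at z)"
    by (rule DERIV_cmult, rule DERIV_chain2[OF \<psi>_ode]) (auto intro!: derivative_eq_intros)
  then show ?thesis by (simp add: q_def q1_def power2_eq_square field_simps)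
qed

lemma q1_deriv:
  assumes "z \<noteq> 0"
  shows "(q1 has_real_derivative sin (q z) - q1 z / z) (at z)"
proof -
  have "((\<lambda>z. (z * q1 z) / z) has_real_derivative sin (q z) - q1 z / z) (at z)"
    using DERIV_divide[OF zq1_deriv DERIV_ident assms] assms by (simp add: diff_divide_distrib)
  moreover have "\<forall>\<^sub>F x in nhds z. (x * q1 x) / x = q1 x"
    using t1_space_nhds[OF assms] by eventually_elim auto
  ultimately show ?thesis
    using DERIV_cong_ev[of z z "\<lambda>z. (z * q1 z) / z" q1] by simp
qed

lemma q_cont: "continuous_on S q"
  by (rule continuous_real_deriv[OF q_deriv])

lemma q1_cont: "continuous_on S q1"
  unfolding q1_def by (intro continuous_intros continuous_on_compose2[OF \<psi>1_cont]) auto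

lemma q1_div_le: "z > 0 \<Longrightarrow> q1 z / z \<le> 1 / 2" "z \<ge> 0 \<Longrightarrow> \<bar>q1 z\<bar> \<le> z / 2"
  using \<psi>1_le[of "z\<^sup>2/4"] by (auto simp: q1_def field_simps abs_mult mult_left_le)

text \<open>Twice the pendulum energy \<open>q1\<^sup>2 / 2 + cos q\<close>. The friction term
  \<open>q1 / z\<close> dissipates it at the rate \<open>2 * q1\<^sup>2 / z\<close>.\<close>

lemma energy_mono:
  assumes "0 \<le> x" "x \<le> y"
  shows "(q1 y)\<^sup>2 + 2 * cos (q y) \<le> (q1 x)\<^sup>2 + 2 * cos (q x)"
proof (rule DERIV_nonpos_imp_decreasing_open[OF assms(2)])
  fix z assume "x < z" "z < y"
  then have z: "z > 0" using assms by simp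
  have "((\<lambda>z. (q1 z)\<^sup>2 + 2 * cos (q z)) has_real_derivative - (2 * (q1 z)\<^sup>2 / z)) (at z)"
    using z by (auto intro!: derivative_eq_intros q1_deriv q_deriv simp: power2_eq_square field_simps)
  then show "\<exists>d. ((\<lambda>z. (q1 z)\<^sup>2 + 2 * cos (q z)) has_real_derivative d) (at z) \<and> d \<le> 0"
    using z by (intro exI[of _ "- (2 * (q1 z)\<^sup>2 / z)"]) auto
qed (intro continuous_intros q1_cont q_cont)

lemma energy_le: "z \<ge> 0 \<Longrightarrow> (q1 z)\<^sup>2 + 2 * cos (q z) \<le> 2 * cos (pi / real n)"
  using energy_mono[of 0 z] by simp

lemma q1_le_2:
  assumes "z \<ge> 0"
  shows "(q1 z)\<^sup>2 \<le> 2 * (1 - cos (q z))" "\<bar>q1 z\<bar> \<le> 2"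
proof -
  show *: "(q1 z)\<^sup>2 \<le> 2 * (1 - cos (q z))"
    using energy_le[OF assms] cos_le_one[of "pi / real n"] unfolding right_diff_distrib by linarith
  also have "\<dots> \<le> 4" using cos_ge_minus_one[of "q z"] unfolding right_diff_distrib by linarith
  finally have "(q1 z)\<^sup>2 \<le> 2\<^sup>2" by simp
  then show "\<bar>q1 z\<bar> \<le> 2" using abs_le_square_iff[of "q1 z" 2] by simp
qed

text \<open>An energy barrier: on its way below the start value the profile would pass a point whose
  potential part alone exceeds the initial energy. The target \<open>y\<close> is cut off at 0 to
  remain where the cosine is monotone.\<close>

lemma q_ge:
  assumes "z \<ge> 0"
  shows "q z \<ge> pi / real n"
proof (rule ccontr)
  assume "\<not> ?thesis"
  then have less: "q z < pi / real n" by simp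
  define y where "y = max (q z) 0"
  have y: "q z \<le> y" "y \<le> q 0" "0 \<le> y" "y < pi / real n" using less angle_bounds by (auto simp: y_def)
  obtain x where x: "0 \<le> x" "x \<le> z" "q x = y"
    using IVT2'[of q z y 0] y assms q_cont by auto
  have "cos (pi / real n) < cos y"
    using y angle_bounds by (intro cos_monotone_0_pi) auto
  moreover have "cos (q x) \<le> cos (pi / real n)" using energy_le[OF x(1)] zero_le_power2[of "q1 x"] by linarith
  ultimately show False using x(3) by simp
qed

lemma q1_nonneg:
  assumes "\<And>x. 0 \<le> x \<Longrightarrow> x < z \<Longrightarrow> q x < pi" "z \<ge> 0"
  shows "q1 z \<ge> 0"
proof (cases "z = 0")
  case False
  have "0 * q1 0 \<le> z * q1 z"
  proof (rule DERIV_nonneg_imp_increasing_open[OF assms(2)])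
    fix x assume "0 < x" "x < z"
    then have "x * sin (q x) \<ge> 0"
      using assms(1)[of x] q_ge[of x] angle_bounds by (intro mult_nonneg_nonneg sin_ge_zero) auto
    then show "\<exists>d. ((\<lambda>z. z * q1 z) has_real_derivative d) (at x) \<and> 0 \<le> d"
      using zq1_deriv by blast
  qed (intro continuous_intros q1_cont)
  then show ?thesis using False assms(2) by (simp add: zero_le_mult_iff)
qed auto

lemma q_mono:
  assumes "\<And>x. 0 \<le> x \<Longrightarrow> x < b \<Longrightarrow> q x < pi" "0 \<le> a" "a \<le> b"
  shows "q a \<le> q b"
proof (rule DERIV_nonneg_imp_nondecreasing[OF assms(3)])
  fix x assume "a \<le> x" "x \<le> b"
  then show "\<exists>d. (q has_real_derivative d) (at x) \<and> 0 \<le> d"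
    using q_deriv q1_nonneg[of x] assms by auto
qed

text \<open>Otherwise the angle would stay in the interval from \<open>pi / n\<close> to
  \<open>pi\<close>, so \<open>z * q1 z\<close> would increase and \<open>q1 z\<close> would be at
  least \<open>k / z\<close> for \<open>z \<ge> 1\<close>. The resulting logarithmic growth is
  unbounded.\<close>

lemma reaches_pi: "\<exists>z\<ge>0. q z = pi"
proof (rule ccontr)
  assume no: "\<not> ?thesis"
  have lt: "q z < pi" if z: "z \<ge> 0" for z
  proof (rule ccontr)
    assume "\<not> q z < pi"
    then have "pi \<le> q z" by simp
    then obtain x where "0 \<le> x" "x \<le> z" "q x = pi"
      using IVT'[OF q_0_le_pi _ z q_cont] by blast
    then show False using no by blast
  qed
  define k where "k = q1 1"
  have "0 * q1 0 < 1 * q1 1"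
  proof (rule DERIV_pos_imp_increasing_open[where f = "\<lambda>z. z * q1 z"])
    fix x :: real assume "0 < x" "x < 1"
    then have "x * sin (q x) > 0"
      using lt[of x] q_ge[of x] angle_bounds by (intro mult_pos_pos sin_gt_zero) auto
    then show "\<exists>d. ((\<lambda>z. z * q1 z) has_real_derivative d) (at x) \<and> 0 < d"
      using zq1_deriv by blast
  qed (auto intro!: continuous_intros q1_cont)
  then have k: "k > 0" by (simp add: k_def)
  have zk: "z * q1 z \<ge> k" if "z \<ge> 1" for z
  proof -
    have "1 * q1 1 \<le> z * q1 z"
    proof (rule DERIV_nonneg_imp_increasing_open[OF that])
      fix x assume "1 < x" "x < z"
      then have "x * sin (q x) \<ge> 0"
        using lt[of x] q_ge[of x] angle_bounds by (intro mult_nonneg_nonneg sin_ge_zero) auto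
      then show "\<exists>d. ((\<lambda>z. z * q1 z) has_real_derivative d) (at x) \<and> 0 \<le> d"
        using zq1_deriv by blast
    qed (intro continuous_intros q1_cont)
    then show ?thesis by (simp add: k_def)
  qed
  \<comment> \<open>At this point the logarithmic lower bound \<open>k * ln b\<close> has reached
    \<open>pi\<close>.\<close>
  define b where "b = exp (pi / k)"
  have b: "1 \<le> b" using k by (simp add: b_def)
  have "q 1 - k * ln 1 \<le> q b - k * ln b"
  proof (rule DERIV_nonneg_imp_nondecreasing[OF b])
    fix x assume "1 \<le> x" "x \<le> b"
    moreover from this have "((\<lambda>x. q x - k * ln x) has_real_derivative q1 x - k / x) (at x)"
      by (auto intro!: derivative_eq_intros q_deriv)
    ultimately show "\<exists>d. ((\<lambda>x. q x - k * ln x) has_real_derivative d) (at x) \<and> 0 \<le> d"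
      using zk[of x] by (intro exI[of _ "q1 x - k / x"]) (auto simp: field_simps)
  qed
  then show False
    using k lt[of b] q_ge[of 1] angle_bounds b by (simp add: b_def)
qed

definition Z :: real where "Z = Inf {z. z \<ge> 0 \<and> q z = pi}"

lemma Z: "Z > 0" "q Z = pi" "\<And>z. 0 \<le> z \<Longrightarrow> z < Z \<Longrightarrow> q z < pi"
proof -
  define A where "A = {z. z \<ge> 0 \<and> q z = pi}"
  have "A = {0..} \<inter> q -` {pi}" by (auto simp: A_def)
  moreover have "closed ({0..} \<inter> q -` {pi})"
    by (rule continuous_closed_preimage) (auto intro: q_cont)
  ultimately have cl: "closed A" by simp
  have ne: "A \<noteq> {}" and bdd: "bdd_below A" using reaches_pi by (auto simp: A_def bdd_below_def)
  have "Z \<in> A" unfolding Z_def A_def[symmetric] by (rule closed_contains_Inf[OF ne bdd cl])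
  then show ZA: "q Z = pi" by (simp add: A_def)
  have "Z \<ge> 0" using \<open>Z \<in> A\<close> by (simp add: A_def)
  moreover have "Z \<noteq> 0" using ZA angle_bounds by auto
  ultimately show "Z > 0" by simp
  show "q z < pi" if z: "0 \<le> z" "z < Z" for z
  proof (rule ccontr)
    assume "\<not> q z < pi"
    then have "pi \<le> q z" by simp
    then obtain x where x: "0 \<le> x" "x \<le> z" "q x = pi"
      using IVT'[OF q_0_le_pi _ z(1) q_cont] by blast
    then have "Z \<le> x" unfolding Z_def using bdd by (intro cInf_lower) (auto simp: A_def)
    then show False using x z by simp
  qed
qed

lemma profile: "amsler_profile n q Z"
  unfolding amsler_profile_def
proof (intro conjI, goal_cases)
  case 4
  show ?case
  proof (rule exI[of _ q1], rule exI[of _ "\<lambda>z. sin (q z) - q1 z / z"], intro conjI)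
  show "\<forall>z\<in>{0..Z}. (q has_real_derivative q1 z) (at z within {0..Z})"
    using q_deriv has_field_derivative_at_within by blast
  show "\<forall>z\<in>{0<..Z}. (q1 has_real_derivative sin (q z) - q1 z / z) (at z within {0..Z})"
    using q1_deriv has_field_derivative_at_within by (metis greaterThanAtMost_iff less_irrefl)
  qed auto
qed (use Z in force)+

lemma q_sqrt: "u \<ge> 0 \<Longrightarrow> v \<ge> 0 \<Longrightarrow> q (2 * sqrt (u * v)) = \<psi> (u * v)"
  by (simp add: q_def power_mult_distrib)

lemma sin_pos_on_domain:
  assumes "(u, v) \<in> amsler_domain Z"
  shows "sin (\<psi> (u * v)) > 0"
proof -
  have uv: "u \<ge> 0" "v \<ge> 0" "2 * sqrt (u * v) < Z" using assms by (auto simp: amsler_domain_def)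
  then show ?thesis
    using Z(3)[of "2 * sqrt (u * v)"] q_ge[of "2 * sqrt (u * v)"] angle_bounds
    by (intro sin_gt_zero) (auto simp flip: q_sqrt)
qed

end

section \<open>The Amsler piece\<close>

definition vec3 :: "real \<Rightarrow> real \<Rightarrow> real \<Rightarrow> real^3" where
  "vec3 a b c = vector [a, b, c]"

lemma vec3_nth [simp]: "vec3 a b c $ 1 = a" "vec3 a b c $ 2 = b" "vec3 a b c $ 3 = c"
  by (auto simp: vec3_def)

lemma vec3_alt: "vec3 a b c = a *\<^sub>R axis 1 1 + b *\<^sub>R axis 2 1 + c *\<^sub>R axis 3 1"
  by (simp add: vec_eq_iff forall_3 axis_def)

lemma vec3_deriv:
  assumes "(a has_real_derivative a') F" "(b has_real_derivative b') F" "(c has_real_derivative c') F"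
  shows "((\<lambda>x. vec3 (a x) (b x) (c x)) has_vector_derivative vec3 a' b' c') F"
  unfolding vec3_alt has_vector_derivative_def
  using assms[unfolded has_field_derivative_def]
  by (auto intro!: derivative_eq_intros simp: algebra_simps)

lemma vec3_continuous:
  "continuous_on S a \<Longrightarrow> continuous_on S b \<Longrightarrow> continuous_on S c \<Longrightarrow> continuous_on S (\<lambda>x. vec3 (a x) (b x) (c x))"
  unfolding vec3_alt by (intro continuous_intros)

lemma zero_vector_derivative_const:
  fixes f :: "real \<Rightarrow> 'a::real_normed_vector"
  assumes "\<And>x. (f has_vector_derivative 0) (at x)"
  shows "f x = f y"
  using has_vector_derivative_zero_constant[of UNIV f] assms by (metis UNIV_I convex_UNIV)

text \<open>With \<open>J = diag (1, -e, -e)\<close> and \<open>J ** J = mat 1\<close>, the relation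
  \<open>transpose M ** J ** M = J\<close> implies the same relation for the transpose. Conservation
  of the form relates the columns, that is, different solutions; the geometry needs the rows, that
  is, the frame vectors at one point.\<close>

lemma pseudo_orthogonal_rows:
  fixes M :: "real^3^3"
  defines "h \<equiv> \<lambda>e i j. if i = j then (if i = 1 then 1 else - e) else (0::real)"
  assumes e: "e = 1 \<or> e = -1"
    and cols: "\<And>i j. M$1$i * M$1$j - e * (M$2$i * M$2$j + M$3$i * M$3$j) = h e i j"
  shows "M$k$1 * M$l$1 - e * (M$k$2 * M$l$2 + M$k$3 * M$l$3) = h e k l"
proof -
  define J :: "real^3^3" where "J = (\<chi> i j. h e i j)"
  have JJ: "J ** J = mat 1"
    using e by (auto simp: J_def h_def matrix_matrix_mult_def mat_def vec_eq_iff forall_3 sum_3)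
  have "transpose M ** (J ** M) = J"
    using cols by (simp add: J_def h_def matrix_matrix_mult_def transpose_def vec_eq_iff sum_3 algebra_simps)
  then have "(J ** transpose M ** J) ** M = mat 1"
    using JJ by (metis matrix_mul_assoc)
  then have "M ** (J ** transpose M ** J) = mat 1"
    using matrix_left_right_inverse by blast
  then have "M ** (J ** transpose M) ** (J ** J) = J"
    by (metis matrix_mul_assoc matrix_mul_lid)
  then have "M ** (J ** transpose M) = J"
    by (simp add: JJ)
  then have "(M ** (J ** transpose M)) $ k $ l = h e k l"
    by (simp add: J_def)
  then show ?thesis
    by (simp add: J_def h_def matrix_matrix_mult_def transpose_def sum_3 algebra_simps)
qed

context amsler
begin

text \<open>For \<open>e = -1\<close> three solutions serve as the coordinates of a frame in
  Euclidean space. The initial frame is chosen so that the tangents of the \<open>u\<close>- and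
  \<open>v\<close>-curves at the origin lie in the \<open>xy\<close>-plane, along the directions at
  angles 0 and \<open>pi / n\<close>.\<close>

lemma euclidean_frame:
  obtains N P S :: "real \<Rightarrow> real \<Rightarrow> real^3" where
    "\<And>u v. ((\<lambda>u. N u v) has_vector_derivative P u v) (at u)"
    "\<And>u v. ((\<lambda>u. P u v) has_vector_derivative - N u v - (v * \<psi>1 (u * v)) *\<^sub>R S u v) (at u)"
    "\<And>u v. ((\<lambda>u. S u v) has_vector_derivative (v * \<psi>1 (u * v)) *\<^sub>R P u v) (at u)"
    "\<And>u v. ((\<lambda>v. N u v) has_vector_derivative - cos (\<psi> (u * v)) *\<^sub>R P u v - sin (\<psi> (u * v)) *\<^sub>R S u v) (at v)"
    "\<And>u v. ((\<lambda>v. P u v) has_vector_derivative cos (\<psi> (u * v)) *\<^sub>R N u v) (at v)"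
    "\<And>u v. ((\<lambda>v. S u v) has_vector_derivative sin (\<psi> (u * v)) *\<^sub>R N u v) (at v)"
    "continuous_on UNIV (\<lambda>z. N (fst z) (snd z))" "continuous_on UNIV (\<lambda>z. P (fst z) (snd z))"
    "continuous_on UNIV (\<lambda>z. S (fst z) (snd z))"
    "\<And>u v. N u v \<bullet> N u v = 1" "\<And>u v. P u v \<bullet> P u v = 1" "\<And>u v. S u v \<bullet> S u v = 1"
    "\<And>u v. N u v \<bullet> P u v = 0" "\<And>u v. N u v \<bullet> S u v = 0" "\<And>u v. P u v \<bullet> S u v = 0"
    "\<And>u v. cross3 (P u v) (S u v) = N u v"
    "N 0 0 = vec3 0 0 1" "P 0 0 = vec3 0 (-1) 0" "S 0 0 = vec3 1 0 0"
proof -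
  let ?F = "frame_system (-1) (\<lambda>u v. \<psi> (u * v)) (\<lambda>u v. v * \<psi>1 (u * v))"
  have e: "(-1::real) = 1 \<or> (-1::real) = -1" by simp
  obtain n1 p1 s1 where 1: "?F n1 p1 s1" "n1 0 0 = 0" "p1 0 0 = 0" "s1 0 0 = 1"
    using frame_system_exists[OF e] by blast
  obtain n2 p2 s2 where 2: "?F n2 p2 s2" "n2 0 0 = 0" "p2 0 0 = -1" "s2 0 0 = 0"
    using frame_system_exists[OF e] by blast
  obtain n3 p3 s3 where 3: "?F n3 p3 s3" "n3 0 0 = 1" "p3 0 0 = 0" "s3 0 0 = 0"
    using frame_system_exists[OF e] by blast
  note D1 = frame_systemD[OF 1(1)] and D2 = frame_systemD[OF 2(1)] and D3 = frame_systemD[OF 3(1)]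
  define N where "N u v = vec3 (n1 u v) (n2 u v) (n3 u v)" for u v
  define P where "P u v = vec3 (p1 u v) (p2 u v) (p3 u v)" for u v
  define S where "S u v = vec3 (s1 u v) (s2 u v) (s3 u v)" for u v
  define M :: "real \<Rightarrow> real \<Rightarrow> real^3^3" where "M u v = vector [N u v, P u v, S u v]" for u v
  have cols: "M u v$1$i * M u v$1$j - (-1) * (M u v$2$i * M u v$2$j + M u v$3$i * M u v$3$j)
      = (if i = j then (if i = 1 then 1 else - (-1)) else 0)" for u v and i j :: 3
  proof -
    have "\<forall>i j. M u v$1$i * M u v$1$j - (-1) * (M u v$2$i * M u v$2$j + M u v$3$i * M u v$3$j)
      = (if i = j then (if i = 1 then 1 else - (-1)) else (0::real))"
      using frame_system_form_const[OF 1(1) 1(1) e, of u v 0 0]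
        frame_system_form_const[OF 1(1) 2(1) e, of u v 0 0]
        frame_system_form_const[OF 1(1) 3(1) e, of u v 0 0]
        frame_system_form_const[OF 2(1) 2(1) e, of u v 0 0]
        frame_system_form_const[OF 2(1) 3(1) e, of u v 0 0]
        frame_system_form_const[OF 3(1) 3(1) e, of u v 0 0]
      unfolding forall_3 by (simp add: M_def N_def P_def S_def 1 2 3 algebra_simps)
    then show ?thesis by blast
  qed
  note rows = pseudo_orthogonal_rows[OF e cols]
  have ortho: "N u v \<bullet> N u v = 1" "P u v \<bullet> P u v = 1" "S u v \<bullet> S u v = 1"
    "N u v \<bullet> P u v = 0" "N u v \<bullet> S u v = 0" "P u v \<bullet> S u v = 0" for u v
    using rows[of u v 1 1] rows[of u v 2 2] rows[of u v 3 3] rows[of u v 1 2] rows[of u v 1 3] rows[of u v 2 3]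
    by (simp_all add: M_def inner_vec_def sum_3)
  \<comment> \<open>The determinant of the frame is constant, which decides the orientation that
    orthonormality leaves open.\<close>
  define T where "T u v = n1 u v * (p2 u v * s3 u v - p3 u v * s2 u v)
    - n2 u v * (p1 u v * s3 u v - p3 u v * s1 u v) + n3 u v * (p1 u v * s2 u v - p2 u v * s1 u v)" for u v
  have Tc: "T u v = T 0 0" for u v
  proof (rule const_in_2_variables[of T])
    fix u v
    show "((\<lambda>u. T u v) has_real_derivative 0) (at u)"
      unfolding T_def
      by (rule derivative_eq_intros D1(4-6) D2(4-6) D3(4-6) refl)+ (simp add: algebra_simps)
    show "((\<lambda>v. T u v) has_real_derivative 0) (at v)"
      unfolding T_def
      by (rule derivative_eq_intros D1(7-9) D2(7-9) D3(7-9) refl)+ (simp add: algebra_simps)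
  qed
  have T1: "N u v \<bullet> cross3 (P u v) (S u v) = 1" for u v
  proof -
    have "N u v \<bullet> cross3 (P u v) (S u v) = T u v"
      by (simp add: T_def N_def P_def S_def cross3_def inner_vec_def sum_3 algebra_simps)
    also have "\<dots> = T 0 0" by (rule Tc)
    also have "\<dots> = 1" by (simp add: T_def 1 2 3)
    finally show ?thesis .
  qed
  have cross: "cross3 (P u v) (S u v) = N u v" for u v
  proof -
    let ?C = "cross3 (P u v) (S u v)"
    \<comment> \<open>Two unit vectors with inner product 1 are equal.\<close>
    have "?C \<bullet> ?C = 1"
      using norm_cross_dot[of "P u v" "S u v"] ortho[of u v]
      by (simp add: power2_norm_eq_inner power_mult_distrib)
    then have "(?C - N u v) \<bullet> (?C - N u v) = 0"
      using T1[of u v] ortho[of u v] by (simp add: inner_diff_left inner_diff_right inner_commute)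
    then show ?thesis by simp
  qed
  have N_u: "((\<lambda>u. N u v) has_vector_derivative P u v) (at u)" for u v
    unfolding N_def P_def by (intro vec3_deriv D1 D2 D3)
  have P_u: "((\<lambda>u. P u v) has_vector_derivative - N u v - (v * \<psi>1 (u * v)) *\<^sub>R S u v) (at u)" for u v
    unfolding P_def using vec3_deriv[OF D1(5)[where u=u and v=v] D2(5)[where u=u and v=v] D3(5)[where u=u and v=v]]
    by (rule back_subst) (simp add: N_def S_def P_def vec_eq_iff forall_3)
  have S_u: "((\<lambda>u. S u v) has_vector_derivative (v * \<psi>1 (u * v)) *\<^sub>R P u v) (at u)" for u v
    unfolding S_def using vec3_deriv[OF D1(6)[where u=u and v=v] D2(6)[where u=u and v=v] D3(6)[where u=u and v=v]]
    by (rule back_subst) (simp add: N_def S_def P_def vec_eq_iff forall_3)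
  have N_v: "((\<lambda>v. N u v) has_vector_derivative - cos (\<psi> (u * v)) *\<^sub>R P u v - sin (\<psi> (u * v)) *\<^sub>R S u v) (at v)" for u v
    unfolding N_def using vec3_deriv[OF D1(7)[where u=u and v=v] D2(7)[where u=u and v=v] D3(7)[where u=u and v=v]]
    by (rule back_subst) (simp add: N_def S_def P_def vec_eq_iff forall_3)
  have P_v: "((\<lambda>v. P u v) has_vector_derivative cos (\<psi> (u * v)) *\<^sub>R N u v) (at v)" for u v
    unfolding P_def using vec3_deriv[OF D1(8)[where u=u and v=v] D2(8)[where u=u and v=v] D3(8)[where u=u and v=v]]
    by (rule back_subst) (simp add: N_def S_def P_def vec_eq_iff forall_3)
  have S_v: "((\<lambda>v. S u v) has_vector_derivative sin (\<psi> (u * v)) *\<^sub>R N u v) (at v)" for u v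
    unfolding S_def using vec3_deriv[OF D1(9)[where u=u and v=v] D2(9)[where u=u and v=v] D3(9)[where u=u and v=v]]
    by (rule back_subst) (simp add: N_def S_def P_def vec_eq_iff forall_3)
  have cont: "continuous_on UNIV (\<lambda>z. N (fst z) (snd z))" "continuous_on UNIV (\<lambda>z. P (fst z) (snd z))"
    "continuous_on UNIV (\<lambda>z. S (fst z) (snd z))"
    unfolding N_def P_def S_def using D1(1-3) D2(1-3) D3(1-3) by (auto simp: cont2_def intro!: vec3_continuous)
  have init: "N 0 0 = vec3 0 0 1" "P 0 0 = vec3 0 (-1) 0" "S 0 0 = vec3 1 0 0"
    by (auto simp: N_def P_def S_def 1 2 3)
  show ?thesis
  proof (rule that[of N P S])
  qed fact+
qed

text \<open>The frame equations are exported over the whole plane and not only over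
  \<open>amsler_domain Z\<close>, because the chain rule used for the immersion differentiates
  functions of two real variables in every point.\<close>

lemma amsler_piece_param:
  obtains r N P S :: "real \<Rightarrow> real \<Rightarrow> real^3" where
    "amsler_piece n ((\<lambda>(u, v). r u v) ` amsler_domain Z)"
    "\<And>u v. ((\<lambda>u. r u v) has_vector_derivative S u v) (at u)"
    "\<And>u v. ((\<lambda>v. r u v) has_vector_derivative cos (\<psi> (u * v)) *\<^sub>R S u v - sin (\<psi> (u * v)) *\<^sub>R P u v) (at v)"
    "\<And>u v. ((\<lambda>u. P u v) has_vector_derivative - N u v - (v * \<psi>1 (u * v)) *\<^sub>R S u v) (at u)"
    "\<And>u v. ((\<lambda>u. S u v) has_vector_derivative (v * \<psi>1 (u * v)) *\<^sub>R P u v) (at u)"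
    "\<And>u v. ((\<lambda>v. P u v) has_vector_derivative cos (\<psi> (u * v)) *\<^sub>R N u v) (at v)"
    "\<And>u v. ((\<lambda>v. S u v) has_vector_derivative sin (\<psi> (u * v)) *\<^sub>R N u v) (at v)"
    "continuous_on UNIV (\<lambda>z. r (fst z) (snd z))"
    "continuous_on UNIV (\<lambda>z. N (fst z) (snd z))" "continuous_on UNIV (\<lambda>z. P (fst z) (snd z))"
    "continuous_on UNIV (\<lambda>z. S (fst z) (snd z))"
    "\<And>u v. P u v \<bullet> P u v = 1" "\<And>u v. S u v \<bullet> S u v = 1" "\<And>u v. P u v \<bullet> S u v = 0"
proof -
  obtain N P S :: "real \<Rightarrow> real \<Rightarrow> real^3" where
    N_u: "\<And>u v. ((\<lambda>u. N u v) has_vector_derivative P u v) (at u)" and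
    P_u: "\<And>u v. ((\<lambda>u. P u v) has_vector_derivative - N u v - (v * \<psi>1 (u * v)) *\<^sub>R S u v) (at u)" and
    S_u: "\<And>u v. ((\<lambda>u. S u v) has_vector_derivative (v * \<psi>1 (u * v)) *\<^sub>R P u v) (at u)" and
    N_v: "\<And>u v. ((\<lambda>v. N u v) has_vector_derivative - cos (\<psi> (u * v)) *\<^sub>R P u v - sin (\<psi> (u * v)) *\<^sub>R S u v) (at v)" and
    P_v: "\<And>u v. ((\<lambda>v. P u v) has_vector_derivative cos (\<psi> (u * v)) *\<^sub>R N u v) (at v)" and
    S_v: "\<And>u v. ((\<lambda>v. S u v) has_vector_derivative sin (\<psi> (u * v)) *\<^sub>R N u v) (at v)" and
    cont: "continuous_on UNIV (\<lambda>z. N (fst z) (snd z))" "continuous_on UNIV (\<lambda>z. P (fst z) (snd z))"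
      "continuous_on UNIV (\<lambda>z. S (fst z) (snd z))" and
    ortho: "\<And>u v. N u v \<bullet> N u v = 1" "\<And>u v. P u v \<bullet> P u v = 1" "\<And>u v. S u v \<bullet> S u v = 1"
      "\<And>u v. N u v \<bullet> P u v = 0" "\<And>u v. N u v \<bullet> S u v = 0" "\<And>u v. P u v \<bullet> S u v = 0" and
    cross: "\<And>u v. cross3 (P u v) (S u v) = N u v" and
    init: "N 0 0 = vec3 0 0 1" "P 0 0 = vec3 0 (-1) 0" "S 0 0 = vec3 1 0 0"
    using euclidean_frame by blast
  define \<phi> where "\<phi> u v = \<psi> (u * v)" for u v
  define T where "T u v = cos (\<phi> u v) *\<^sub>R S u v - sin (\<phi> u v) *\<^sub>R P u v" for u v
  text \<open>Sym's formula for the position vector is explicit here: by the boost symmetry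
    \<open>(u, v) \<mapsto> (\<lambda> u, v / \<lambda>)\<close> of the angle, the derivative in the spectral parameter is
    \<open>u \<partial>\<^sub>u - v \<partial>\<^sub>v\<close>.\<close>
  define r where "r u v = u *\<^sub>R S u v + v *\<^sub>R T u v - (u * v * \<psi>1 (u * v)) *\<^sub>R N u v" for u v
  have \<phi>u: "((\<lambda>u. \<phi> u v) has_real_derivative v * \<psi>1 (u * v)) (at u)" for u v
    unfolding \<phi>_def by (rule \<phi>_u)
  have \<phi>v: "((\<lambda>v. \<phi> u v) has_real_derivative u * \<psi>1 (u * v)) (at v)" for u v
    unfolding \<phi>_def using \<phi>_u[of u v] by (simp add: mult.commute)
  have T_u: "((\<lambda>u. T u v) has_vector_derivative sin (\<phi> u v) *\<^sub>R N u v) (at u)" for u v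
    unfolding T_def
    by (rule derivative_eq_intros \<phi>u S_u P_u refl)+ (simp add: algebra_simps)
  have T_v: "((\<lambda>v. T u v) has_vector_derivative
      (u * \<psi>1 (u * v)) *\<^sub>R (- sin (\<phi> u v) *\<^sub>R S u v - cos (\<phi> u v) *\<^sub>R P u v)) (at v)" for u v
    unfolding T_def
    by (rule derivative_eq_intros \<phi>v S_v P_v refl)+ (simp add: algebra_simps \<phi>_def)
  have w_u: "((\<lambda>u. u * v * \<psi>1 (u * v)) has_real_derivative sin (\<phi> u v) * v) (at u)" for u v
    unfolding \<phi>_def by (rule DERIV_chain2[OF \<psi>_ode]) (auto intro!: derivative_eq_intros)
  have w_v: "((\<lambda>v. u * v * \<psi>1 (u * v)) has_real_derivative sin (\<phi> u v) * u) (at v)" for u v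
    unfolding \<phi>_def by (rule DERIV_chain2[OF \<psi>_ode]) (auto intro!: derivative_eq_intros)
  have r_u: "((\<lambda>u. r u v) has_vector_derivative S u v) (at u)" for u v
    unfolding r_def
    by (rule derivative_eq_intros w_u S_u T_u N_u refl)+ (simp add: algebra_simps \<phi>_def)
  have r_v: "((\<lambda>v. r u v) has_vector_derivative T u v) (at v)" for u v
    unfolding r_def
    by (rule derivative_eq_intros w_v S_v T_v N_v refl)+ (simp add: algebra_simps \<phi>_def)
  have \<phi>c: "continuous_on UNIV (\<lambda>z. \<phi> (fst z) (snd z))"
    unfolding \<phi>_def by (intro continuous_on_compose2[OF \<psi>_cont[of UNIV]] continuous_intros) auto
  have \<psi>1c: "continuous_on UNIV (\<lambda>z. \<psi>1 (fst z * snd z))"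
    by (intro continuous_on_compose2[OF \<psi>1_cont] continuous_intros) auto
  have Tc: "continuous_on UNIV (\<lambda>z. T (fst z) (snd z))"
    unfolding T_def by (intro continuous_intros cont \<phi>c)
  have rc: "continuous_on UNIV (\<lambda>z. r (fst z) (snd z))"
    unfolding r_def by (intro continuous_intros cont Tc \<psi>1c)
  define Q where "Q = amsler_domain Z"
  have sin_pos: "sin (\<phi> u v) > 0" if "(u, v) \<in> Q" for u v
    using sin_pos_on_domain that by (simp add: \<phi>_def Q_def)
  have ct: "continuous_on Q (\<lambda>(u, v). f u v)" if "continuous_on UNIV (\<lambda>z. f (fst z) (snd z))"
    for f :: "real \<Rightarrow> real \<Rightarrow> real^3"
    using continuous_on_subset[OF that] by (simp add: split_beta)
  have forms: "has_fundamental_forms Q (\<lambda>(u, v). r u v) (\<lambda>_. 1) (\<lambda>w. cos (case w of (u, v) \<Rightarrow> q (2 * sqrt (u * v))))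
      (\<lambda>_. 1) (\<lambda>_. 0) (\<lambda>w. sin (case w of (u, v) \<Rightarrow> q (2 * sqrt (u * v)))) (\<lambda>_. 0)"
    unfolding has_fundamental_forms_def
  proof (intro exI conjI)
    show "partial_u_on Q (\<lambda>(u, v). r u v) (\<lambda>(u, v). S u v)"
      "partial_v_on Q (\<lambda>(u, v). r u v) (\<lambda>(u, v). T u v)"
      "partial_u_on Q (\<lambda>(u, v). S u v) (\<lambda>(u, v). (v * \<psi>1 (u * v)) *\<^sub>R P u v)"
      "partial_v_on Q (\<lambda>(u, v). S u v) (\<lambda>(u, v). sin (\<phi> u v) *\<^sub>R N u v)"
      "partial_u_on Q (\<lambda>(u, v). T u v) (\<lambda>(u, v). sin (\<phi> u v) *\<^sub>R N u v)"
      "partial_v_on Q (\<lambda>(u, v). T u v) (\<lambda>(u, v). (u * \<psi>1 (u * v)) *\<^sub>R (- sin (\<phi> u v) *\<^sub>R S u v - cos (\<phi> u v) *\<^sub>R P u v))"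
      using r_u r_v S_u S_v T_u T_v
      by (auto simp: partial_u_on_def partial_v_on_def \<phi>_def intro: has_vector_derivative_at_within)
    show "continuous_on Q (\<lambda>(u, v). r u v)" "continuous_on Q (\<lambda>(u, v). S u v)" "continuous_on Q (\<lambda>(u, v). T u v)"
      "continuous_on Q (\<lambda>(u, v). (v * \<psi>1 (u * v)) *\<^sub>R P u v)"
      "continuous_on Q (\<lambda>(u, v). sin (\<phi> u v) *\<^sub>R N u v)"
      "continuous_on Q (\<lambda>(u, v). (u * \<psi>1 (u * v)) *\<^sub>R (- sin (\<phi> u v) *\<^sub>R S u v - cos (\<phi> u v) *\<^sub>R P u v))"
      by (intro ct continuous_intros cont rc Tc \<phi>c \<psi>1c)+
    have main: "cross3 (S u v) (T u v) \<noteq> 0 \<and> S u v \<bullet> S u v = 1 \<and> S u v \<bullet> T u v = cos (\<phi> u v) \<and> T u v \<bullet> T u v = 1 \<and>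
      sgn (cross3 (S u v) (T u v)) = N u v" if uv: "(u, v) \<in> Q" for u v
    proof -
      have "cross3 (S u v) (T u v) = sin (\<phi> u v) *\<^sub>R cross3 (P u v) (S u v)"
        unfolding T_def by (simp add: Cross3.right_diff_distrib cross_mult_right) (metis cross_skew scaleR_minus_right minus_minus)
      then have c: "cross3 (S u v) (T u v) = sin (\<phi> u v) *\<^sub>R N u v" by (simp add: cross)
      have nN: "norm (N u v) = 1" using ortho(1)[of u v] by (simp add: norm_eq_sqrt_inner)
      have "S u v \<bullet> P u v = 0" using ortho by (simp add: inner_commute)
      then have "S u v \<bullet> T u v = cos (\<phi> u v)" "T u v \<bullet> T u v = (cos (\<phi> u v))\<^sup>2 + (sin (\<phi> u v))\<^sup>2"
        unfolding T_def using ortho[of u v] by (simp_all add: inner_diff_left inner_diff_right power2_eq_square)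
      then show ?thesis
        using c nN sin_pos[OF uv] ortho[of u v] by (auto simp: sgn_div_norm)
    qed
    have NS: "N u v \<bullet> S u v = 0" "S u v \<bullet> N u v = 0" "N u v \<bullet> P u v = 0" "P u v \<bullet> N u v = 0" for u v
      using ortho by (simp_all add: inner_commute)
    have qq: "q (2 * sqrt (u * v)) = \<phi> u v" if "(u, v) \<in> Q" for u v
      using that q_sqrt by (auto simp: Q_def amsler_domain_def \<phi>_def)
    show "\<forall>w\<in>Q. cross3 (case w of (u, v) \<Rightarrow> S u v) (case w of (u, v) \<Rightarrow> T u v) \<noteq> 0 \<and>
        (case w of (u, v) \<Rightarrow> S u v) \<bullet> (case w of (u, v) \<Rightarrow> S u v) = 1 \<and>
        (case w of (u, v) \<Rightarrow> S u v) \<bullet> (case w of (u, v) \<Rightarrow> T u v) = cos (case w of (u, v) \<Rightarrow> q (2 * sqrt (u * v))) \<and>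
        (case w of (u, v) \<Rightarrow> T u v) \<bullet> (case w of (u, v) \<Rightarrow> T u v) = 1 \<and>
        (let \<nu> = sgn (cross3 (case w of (u, v) \<Rightarrow> S u v) (case w of (u, v) \<Rightarrow> T u v)) in
          (case w of (u, v) \<Rightarrow> (v * \<psi>1 (u * v)) *\<^sub>R P u v) \<bullet> \<nu> = 0 \<and>
          (case w of (u, v) \<Rightarrow> sin (\<phi> u v) *\<^sub>R N u v) \<bullet> \<nu> = sin (case w of (u, v) \<Rightarrow> q (2 * sqrt (u * v))) \<and>
          (case w of (u, v) \<Rightarrow> (u * \<psi>1 (u * v)) *\<^sub>R (- sin (\<phi> u v) *\<^sub>R S u v - cos (\<phi> u v) *\<^sub>R P u v)) \<bullet> \<nu> = 0)"
      using main qq NS ortho(1) by (auto simp: Let_def inner_diff_left)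
  qed
  \<comment> \<open>The derivative of the tangent along either axis carries the vanishing coordinate
    as a factor, so the tangent is constant and the axis is mapped to a straight ray.\<close>
  have axis_u: "r u 0 = u *\<^sub>R vec3 1 0 0" for u
  proof -
    have "((\<lambda>u. S u 0) has_vector_derivative 0) (at u)" for u using S_u[of 0 u] by simp
    then have "S u 0 = S 0 0" by (rule zero_vector_derivative_const)
    then show ?thesis by (simp add: r_def init)
  qed
  have axis_v: "r 0 v = v *\<^sub>R vec3 (cos (pi / n)) (sin (pi / n)) 0" for v
  proof -
    have "((\<lambda>v. T 0 v) has_vector_derivative 0) (at v)" for v using T_v[of 0 v] by simp
    then have "T 0 v = T 0 0" by (rule zero_vector_derivative_const)
    moreover have "T 0 0 = vec3 (cos (pi / n)) (sin (pi / n)) 0"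
      by (simp add: T_def init \<phi>_def \<psi>0 vec_eq_iff forall_3)
    ultimately show ?thesis by (simp add: r_def)
  qed
  have piece: "amsler_piece n ((\<lambda>(u, v). r u v) ` amsler_domain Z)"
    unfolding amsler_piece_def Let_def
  proof (intro exI conjI)
    show "amsler_profile n q Z" by (rule profile)
    show "has_fundamental_forms (amsler_domain Z) (\<lambda>(u, v). r u v) (\<lambda>_. 1) (\<lambda>w. cos (case w of (u, v) \<Rightarrow> q (2 * sqrt (u * v))))
      (\<lambda>_. 1) (\<lambda>_. 0) (\<lambda>w. sin (case w of (u, v) \<Rightarrow> q (2 * sqrt (u * v)))) (\<lambda>_. 0)"
      using forms by (simp add: Q_def)
    show "(case (0, 0) of (u, v) \<Rightarrow> r u v) = 0" by (simp add: axis_u)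
    have rd: "ray_dir n 0 = vec3 1 0 0" "ray_dir n 1 = vec3 (cos (pi / n)) (sin (pi / n)) 0"
      by (simp_all add: ray_dir_def vec3_def)
    have U: "{(u, v) \<in> amsler_domain Z. v = 0} = (\<lambda>u. (u, 0)) ` {0..}"
      and V: "{(u, v) \<in> amsler_domain Z. u = 0} = (\<lambda>v. (0, v)) ` {0..}"
      using Z(1) by (auto simp: amsler_domain_def image_iff)
    show "(\<lambda>(u, v). r u v) ` {(u, v) \<in> amsler_domain Z. v = 0} = amsler_ray n 0"
      unfolding U amsler_ray_def rd by (auto simp: image_image axis_u)
    show "(\<lambda>(u, v). r u v) ` {(u, v) \<in> amsler_domain Z. u = 0} = amsler_ray n 1"
      unfolding V amsler_ray_def rd by (auto simp: image_image axis_v)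
  qed simp
  show ?thesis
    by (rule that[OF piece r_u r_v[unfolded T_def \<phi>_def] P_u S_u P_v S_v rc cont ortho(2,3,6)])
qed

end

section \<open>Twice continuously differentiable functions are Sobolev\<close>

text \<open>The difference quotients in direction \<open>e\<close> have integral 0 by translation
  invariance of Lebesgue measure. They converge to the derivative, dominated by its maximum on a
  compact set.\<close>

lemma integral_partial_derivative_eq_0:
  fixes g :: "'a::euclidean_space \<Rightarrow> real"
  assumes d: "\<And>x. (g has_derivative g' x) (at x)" and c: "continuous_on UNIV (\<lambda>x. g' x e)"
    and supp: "\<And>x. x \<notin> cball 0 \<rho> \<Longrightarrow> g x = 0"
  shows "integral\<^sup>L lborel (\<lambda>x. g' x e) = 0"
proof -
  define h where "h k = 1 / real (Suc k)" for k
  have h: "0 < h k" "h k \<le> 1" for k by (auto simp: h_def)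
  define D where "D k x = (g (x + h k *\<^sub>R e) - g x) / h k" for k x
  have gc: "continuous_on S g" for S
    using d has_derivative_continuous continuous_at_imp_continuous_on by blast
  have gi: "integrable lborel g"
  proof -
    have "integrable lborel (\<lambda>x. indicator (cball 0 \<rho>) x *\<^sub>R g x)"
      by (rule borel_integrable_compact) (auto intro: gc)
    moreover have "(\<lambda>x. indicator (cball 0 \<rho>) x *\<^sub>R g x) = g"
      using supp by (auto simp: indicator_def fun_eq_iff)
    ultimately show ?thesis by simp
  qed
  have shift: "integrable lborel (\<lambda>x. g (x + a))" "integral\<^sup>L lborel (\<lambda>x. g (x + a)) = integral\<^sup>L lborel g" for a
  proof -
    have gm: "g \<in> borel_measurable borel" using gi by auto
    have "integrable (distr lborel borel ((+) a)) g" using gi lborel_distr_plus[of a] by simp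
    then show "integrable lborel (\<lambda>x. g (x + a))"
      by (subst (asm) integrable_distr_eq) (use gm in \<open>auto simp: add.commute\<close>)
    have "integral\<^sup>L lborel g = integral\<^sup>L (distr lborel borel ((+) a)) g" using lborel_distr_plus[of a] by simp
    also have "\<dots> = integral\<^sup>L lborel (\<lambda>x. g (a + x))"
      by (subst integral_distr) (use gm in auto)
    finally show "integral\<^sup>L lborel (\<lambda>x. g (x + a)) = integral\<^sup>L lborel g" by (simp add: add.commute)
  qed
  have D0: "integral\<^sup>L lborel (D k) = 0" for k
    unfolding D_def using shift gi by simp
  \<comment> \<open>The quotients vanish outside radius \<open>\<rho> + norm e\<close>, and the
    intermediate point of the mean value theorem is at most \<open>norm e\<close> further
    out.\<close>
  define K where "K = cball (0::'a) (\<rho> + 2 * norm e)"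
  have "bounded ((\<lambda>x. g' x e) ` K)"
    by (intro compact_imp_bounded compact_continuous_image continuous_on_subset[OF c]) (auto simp: K_def)
  then obtain B where B: "\<And>x. x \<in> K \<Longrightarrow> \<bar>g' x e\<bar> \<le> B" and B0: "B > 0"
    unfolding bounded_pos by auto
  have D_le: "\<bar>D k x\<bar> \<le> indicator (cball 0 (\<rho> + norm e)) x *\<^sub>R B" for k x
  proof (cases "x \<in> cball 0 (\<rho> + norm e)")
    case True
    have "\<exists>t. 0 < t \<and> t < h k \<and> g (x + h k *\<^sub>R e) - g (x + 0 *\<^sub>R e) = (h k - 0) * g' (x + t *\<^sub>R e) e"
    proof (rule MVT2[OF h(1)])
      fix t
      have "((\<lambda>t. g (x + t *\<^sub>R e)) has_derivative (\<lambda>s. g' (x + t *\<^sub>R e) (s *\<^sub>R e))) (at t)"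
        by (rule has_derivative_compose[OF _ d]) (auto intro!: derivative_eq_intros)
      moreover have "linear (g' (x + t *\<^sub>R e))" using d has_derivative_linear by blast
      then have "(\<lambda>s. g' (x + t *\<^sub>R e) (s *\<^sub>R e)) = (*) (g' (x + t *\<^sub>R e) e)"
        by (auto simp: fun_eq_iff linear_cmul)
      ultimately show "((\<lambda>t. g (x + t *\<^sub>R e)) has_real_derivative g' (x + t *\<^sub>R e) e) (at t)"
        by (simp only: has_field_derivative_def)
    qed
    then obtain t where t: "0 < t" "t < h k" "D k x = g' (x + t *\<^sub>R e) e"
      using h(1)[of k] unfolding D_def by (auto simp: field_simps)
    have "norm (x + t *\<^sub>R e) \<le> norm x + 1 * norm e"
      using t h(2)[of k] by (intro norm_triangle_mono) (auto simp: mult_right_mono intro!: mult_left_le_one_le)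
    also have "\<dots> \<le> \<rho> + 2 * norm e" using True by simp
    finally have "x + t *\<^sub>R e \<in> K" by (simp add: K_def)
    then show ?thesis using B t True by simp
  next
    case False
    have "x + h k *\<^sub>R e \<notin> cball 0 \<rho>"
    proof
      assume "x + h k *\<^sub>R e \<in> cball 0 \<rho>"
      moreover have "norm x \<le> norm (x + h k *\<^sub>R e) + norm (h k *\<^sub>R e)"
        using norm_triangle_sub[of x "x + h k *\<^sub>R e"] by simp
      moreover have "norm (h k *\<^sub>R e) \<le> norm e" using h[of k] by (auto intro!: mult_left_le_one_le)
      ultimately show False using False by simp
    qed
    moreover have "x \<notin> cball 0 \<rho>" using False norm_ge_zero[of e] unfolding mem_cball_0 by linarith
    ultimately have "D k x = 0" using supp by (simp add: D_def)
    then show ?thesis using False by simp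
  qed
  have lim: "(\<lambda>k. D k x) \<longlonglongrightarrow> g' x e" for x
  proof -
    have "((\<lambda>t. g (x + t *\<^sub>R e)) has_derivative (\<lambda>s. g' (x + 0 *\<^sub>R e) (s *\<^sub>R e))) (at 0)"
      by (rule has_derivative_compose[OF _ d]) (auto intro!: derivative_eq_intros)
    moreover have "linear (g' x)" using d has_derivative_linear by blast
    then have "(\<lambda>s. g' (x + 0 *\<^sub>R e) (s *\<^sub>R e)) = (*) (g' x e)"
      by (auto simp: fun_eq_iff linear_cmul)
    ultimately have "((\<lambda>t. g (x + t *\<^sub>R e)) has_real_derivative g' x e) (at 0)"
      by (simp only: has_field_derivative_def)
    then have "((\<lambda>t. (g (x + t *\<^sub>R e) - g x) / t) \<longlongrightarrow> g' x e) (at 0)"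
      by (simp add: DERIV_def)
    moreover have "filterlim h (at 0) sequentially"
      unfolding filterlim_at
    proof
      show "\<forall>\<^sub>F k in sequentially. h k \<in> UNIV \<and> h k \<noteq> 0" using h by (simp add: less_imp_neq[symmetric])
      show "h \<longlonglongrightarrow> 0" unfolding h_def using LIMSEQ_inverse_real_of_nat by (simp add: inverse_eq_divide)
    qed
    ultimately show ?thesis unfolding D_def by (rule filterlim_compose)
  qed
  have "(\<lambda>k. integral\<^sup>L lborel (D k)) \<longlonglongrightarrow> integral\<^sup>L lborel (\<lambda>x. g' x e)"
  proof (rule integral_dominated_convergence[where w="\<lambda>x. indicator (cball 0 (\<rho> + norm e)) x *\<^sub>R B"])
    show "(\<lambda>x. g' x e) \<in> borel_measurable lborel" using c by (simp add: borel_measurable_continuous_onI)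
    show "D k \<in> borel_measurable lborel" for k
      unfolding D_def using shift gi by (intro borel_measurable_divide borel_measurable_diff) auto
    show "integrable lborel (\<lambda>x::'a. indicator (cball 0 (\<rho> + norm e)) x *\<^sub>R B)"
      by (rule borel_integrable_compact) auto
  qed (use lim D_le in auto)
  then show ?thesis using LIMSEQ_unique[OF tendsto_const[of 0]] by (simp add: D0)
qed

lemma integrable_continuous_compact_support:
  fixes f :: "'a::euclidean_space \<Rightarrow> real"
  assumes "compact K" "continuous_on UNIV f" "\<And>x. x \<notin> K \<Longrightarrow> f x = 0"
  shows "integrable lborel f"
proof -
  have "integrable lborel (\<lambda>x. indicator K x *\<^sub>R f x)"
    by (rule borel_integrable_compact) (use assms in \<open>auto intro: continuous_on_subset\<close>)
  moreover have "(\<lambda>x. indicator K x *\<^sub>R f x) = f"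
    using assms(3) by (auto simp: indicator_def fun_eq_iff)
  ultimately show ?thesis by simp
qed

lemma integrable_lebesgue_on_compact:
  fixes f :: "real^'n \<Rightarrow> real"
  assumes "compact K" "continuous_on K f" "S \<subseteq> K" "S \<in> sets lebesgue"
  shows "integrable (lebesgue_on S) f"
proof -
  have "integrable lborel (\<lambda>x. indicator K x *\<^sub>R f x)"
    by (rule borel_integrable_compact) (use assms in auto)
  then have "integrable lebesgue (\<lambda>x. indicator K x *\<^sub>R f x)"
    using integrable_completion by blast
  then have "integrable lebesgue (\<lambda>x. indicator S x *\<^sub>R (indicator K x *\<^sub>R f x))"
    by (rule integrable_mult_indicator[OF assms(4)])
  moreover have "(\<lambda>x. indicator S x *\<^sub>R (indicator K x *\<^sub>R f x)) = (\<lambda>x. indicator S x *\<^sub>R f x)"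
    using assms(3) by (auto simp: indicator_def fun_eq_iff)
  ultimately show ?thesis
    using assms(4) by (simp add: integrable_restrict_space)
qed

lemma square_integrable_continuous:
  fixes f :: "real^'n \<Rightarrow> real"
  assumes "compact K" "continuous_on K f" "S \<subseteq> K" "S \<in> sets lebesgue"
  shows "square_integrable S f"
proof -
  have "continuous_on K (\<lambda>x. (f x)\<^sup>2)" by (intro continuous_on_power assms(2))
  then have "integrable (lebesgue_on S) (\<lambda>x. (f x)\<^sup>2)"
    using assms by (intro integrable_lebesgue_on_compact)
  moreover have "f \<in> borel_measurable (lebesgue_on S)"
    by (rule borel_measurable_integrable, rule integrable_lebesgue_on_compact) (fact assms)+
  ultimately show ?thesis by (simp add: square_integrable_def)
qed

lemma locally_integrable_continuous:
  fixes f :: "real^'n \<Rightarrow> real"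
  assumes "continuous_on \<Omega> f"
  shows "locally_integrable \<Omega> f"
  unfolding locally_integrable_def
proof safe
  fix K assume "compact K" "K \<subseteq> \<Omega>"
  then show "integrable (lebesgue_on K) f"
    using integrable_lebesgue_on_compact[of K f K] continuous_on_subset[OF assms]
    by (simp add: lmeasurable_compact fmeasurableD)
qed

lemma test_function_partial:
  assumes t: "test_function \<Omega> \<psi>"
  shows "(\<psi> has_derivative frechet_derivative \<psi> (at x)) (at x)"
    "continuous_on UNIV (partial_deriv i \<psi>)"
    "x \<notin> closure {x. \<psi> x \<noteq> 0} \<Longrightarrow> \<psi> x = 0"
    "x \<notin> closure {x. \<psi> x \<noteq> 0} \<Longrightarrow> partial_deriv i \<psi> x = 0"
proof -
  have "Ck (Suc 0) \<psi>" using t unfolding test_function_def by blast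
  then have d: "\<psi> differentiable_on UNIV" and c: "\<And>i. continuous_on UNIV (partial_deriv i \<psi>)" by auto
  show "(\<psi> has_derivative frechet_derivative \<psi> (at x)) (at x)"
    using d by (simp add: differentiable_on_def frechet_derivative_works)
  show "continuous_on UNIV (partial_deriv i \<psi>)" by (rule c)
  show "\<psi> x = 0" if "x \<notin> closure {x. \<psi> x \<noteq> 0}"
    using that closure_subset[of "{x. \<psi> x \<noteq> 0}"] by auto
  show "partial_deriv i \<psi> x = 0" if x: "x \<notin> closure {x. \<psi> x \<noteq> 0}"
  proof -
    have "(\<psi> has_derivative (\<lambda>_. 0)) (at x)"
    proof (rule has_derivative_transform_within_open[of "\<lambda>_. 0"])
      show "open (- closure {x. \<psi> x \<noteq> 0})" by (simp add: open_Compl)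
      show "0 = \<psi> y" if "y \<in> - closure {x. \<psi> x \<noteq> 0}" for y
        using that closure_subset[of "{x. \<psi> x \<noteq> 0}"] by auto
    qed (use x in auto)
    then have "frechet_derivative \<psi> (at x) = (\<lambda>_. 0)"
      using frechet_derivative_at by metis
    then show ?thesis by (simp add: partial_deriv_def)
  qed
qed

text \<open>The product of \<open>f\<close> with a test function, extended by 0, is differentiable
  on the whole space, because \<open>\<Omega>\<close> and the complement of the support form an open
  cover. Its partial derivative is \<open>a + b\<close> and has integral 0, which is integration by
  parts.\<close>

lemma weak_partial_C1:
  fixes f :: "real^'n \<Rightarrow> real"
  assumes \<Omega>: "open \<Omega>" and d: "\<And>x. x \<in> \<Omega> \<Longrightarrow> (f has_derivative f' x) (at x)"
    and c: "continuous_on \<Omega> (\<lambda>x. f' x (axis i 1))"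
  shows "weak_partial \<Omega> i f (\<lambda>x. f' x (axis i 1))"
  unfolding weak_partial_def
proof (intro conjI allI impI)
  have fc: "continuous_on \<Omega> f"
    using d has_derivative_continuous continuous_at_imp_continuous_on by blast
  then show "locally_integrable \<Omega> f" by (rule locally_integrable_continuous)
  show "locally_integrable \<Omega> (\<lambda>x. f' x (axis i 1))" using c by (rule locally_integrable_continuous)
  fix \<psi> assume t: "test_function \<Omega> \<psi>"
  define K where "K = closure {x. \<psi> x \<noteq> 0}"
  have K: "compact K" "K \<subseteq> \<Omega>" using t by (auto simp: test_function_def K_def)
  note T = test_function_partial[OF t, folded K_def]
  have \<psi>c: "continuous_on S \<psi>" for S
    using T(1) has_derivative_continuous continuous_at_imp_continuous_on by blast
  define a where "a x = (if x \<in> \<Omega> then f x * partial_deriv i \<psi> x else 0)" for x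
  define b where "b x = (if x \<in> \<Omega> then f' x (axis i 1) * \<psi> x else 0)" for x
  define g where "g x = (if x \<in> \<Omega> then f x * \<psi> x else 0)" for x
  define g' where "g' x = (if x \<in> \<Omega> then (\<lambda>h. f x * frechet_derivative \<psi> (at x) h + f' x h * \<psi> x) else (\<lambda>_. 0))" for x
  have zero: "a x = 0" "b x = 0" "g x = 0" if "x \<notin> K" for x
    using T(3,4) that by (auto simp: a_def b_def g_def)
  have glue: "continuous_on UNIV k" if "continuous_on \<Omega> k" "\<And>x. x \<notin> K \<Longrightarrow> k x = 0" for k :: "real^'n \<Rightarrow> real"
  proof -
    have "continuous_on (- K) k \<longleftrightarrow> continuous_on (- K) (\<lambda>_. 0::real)"
      using that(2) by (intro continuous_on_cong) auto
    then have "continuous_on (\<Omega> \<union> - K) k"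
      using that(1) \<Omega> K by (intro continuous_on_open_Un) (auto simp: compact_imp_closed open_Compl)
    moreover have "\<Omega> \<union> - K = UNIV" using K by auto
    ultimately show ?thesis by simp
  qed
  have ac: "continuous_on UNIV a"
  proof (rule glue[OF _ zero(1)])
    have "continuous_on \<Omega> (\<lambda>x. f x * partial_deriv i \<psi> x)"
      by (intro continuous_intros fc continuous_on_subset[OF T(2)]) auto
    then show "continuous_on \<Omega> a" by (subst continuous_on_cong[OF refl]) (auto simp: a_def)
  qed
  have bc: "continuous_on UNIV b"
  proof (rule glue[OF _ zero(2)])
    have "continuous_on \<Omega> (\<lambda>x. f' x (axis i 1) * \<psi> x)" by (intro continuous_intros c \<psi>c)
    then show "continuous_on \<Omega> b" by (subst continuous_on_cong[OF refl]) (auto simp: b_def)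
  qed
  have int: "integrable lborel a" "integrable lborel b"
    using integrable_continuous_compact_support[OF K(1)] ac bc zero by auto
  have gd: "(g has_derivative g' x) (at x)" for x
  proof (cases "x \<in> \<Omega>")
    case True
    have "((\<lambda>x. f x * \<psi> x) has_derivative g' x) (at x)"
      using True has_derivative_mult[OF d[OF True] T(1)] by (simp add: g'_def)
    then show ?thesis
      by (rule has_derivative_transform_within_open[OF _ \<Omega> True]) (simp add: g_def)
  next
    case False
    then have "x \<in> - K" using K by auto
    have "((\<lambda>_. 0) has_derivative (\<lambda>_. 0)) (at x)" by simp
    then have "(g has_derivative (\<lambda>_. 0)) (at x)"
      by (rule has_derivative_transform_within_open[OF _ _ \<open>x \<in> - K\<close>])
        (use K zero in \<open>auto simp: compact_imp_closed open_Compl\<close>)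
    then show ?thesis using False by (simp add: g'_def)
  qed
  have g'ab: "g' x (axis i 1) = a x + b x" for x
    by (simp add: g'_def a_def b_def partial_deriv_def)
  obtain \<rho> where \<rho>: "K \<subseteq> cball 0 \<rho>"
    using compact_imp_bounded[OF K(1)] by (auto simp: bounded_iff subset_iff)
  have "integral\<^sup>L lborel (\<lambda>x. g' x (axis i 1)) = 0"
  proof (rule integral_partial_derivative_eq_0[OF gd])
    show "continuous_on UNIV (\<lambda>x. g' x (axis i 1))" unfolding g'ab by (intro continuous_intros ac bc)
    show "g x = 0" if "x \<notin> cball 0 \<rho>" for x using that \<rho> zero by blast
  qed
  then have "integral\<^sup>L lborel a + integral\<^sup>L lborel b = 0"
    unfolding g'ab using int by simp
  moreover have m: "\<Omega> \<in> sets lebesgue" using \<Omega> by auto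
  have "integral\<^sup>L (lebesgue_on \<Omega>) (\<lambda>x. f x * partial_deriv i \<psi> x) = integral\<^sup>L lebesgue a"
    "integral\<^sup>L (lebesgue_on \<Omega>) (\<lambda>x. f' x (axis i 1) * \<psi> x) = integral\<^sup>L lebesgue b"
    unfolding a_def b_def by (subst Lebesgue_Measure.integral_restrict_UNIV[OF m], rule refl)+
  moreover have "integral\<^sup>L lebesgue a = integral\<^sup>L lborel a" "integral\<^sup>L lebesgue b = integral\<^sup>L lborel b"
    using int by (auto intro: integral_completion)
  ultimately show "integral\<^sup>L (lebesgue_on \<Omega>) (\<lambda>x. f x * partial_deriv i \<psi> x)
      = - integral\<^sup>L (lebesgue_on \<Omega>) (\<lambda>x. f' x (axis i 1) * \<psi> x)" by simp
qed

text \<open>Classical derivatives are weak ones. The compact \<open>K\<close> between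
  \<open>\<Omega>\<close> and the domain \<open>U\<close> of smoothness bounds all of them on
  \<open>\<Omega>\<close>, and this gives square integrability.\<close>

lemma W22_C2:
  fixes f :: "real^'n \<Rightarrow> real"
  assumes \<Omega>: "open \<Omega>" "\<Omega> \<subseteq> K" "compact K" "K \<subseteq> U"
    and d: "\<And>x. x \<in> U \<Longrightarrow> (f has_derivative (\<lambda>h. \<Sum>i\<in>UNIV. df i x * h $ i)) (at x)"
    and d2: "\<And>i x. x \<in> U \<Longrightarrow> (df i has_derivative (\<lambda>h. \<Sum>j\<in>UNIV. d2f i j x * h $ j)) (at x)"
    and c: "\<And>i j. continuous_on U (d2f i j)"
  shows "W22 \<Omega> f" "weak_partial \<Omega> i f (df i)"
proof -
  have \<Omega>U: "\<Omega> \<subseteq> U" and KU: "K \<subseteq> U" and m: "\<Omega> \<in> sets lebesgue" using \<Omega> by auto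
  have sum: "(\<Sum>i\<in>UNIV. e i * axis k 1 $ i) = e k" for e :: "'n \<Rightarrow> real" and k
    by (simp add: axis_def if_distrib cong: if_cong)
  have c0: "continuous_on U f" and c1: "continuous_on U (df i)" for i
    by (meson d d2 has_derivative_continuous continuous_at_imp_continuous_on)+
  have w1: "weak_partial \<Omega> i f (df i)" for i
    using weak_partial_C1[OF \<Omega>(1) d, of i] continuous_on_subset[OF c1 \<Omega>U] \<Omega>U by (simp add: sum subset_iff)
  have w2: "weak_partial \<Omega> j (df i) (d2f i j)" for i j
    using weak_partial_C1[OF \<Omega>(1) d2, of i j] continuous_on_subset[OF c \<Omega>U] \<Omega>U by (simp add: sum subset_iff)
  have sq: "square_integrable \<Omega> f" "square_integrable \<Omega> (df i)" "square_integrable \<Omega> (d2f i j)" for i j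
    using square_integrable_continuous[OF \<Omega>(3) continuous_on_subset[OF _ KU] \<Omega>(2) m] c c0 c1 by auto
  show "W22 \<Omega> f"
    unfolding W22_def using w1 w2 sq by blast
  show "weak_partial \<Omega> i f (df i)" by (rule w1)
qed

section \<open>The profile near its singular edge\<close>

text \<open>The function \<open>exp (- C * t) * y t - b * t\<close> does not increase.\<close>

lemma gronwall_right:
  fixes y y' :: "real \<Rightarrow> real"
  assumes d: "\<And>s. 0 \<le> s \<Longrightarrow> s \<le> L \<Longrightarrow> (y has_real_derivative y' s) (at s)"
    and le: "\<And>s. 0 \<le> s \<Longrightarrow> s \<le> L \<Longrightarrow> y' s \<le> C * y s + b"
    and pos: "C \<ge> 0" "b \<ge> 0" "y 0 \<ge> 0" and t: "0 \<le> t" "t \<le> L"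
  shows "y t \<le> (y 0 + b * L) * exp (C * L)"
proof -
  have "exp (- C * t) * y t - b * t \<le> exp (- C * 0) * y 0 - b * 0"
  proof (rule DERIV_nonpos_imp_nonincreasing[OF t(1)])
    fix s assume s: "0 \<le> s" "s \<le> t"
    then have sL: "s \<le> L" using t by simp
    have "((\<lambda>s. exp (- C * s) * y s - b * s) has_real_derivative exp (- C * s) * (y' s - C * y s) - b) (at s)"
      by (auto intro!: derivative_eq_intros d s sL simp: algebra_simps)
    moreover have "exp (- C * s) * (y' s - C * y s) \<le> 1 * b"
    \<comment> \<open>The factor \<open>exp (- C * s)\<close> may be replaced by 1 only when the
      bracket is nonnegative; otherwise the product is nonpositive and \<open>b \<ge> 0\<close>
      suffices.\<close>
    proof (cases "y' s - C * y s \<ge> 0")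
      case True
      then show ?thesis using le[OF s(1) sL] pos s by (intro mult_mono) auto
    next
      case False
      then have "exp (- C * s) * (y' s - C * y s) \<le> 0" by (simp add: mult_nonneg_nonpos)
      then show ?thesis using pos by simp
    qed
    ultimately show "\<exists>d. ((\<lambda>s. exp (- C * s) * y s - b * s) has_real_derivative d) (at s) \<and> d \<le> 0"
      by (intro exI[of _ "exp (- C * s) * (y' s - C * y s) - b"]) simp
  qed
  then have "exp (- (C * t)) * y t \<le> y 0 + b * t" by simp
  then have "y t \<le> (y 0 + b * t) * exp (C * t)" by (simp add: exp_minus field_simps)
  also have "\<dots> \<le> (y 0 + b * L) * exp (C * L)"
    using pos t by (intro mult_mono add_mono mult_left_mono) (auto intro: mult_left_mono)
  finally show ?thesis .
qed

lemma gronwall: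
  fixes y y' :: "real \<Rightarrow> real"
  assumes d: "\<And>s. \<bar>s\<bar> \<le> L \<Longrightarrow> (y has_real_derivative y' s) (at s)"
    and le: "\<And>s. \<bar>s\<bar> \<le> L \<Longrightarrow> \<bar>y' s\<bar> \<le> C * y s + b"
    and pos: "C \<ge> 0" "b \<ge> 0" "y 0 \<ge> 0" and t: "\<bar>t\<bar> \<le> L"
  shows "y t \<le> (y 0 + b * L) * exp (C * L)"
proof (cases "t \<ge> 0")
  case True
  show ?thesis
  proof (rule gronwall_right[of L y y'])
    show "y' s \<le> C * y s + b" if "0 \<le> s" "s \<le> L" for s using le[of s] that by auto
  qed (use assms True in auto)
next
  case False
  have "y (- (- t)) \<le> (y (- 0) + b * L) * exp (C * L)"
  proof (rule gronwall_right[of L "\<lambda>s. y (- s)" "\<lambda>s. - y' (- s)"])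
    show "((\<lambda>s. y (- s)) has_real_derivative - y' (- s)) (at s)" if "0 \<le> s" "s \<le> L" for s
      using that d[of "-s"] by (simp add: DERIV_mirror)
    show "- y' (- s) \<le> C * y (- s) + b" if "0 \<le> s" "s \<le> L" for s using le[of "-s"] that by auto
  qed (use assms False in auto)
  then show ?thesis by simp
qed

section \<open>The separatrix of the frictionless pendulum\<close>

text \<open>The solution of \<open>y'' = sin y\<close> that leaves the equilibrium 0 at minus
  infinity and passes \<open>pi\<close> at \<open>a = A\<close>. With \<open>a = u + v\<close> it is
  the asymptotic angle of the pseudosphere, and \<open>a = A\<close> is its singular edge.\<close>

definition sep :: "real \<Rightarrow> real \<Rightarrow> real" where "sep A a = 4 * arctan (exp (a - A))"
definition sep1 :: "real \<Rightarrow> real \<Rightarrow> real" where "sep1 A a = 2 / cosh (a - A)"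

lemma one_minus_cos_le: "1 - cos x \<le> x\<^sup>2 / 2" for x :: real
proof -
  have "(sin (x / 2))\<^sup>2 \<le> (x / 2)\<^sup>2"
    using abs_sin_x_le_abs_x[of "x / 2"] unfolding abs_le_square_iff .
  moreover have "1 - cos x = 2 * (sin (x / 2))\<^sup>2" using cos_double_sin[of "x / 2"] by simp
  ultimately show ?thesis by (simp add: power_divide)
qed

lemma cosh_sinh_exp:
  fixes t :: real
  shows "cosh t = (1 + (exp t)\<^sup>2) / (2 * exp t)" "sinh t = - (1 - (exp t)\<^sup>2) / (2 * exp t)"
  by (simp_all add: cosh_field_def sinh_field_def exp_minus field_simps power2_eq_square)

lemma sep_trig: "sin (sep A a) = - 2 * sinh (a - A) / (cosh (a - A))\<^sup>2" "cos (sep A a) = 1 - 2 / (cosh (a - A))\<^sup>2"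
proof -
  define x where "x = exp (a - A)"
  define \<theta> where "\<theta> = arctan x"
  have x: "x > 0" by (simp add: x_def)
  have p: "1 + x\<^sup>2 > 0" by (simp add: add_pos_nonneg)
  have "cos \<theta> = 1 / sqrt (1 + x\<^sup>2)" "sin \<theta> = x / sqrt (1 + x\<^sup>2)"
    by (simp_all add: \<theta>_def cos_arctan sin_arctan)
  then have s2: "sin (2 * \<theta>) = 2 * x / (1 + x\<^sup>2)" and c2: "cos (2 * \<theta>) = (1 - x\<^sup>2) / (1 + x\<^sup>2)"
    using p by (simp_all add: sin_double cos_double power_divide diff_divide_distrib)
  have "sep A a = 2 * (2 * \<theta>)" by (simp add: sep_def \<theta>_def x_def)
  then have "sin (sep A a) = 2 * (2 * x / (1 + x\<^sup>2)) * ((1 - x\<^sup>2) / (1 + x\<^sup>2))"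
    and "cos (sep A a) = 1 - 2 * (2 * x / (1 + x\<^sup>2))\<^sup>2"
    using sin_double[of "2 * \<theta>"] cos_double_sin[of "2 * \<theta>"] by (simp_all only: s2 c2)
  moreover have CS: "cosh (a - A) = (1 + x\<^sup>2) / (2 * x)" "sinh (a - A) = - (1 - x\<^sup>2) / (2 * x)"
    unfolding x_def by (rule cosh_sinh_exp)+
  moreover have "- 2 * (- b / (2 * x)) / (P / (2 * x))\<^sup>2 = 2 * (2 * x / P) * (b / P)"
    "1 - 2 / (P / (2 * x))\<^sup>2 = 1 - 2 * (2 * x / P)\<^sup>2" if "P > 0" for b P
    using x that by (simp_all add: field_simps power2_eq_square)
  ultimately show "sin (sep A a) = - 2 * sinh (a - A) / (cosh (a - A))\<^sup>2" "cos (sep A a) = 1 - 2 / (cosh (a - A))\<^sup>2"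
    using p by presburger+
qed

lemma sep_deriv: "(sep A has_real_derivative sep1 A a) (at a)"
proof -
  have "((\<lambda>a. 4 * arctan (exp (a - A))) has_real_derivative 4 * (inverse (1 + (exp (a - A))\<^sup>2) * exp (a - A))) (at a)"
    by (rule DERIV_cmult, rule DERIV_chain2[OF DERIV_arctan]) (auto intro!: derivative_eq_intros)
  moreover have "4 * (inverse (1 + (exp (a - A))\<^sup>2) * exp (a - A)) = sep1 A a"
  proof -
    define x where "x = exp (a - A)"
    have "x > 0" "1 + x\<^sup>2 > 0" by (auto simp: x_def add_pos_nonneg)
    then show ?thesis
      unfolding sep1_def cosh_sinh_exp x_def[symmetric] by (simp add: field_simps)
  qed
  ultimately show ?thesis by (simp add: sep_def[abs_def])
qed

lemma sep1_deriv: "(sep1 A has_real_derivative sin (sep A a)) (at a)"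
proof -
  have "((\<lambda>a. 2 / cosh (a - A)) has_real_derivative - 2 * sinh (a - A) / (cosh (a - A))\<^sup>2) (at a)"
    by (auto intro!: derivative_eq_intros simp: power2_eq_square)
  then show ?thesis by (simp add: sep1_def[abs_def] sep_trig)
qed

text \<open>The identity puts the separatrix on the energy level
  \<open>sep1\<^sup>2 + 2 * cos sep = 2\<close> of the equilibrium 0; the profile starts just below
  this level when \<open>n\<close> is large.\<close>

lemma sep1_bounds: "0 < sep1 A a" "sep1 A a \<le> 2" "(sep1 A a)\<^sup>2 = 2 * (1 - cos (sep A a))"
  using cosh_real_ge_1[of "a - A"] cosh_real_pos[of "a - A"]
  by (auto simp: sep1_def sep_trig power_divide divide_le_eq)

lemma sep_mono: "a \<le> b \<Longrightarrow> sep A a \<le> sep A b"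
  by (simp add: sep_def arctan_monotone')

lemma sep_pos: "sep A a > 0"
  by (simp add: sep_def)

lemma sep_less_pi: "a < A \<Longrightarrow> sep A a < pi"
proof -
  assume "a < A"
  then have "arctan (exp (a - A)) < arctan 1" by (intro arctan_monotone) simp
  then show ?thesis by (simp add: sep_def arctan_one)
qed

lemma sep_lipschitz: "\<bar>sep A a - sep A b\<bar> \<le> 2 * \<bar>a - b\<bar>"
  and sep1_lipschitz: "\<bar>sep1 A a - sep1 A b\<bar> \<le> 1 * \<bar>a - b\<bar>"
proof -
  have "norm (sep A a - sep A b) \<le> 2 * norm (a - b)"
    by (rule field_differentiable_bound[of UNIV "sep A" "sep1 A"])
      (use sep_deriv sep1_bounds less_imp_le in \<open>auto simp: abs_of_pos\<close>)
  then show "\<bar>sep A a - sep A b\<bar> \<le> 2 * \<bar>a - b\<bar>" by simp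
  have "norm (sep1 A a - sep1 A b) \<le> 1 * norm (a - b)"
    by (rule field_differentiable_bound[of UNIV "sep1 A" "\<lambda>a. sin (sep A a)"]) (use sep1_deriv in auto)
  then show "\<bar>sep1 A a - sep1 A b\<bar> \<le> 1 * \<bar>a - b\<bar>" by simp
qed

section \<open>Following the separatrix when there are many waves\<close>

context amsler
begin

lemma q_hits:
  assumes "pi / real n \<le> \<alpha>" "\<alpha> < pi"
  obtains z where "0 \<le> z" "z < Z" "q z = \<alpha>"
proof -
  obtain z where z: "0 \<le> z" "z \<le> Z" "q z = \<alpha>"
    using IVT'[of q 0 \<alpha> Z] assms Z q_cont by auto
  moreover from this have "z \<noteq> Z" using Z assms by auto
  ultimately show ?thesis using that by auto
qed

text \<open>The energy bound gives \<open>q1\<^sup>2 \<le> 2 * (1 - cos q) \<le> q\<^sup>2\<close>,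
  so the growth is at most exponential. Its use is in the other direction: for large
  \<open>n\<close> the profile reaches a fixed angle only at large \<open>z\<close>.\<close>

lemma q_le_exp:
  assumes "0 \<le> z" "z \<le> Z"
  shows "q z \<le> pi / real n * exp z"
proof -
  have "exp (- z) * q z \<le> exp (- 0) * q 0"
  proof (rule DERIV_nonpos_imp_nonincreasing[OF assms(1)])
    fix x assume x: "0 \<le> x" "x \<le> z"
    have "((\<lambda>z. exp (- z) * q z) has_real_derivative exp (- x) * (q1 x - q x)) (at x)"
      by (auto intro!: derivative_eq_intros q_deriv simp: algebra_simps)
    moreover have "q1 x \<le> q x"
    proof (rule power2_le_imp_le)
      show "(q1 x)\<^sup>2 \<le> (q x)\<^sup>2"
        using q1_le_2(1)[OF x(1)] one_minus_cos_le[of "q x"] by (simp add: right_diff_distrib)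
      show "0 \<le> q x" using q_ge[OF x(1)] angle_bounds by simp
    qed
    ultimately show "\<exists>d. ((\<lambda>z. exp (- z) * q z) has_real_derivative d) (at x) \<and> d \<le> 0"
      by (intro exI[of _ "exp (- x) * (q1 x - q x)"]) (auto simp: mult_nonneg_nonpos)
  qed
  then show ?thesis by (simp add: exp_minus field_simps)
qed

text \<open>The dissipation \<open>2 * q1\<^sup>2 / x\<close> is compared with \<open>q1\<close>,
  whose integral is the increase of the angle. Before \<open>y\<close> it is at most
  \<open>q1\<close>, because \<open>q1 / x \<le> 1 / 2\<close>, and costs at most
  \<open>\<delta>\<close>. After \<open>y\<close> it is at most \<open>4 / y * q1\<close>, because
  \<open>q1 \<le> 2\<close>, and costs at most \<open>4 * pi / y\<close>.\<close>

lemma energy_loss: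
  assumes y: "0 < y" "q y = \<delta>" and z: "y \<le> z" "z < Z"
  shows "(q1 z)\<^sup>2 + 2 * cos (q z) \<ge> 2 * cos (pi / real n) - \<delta> - 4 * pi / y"
proof -
  define E where "E x = (q1 x)\<^sup>2 + 2 * cos (q x)" for x
  have Ed: "(E has_real_derivative - (2 * (q1 x)\<^sup>2 / x)) (at x)" if "x > 0" for x
    unfolding E_def using that
    by (auto intro!: derivative_eq_intros q1_deriv q_deriv simp: power2_eq_square field_simps)
  have Ec: "continuous_on S E" for S unfolding E_def by (intro continuous_intros q1_cont q_cont)
  have q1: "0 \<le> q1 x" "q1 x \<le> 2" if "0 \<le> x" "x \<le> z" for x
    using q1_nonneg[of x] q1_le_2[of x] Z(3) that z by auto
  have "E 0 + q 0 \<le> E y + q y"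
  proof (rule DERIV_nonneg_imp_increasing_open[where f = "\<lambda>x. E x + q x"])
    fix x assume x: "0 < x" "x < y"
    have "((\<lambda>x. E x + q x) has_real_derivative - (2 * (q1 x)\<^sup>2 / x) + q1 x) (at x)"
      using x by (intro derivative_intros Ed q_deriv) auto
    moreover have "- (2 * (q1 x)\<^sup>2 / x) + q1 x = q1 x * (1 - 2 * (q1 x / x))"
      by (simp add: power2_eq_square algebra_simps)
    moreover have "0 \<le> q1 x * (1 - 2 * (q1 x / x))"
      using q1_div_le(1)[of x] q1(1)[of x] x z by (intro mult_nonneg_nonneg) auto
    ultimately show "\<exists>d. ((\<lambda>x. E x + q x) has_real_derivative d) (at x) \<and> 0 \<le> d" by metis
  qed (use y in \<open>auto intro!: continuous_intros Ec q_cont\<close>)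
  moreover have "E y + 4 / y * q y \<le> E z + 4 / y * q z"
  proof (rule DERIV_nonneg_imp_increasing_open[OF z(1), where f = "\<lambda>x. E x + 4 / y * q x"])
    fix x assume x: "y < x" "x < z"
    have "((\<lambda>x. E x + 4 / y * q x) has_real_derivative - (2 * (q1 x)\<^sup>2 / x) + 4 / y * q1 x) (at x)"
      using x y by (intro DERIV_add DERIV_cmult Ed q_deriv) auto
    moreover have "- (2 * (q1 x)\<^sup>2 / x) + 4 / y * q1 x = q1 x * (4 / y - 2 * (q1 x / x))"
      by (simp add: power2_eq_square algebra_simps)
    moreover have "q1 x / x \<le> 2 / y" using q1[of x] x y by (intro frac_le) auto
    then have "0 \<le> q1 x * (4 / y - 2 * (q1 x / x))"
      using q1(1)[of x] x y by (intro mult_nonneg_nonneg) auto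
    ultimately show "\<exists>d. ((\<lambda>x. E x + 4 / y * q x) has_real_derivative d) (at x) \<and> 0 \<le> d" by metis
  qed (use y in \<open>auto intro!: continuous_intros Ec q_cont\<close>)
  moreover have "4 / y * q z \<le> 4 / y * pi" using Z(3)[of z] z y by (intro mult_left_mono) auto
  moreover have "4 / y * q y \<ge> 0" using q_ge[of y] y angle_bounds by simp
  moreover have "E 0 = 2 * cos (pi / real n)" by (simp add: E_def)
  ultimately show ?thesis using y(2) angle_bounds by (simp add: E_def)
qed

text \<open>Gronwall's inequality for the squared distance in phase space. The two equations differ
  only by the friction, which on this range is at most \<open>2 / (z0 - L)\<close>.\<close>

lemma separatrix_comparison:
  assumes z0: "z0 > L" and q0: "q z0 = sep A 0" and \<sigma>: "\<bar>q1 z0 - sep1 A 0\<bar> \<le> \<sigma>" "2 / (z0 - L) \<le> \<sigma>"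
    and a: "\<bar>a\<bar> \<le> L"
  shows "(q (z0 + a) - sep A a)\<^sup>2 + (q1 (z0 + a) - sep1 A a)\<^sup>2 \<le> (\<sigma>\<^sup>2 + \<sigma>\<^sup>2 * L) * exp (3 * L)"
proof -
  define y where "y a = (q (z0 + a) - sep A a)\<^sup>2 + (q1 (z0 + a) - sep1 A a)\<^sup>2" for a
  define D where "D a = q (z0 + a) - sep A a" for a
  define D1 where "D1 a = q1 (z0 + a) - sep1 A a" for a
  define y' where "y' a = 2 * D a * D1 a + 2 * D1 a * (sin (q (z0 + a)) - q1 (z0 + a) / (z0 + a) - sin (sep A a))" for a
  have "y a \<le> (y 0 + \<sigma>\<^sup>2 * L) * exp (3 * L)"
  proof (rule gronwall[of L y y'])
    fix s assume s: "\<bar>s\<bar> \<le> L"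
    then have z: "z0 + s > 0" using z0 by linarith
    define k where "k = q1 (z0 + s) / (z0 + s)"
    have y's: "y' s = 2 * D s * D1 s + 2 * D1 s * (sin (q (z0 + s)) - k - sin (sep A s))"
      by (simp add: y'_def k_def)
    have "((\<lambda>a. q (z0 + a)) has_real_derivative q1 (z0 + s)) (at s)"
      using q_deriv[of "s + z0"] unfolding DERIV_shift by (simp add: add.commute)
    moreover have "((\<lambda>a. q1 (z0 + a)) has_real_derivative sin (q (z0 + s)) - k) (at s)"
      using q1_deriv[of "s + z0"] z unfolding DERIV_shift by (simp add: add.commute k_def)
    ultimately show "(y has_real_derivative y' s) (at s)"
      unfolding y_def y's
      by (auto intro!: derivative_eq_intros sep_deriv sep1_deriv simp: D_def D1_def algebra_simps)
    have "\<bar>k\<bar> \<le> 2 / (z0 - L)"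
      unfolding k_def abs_divide using q1_le_2(2)[of "z0 + s"] z z0 s by (intro frac_le) auto
    then have k: "\<bar>k\<bar> \<le> \<sigma>" using \<sigma> by simp
    have "\<bar>y' s\<bar> \<le> 2 * \<bar>D s\<bar> * \<bar>D1 s\<bar> + 2 * \<bar>D1 s\<bar> * (\<bar>D s\<bar> + \<sigma>)"
    proof -
      have "\<bar>sin (q (z0 + s)) - k - sin (sep A s)\<bar> \<le> \<bar>D s\<bar> + \<sigma>"
        using abs_sin_diff_le[of "q (z0 + s)" "sep A s"] k unfolding D_def by linarith
      then have "\<bar>2 * D1 s * (sin (q (z0 + s)) - k - sin (sep A s))\<bar> \<le> 2 * \<bar>D1 s\<bar> * (\<bar>D s\<bar> + \<sigma>)"
        by (simp add: abs_mult mult_left_mono)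
      moreover have "\<bar>2 * D s * D1 s\<bar> = 2 * \<bar>D s\<bar> * \<bar>D1 s\<bar>" by (simp add: abs_mult)
      ultimately show ?thesis unfolding y's by linarith
    qed
    also have "\<dots> \<le> 3 * y s + \<sigma>\<^sup>2"
    proof -
      \<comment> \<open>Expanding these squares is exactly the claimed inequality.\<close>
      have "0 \<le> 2 * (\<bar>D s\<bar> - \<bar>D1 s\<bar>)\<^sup>2 + (\<bar>D1 s\<bar> - \<sigma>)\<^sup>2 + \<bar>D s\<bar>\<^sup>2" by simp
      moreover have "y s = \<bar>D s\<bar>\<^sup>2 + \<bar>D1 s\<bar>\<^sup>2" by (simp add: y_def D_def D1_def)
      ultimately show ?thesis by (simp only: power2_eq_square algebra_simps)
    qed
    finally show "\<bar>y' s\<bar> \<le> 3 * y s + \<sigma>\<^sup>2" .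
  qed (use a in \<open>auto simp: y_def\<close>)
  also have "y 0 \<le> \<sigma>\<^sup>2"
    using \<sigma>(1) by (simp add: y_def q0 abs_le_square_iff[symmetric])
  finally show ?thesis using a by (simp add: y_def mult_right_mono)
qed

end

text \<open>The point \<open>z0\<close> is where the profile takes the value \<open>sep A 0\<close>.
  There its energy is still close to that of the separatrix, so the slopes nearly agree as well, and
  the comparison applies with nearly equal initial data. The bound
  \<open>z0 > L + 1 / \<eta>\<close> records that this happens far from the origin.\<close>

lemma amsler_pendulum_limit:
  fixes A L \<eta> :: real
  assumes A: "A > 0" and L: "L > 0" and \<eta>: "\<eta> > 0"
  shows "\<exists>N. \<forall>n\<ge>N. \<forall>\<psi> \<psi>1. amsler n \<psi> \<psi>1 \<longrightarrow> (\<exists>z0. z0 > L + 1 / \<eta> \<and> z0 < amsler.Z \<psi> \<and>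
    (\<forall>a. \<bar>a\<bar> \<le> L \<longrightarrow> \<bar>amsler.q \<psi> (z0 + a) - sep A a\<bar> \<le> \<eta> \<and> \<bar>amsler.q1 \<psi>1 (z0 + a) - sep1 A a\<bar> \<le> \<eta>))"
proof -
  define \<alpha> where "\<alpha> = sep A 0"
  define g where "g = sep1 A 0"
  have \<alpha>: "0 < \<alpha>" "\<alpha> < pi" using sep_pos sep_less_pi A by (auto simp: \<alpha>_def)
  have g: "g > 0" "g\<^sup>2 = 2 * (1 - cos \<alpha>)" using sep1_bounds[of A 0] by (auto simp: g_def \<alpha>_def)
  define \<sigma> where "\<sigma> = \<eta> / sqrt ((1 + L) * exp (3 * L))"
  have \<sigma>: "\<sigma> > 0" "(\<sigma>\<^sup>2 + \<sigma>\<^sup>2 * L) * exp (3 * L) = \<eta>\<^sup>2"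
  proof -
    show "\<sigma> > 0" using \<eta> L by (simp add: \<sigma>_def)
    have "\<sigma>\<^sup>2 = \<eta>\<^sup>2 / ((1 + L) * exp (3 * L))" using L by (simp add: \<sigma>_def power_divide)
    then have "\<sigma>\<^sup>2 * ((1 + L) * exp (3 * L)) = \<eta>\<^sup>2" using L by simp
    then show "(\<sigma>\<^sup>2 + \<sigma>\<^sup>2 * L) * exp (3 * L) = \<eta>\<^sup>2" by (simp add: algebra_simps)
  qed
  \<comment> \<open>The permitted error \<open>g * \<sigma>\<close> of the squared slope is shared
    in thirds by the early loss \<open>\<delta>\<close>, the late loss \<open>4 * pi / y\<close> and
    the initial deficit \<open>2 * (1 - cos c)\<close>. The bound \<open>Y\<close> also makes the
    friction smaller than \<open>\<sigma>\<close>, and \<open>c0\<close> is so small that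
    exponential growth needs at least the length \<open>Y\<close> to reach
    \<open>\<delta>\<close>.\<close>
  define \<delta> where "\<delta> = min (\<alpha> / 2) (g * \<sigma> / 3)"
  define Y where "Y = max (12 * pi / (g * \<sigma>)) (L + 2 / \<sigma> + 1 / \<eta> + 1)"
  have Y: "Y > 0" using L \<sigma> \<eta> by (auto simp: Y_def less_max_iff_disj intro!: add_pos_pos)
  have \<delta>: "0 < \<delta>" "\<delta> < \<alpha>" "\<delta> \<le> g * \<sigma> / 3" using \<alpha> g \<sigma> by (auto simp: \<delta>_def)
  define c0 where "c0 = min (\<delta> * exp (- Y)) (min \<delta> (min 1 (g * \<sigma> / 3)))"
  have c0: "c0 > 0" using \<delta> g \<sigma> by (auto simp: c0_def)
  define N where "N = nat \<lceil>pi / c0\<rceil> + 1"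
  show ?thesis
  proof (intro exI[of _ N] allI impI)
    fix n \<psi> \<psi>1 assume nN: "n \<ge> N" and "amsler n \<psi> \<psi>1"
    then interpret amsler n \<psi> \<psi>1 by simp
    define c where "c = pi / real n"
    have "pi / c0 \<le> real n" using nN unfolding N_def by linarith
    then have c: "0 < c" "c \<le> c0" using c0 n by (auto simp: c_def field_simps)
    obtain y where y: "0 \<le> y" "y < Z" "q y = \<delta>"
      using q_hits[of \<delta>] c \<delta> \<alpha> by (auto simp: c_def c0_def)
    obtain z where z: "0 \<le> z" "z < Z" "q z = \<alpha>"
      using q_hits[of \<alpha>] c \<delta> \<alpha> by (auto simp: c_def c0_def)
    have yz: "y < z"
    proof (rule ccontr)
      assume "\<not> y < z"
      then have "q z \<le> q y" using q_mono[of y z] Z(3) y z by auto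
      then show False using y z \<delta> by simp
    qed
    have Yy: "Y \<le> y"
    proof -
      have "\<delta> \<le> c * exp y" using q_le_exp[of y] y by (simp add: c_def)
      also have "\<dots> \<le> \<delta> * exp (- Y) * exp y" using c by (intro mult_right_mono) (auto simp: c0_def)
      finally have "1 \<le> exp (y - Y)" using \<delta> by (simp add: exp_diff exp_minus field_simps)
      then show ?thesis by simp
    qed
    then have y0: "y > 0" using Y by simp
    have 1: "4 * pi / y \<le> g * \<sigma> / 3"
    proof -
      have "12 * pi / (g * \<sigma>) \<le> y" using Yy by (simp add: Y_def)
      then show ?thesis using g \<sigma> y0 by (simp add: field_simps)
    qed
    have 2: "2 * (1 - cos c) \<le> g * \<sigma> / 3"
    proof -
      have "2 * (1 - cos c) \<le> c * c" using one_minus_cos_le[of c] by (simp add: power2_eq_square)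
      also have "\<dots> \<le> 1 * (g * \<sigma> / 3)" using c g \<sigma> by (intro mult_mono) (auto simp: c0_def)
      finally show ?thesis by simp
    qed
    have "(q1 z)\<^sup>2 \<ge> g\<^sup>2 - g * \<sigma>"
      using energy_loss[OF y0 y(3) less_imp_le[OF yz] z(2)] 1 2 \<delta>(3)
      unfolding c_def[symmetric] z(3) g(2) right_diff_distrib by linarith
    moreover have "(q1 z)\<^sup>2 \<le> g\<^sup>2" using q1_le_2(1)[OF z(1)] by (simp add: z g)
    \<comment> \<open>Since \<open>q1 z + g \<ge> g > 0\<close>, dividing the difference of squares
      turns closeness of the squared slopes into closeness of the slopes.\<close>
    ultimately have "\<bar>q1 z - g\<bar> * (q1 z + g) \<le> g * \<sigma>"
      using q1_nonneg[of z] Z(3) z g by (simp add: abs_if power2_eq_square algebra_simps)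
    moreover have q1z: "q1 z \<ge> 0" using q1_nonneg[of z] Z(3) z by simp
    then have "\<bar>q1 z - g\<bar> * g \<le> \<bar>q1 z - g\<bar> * (q1 z + g)" by (intro mult_left_mono) auto
    ultimately have "\<bar>q1 z - g\<bar> * g \<le> \<sigma> * g" by (simp add: mult.commute)
    then have q1g: "\<bar>q1 z - g\<bar> \<le> \<sigma>" using g by simp
    have zL: "L + 2 / \<sigma> + 1 / \<eta> < z"
      using Yy yz unfolding Y_def by linarith
    have s: "2 / \<sigma> > 0" "1 / \<eta> > 0" using \<sigma> \<eta> by simp_all
    have zL': "z > L" using zL s by linarith
    have "2 / \<sigma> \<le> z - L" using zL s by linarith
    then have zs: "2 / (z - L) \<le> \<sigma>" using \<sigma>(1) zL' by (simp add: pos_divide_le_eq mult.commute)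
    show "\<exists>z0. z0 > L + 1 / \<eta> \<and> z0 < amsler.Z \<psi> \<and>
      (\<forall>a. \<bar>a\<bar> \<le> L \<longrightarrow> \<bar>amsler.q \<psi> (z0 + a) - sep A a\<bar> \<le> \<eta> \<and> \<bar>amsler.q1 \<psi>1 (z0 + a) - sep1 A a\<bar> \<le> \<eta>)"
    proof (intro exI[of _ z] conjI allI impI)
      show "z > L + 1 / \<eta>" using zL s by linarith
      show "z < amsler.Z \<psi>" by (rule z)
      fix a assume a: "\<bar>a\<bar> \<le> L"
      have "(q (z + a) - sep A a)\<^sup>2 + (q1 (z + a) - sep1 A a)\<^sup>2 \<le> \<eta>\<^sup>2"
        using separatrix_comparison[OF zL' _ _ zs a, of A] z q1g by (simp add: \<alpha>_def g_def \<sigma>)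
      then have "(q (z + a) - sep A a)\<^sup>2 \<le> \<eta>\<^sup>2" "(q1 (z + a) - sep1 A a)\<^sup>2 \<le> \<eta>\<^sup>2"
        by (smt (verit) zero_le_power2)+
      then show "\<bar>q (z + a) - sep A a\<bar> \<le> \<eta>" "\<bar>q1 (z + a) - sep1 A a\<bar> \<le> \<eta>"
        using \<eta> by (simp_all add: abs_le_square_iff[symmetric])
    qed
  qed
qed

section \<open>Asymptotic coordinates near a far diagonal point\<close>

text \<open>The gap between arithmetic and geometric mean is \<open>(a - b)\<^sup>2\<close> for the
  roots \<open>a\<close> and \<open>b\<close>, and \<open>a - b = (s - t) / (a + b)\<close> is small
  when \<open>m\<close> is large. The last bound is needed because the \<open>u\<close>-derivative
  of the angle is \<open>v * \<psi>1\<close>, whereas \<open>q1\<close> is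
  \<open>sqrt (u * v) * \<psi>1\<close>.\<close>

lemma sqrt_chart_bounds:
  fixes m s t L :: real
  assumes m: "m > L" and st: "\<bar>s\<bar> \<le> L" "\<bar>t\<bar> \<le> L"
  shows "2 * sqrt ((m + s) * (m + t)) \<le> 2 * m + s + t"
    "2 * m + s + t - 2 * sqrt ((m + s) * (m + t)) \<le> 4 * L\<^sup>2 / (2 * m - 2 * L)"
    "\<bar>(m + t) / sqrt ((m + s) * (m + t)) - 1\<bar> \<le> 2 * L / (m - L)"
proof -
  define a where "a = sqrt (m + s)"
  define b where "b = sqrt (m + t)"
  have p: "m + s \<ge> m - L" "m + t \<ge> m - L" "m - L > 0" using m st by (auto simp: abs_le_iff)
  have ab: "a > 0" "b > 0" "a\<^sup>2 = m + s" "b\<^sup>2 = m + t" "sqrt ((m + s) * (m + t)) = a * b"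
    using p by (auto simp: a_def b_def real_sqrt_mult)
  have diff: "2 * m + s + t - 2 * sqrt ((m + s) * (m + t)) = (a - b)\<^sup>2"
    unfolding ab(5) using ab(3,4) by (simp add: power2_diff)
  have "0 \<le> (a - b)\<^sup>2" by simp
  then show "2 * sqrt ((m + s) * (m + t)) \<le> 2 * m + s + t" unfolding diff[symmetric] by linarith
  have st2: "\<bar>s - t\<bar> \<le> 2 * L" using st by linarith
  have mul: "(a - b) * (a + b) = s - t" using ab(3,4) by (simp add: power2_eq_square algebra_simps)
  have "(a - b)\<^sup>2 * (a\<^sup>2 + b\<^sup>2) \<le> (a - b)\<^sup>2 * (a + b)\<^sup>2"
    using ab by (intro mult_left_mono) (auto simp: power2_sum)
  also have "\<dots> = (s - t)\<^sup>2" by (simp add: mul[symmetric] power_mult_distrib)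
  also have "\<dots> \<le> (2 * L)\<^sup>2" using st2 by (intro abs_le_square_iff[THEN iffD1]) auto
  finally have *: "(a - b)\<^sup>2 * (a\<^sup>2 + b\<^sup>2) \<le> 4 * L\<^sup>2" by (simp add: power_mult_distrib)
  have "(a - b)\<^sup>2 * (2 * m - 2 * L) \<le> (a - b)\<^sup>2 * (a\<^sup>2 + b\<^sup>2)"
    unfolding ab using p by (intro mult_left_mono) auto
  then have "(a - b)\<^sup>2 * (2 * m - 2 * L) \<le> 4 * L\<^sup>2" using * by simp
  then show "2 * m + s + t - 2 * sqrt ((m + s) * (m + t)) \<le> 4 * L\<^sup>2 / (2 * m - 2 * L)"
    unfolding diff using p by (simp add: pos_le_divide_eq)
  have "(m + t) / sqrt ((m + s) * (m + t)) - 1 = (b - a) / a"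
    unfolding ab(5) ab(4)[symmetric] using ab by (simp add: power2_eq_square field_simps)
  moreover have "\<bar>(b - a) / a\<bar> \<le> 2 * L / (m - L)"
  proof -
    have "\<bar>b - a\<bar> * a \<le> \<bar>a - b\<bar> * (a + b)" using ab by (simp add: abs_minus_commute mult_left_mono)
    also have "\<dots> = \<bar>s - t\<bar>" unfolding mul[symmetric] abs_mult using ab by simp
    finally have "\<bar>b - a\<bar> * a \<le> 2 * L" using st2 by simp
    then have "\<bar>b - a\<bar> / a \<le> 2 * L / a\<^sup>2" using ab(1) by (simp add: power2_eq_square field_simps)
    also have "\<dots> \<le> 2 * L / (m - L)" unfolding ab(3) using p st by (intro frac_le) auto
    finally show ?thesis using ab by simp
  qed
  ultimately show "\<bar>(m + t) / sqrt ((m + s) * (m + t)) - 1\<bar> \<le> 2 * L / (m - L)" by simp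
qed

text \<open>The diagonal point has \<open>2 * m = z0\<close>. The pendulum limit is used on the
  range \<open>2 * L + 1\<close>: the sum \<open>s + t\<close> is at most \<open>2 * L\<close> in
  absolute value, and replacing it by \<open>a = 2 * r - z0\<close> moves it by at most 1.\<close>

lemma amsler_chart_limit:
  fixes A L \<eta> :: real
  assumes A: "A > 0" and L: "L > 0" and \<eta>: "\<eta> > 0"
  shows "\<exists>N. \<forall>n\<ge>N. \<forall>\<psi> \<psi>1. amsler n \<psi> \<psi>1 \<longrightarrow> (\<exists>m>L. \<forall>s t. \<bar>s\<bar> \<le> L \<and> \<bar>t\<bar> \<le> L \<longrightarrow>
    \<bar>\<psi> ((m + s) * (m + t)) - sep A (s + t)\<bar> \<le> \<eta> \<and>
    \<bar>(m + t) * \<psi>1 ((m + s) * (m + t)) - sep1 A (s + t)\<bar> \<le> \<eta> \<and>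
    (sep A (s + t) < pi - \<eta> \<longrightarrow> (m + s, m + t) \<in> amsler_domain (amsler.Z \<psi>)))"
proof -
  \<comment> \<open>The bound with \<open>16 * L\<^sup>2 + 16 * L\<close> absorbs the error of the
    change of coordinates, and \<open>1 / (4 * L\<^sup>2)\<close> keeps the displacement of the
    argument below 1.\<close>
  define \<epsilon> where "\<epsilon> = min (\<eta> / 2) (min (1 / (2 * L)) (min (\<eta> / (16 * L\<^sup>2 + 16 * L)) (1 / (4 * L\<^sup>2))))"
  have p: "16 * L\<^sup>2 + 16 * L > 0" using L by (simp add: add_pos_pos)
  have \<epsilon>: "\<epsilon> > 0" "\<epsilon> \<le> \<eta> / 2" "\<epsilon> \<le> 1 / (2 * L)" "\<epsilon> \<le> \<eta> / (16 * L\<^sup>2 + 16 * L)" "\<epsilon> \<le> 1 / (4 * L\<^sup>2)"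
    using L \<eta> p unfolding \<epsilon>_def min_less_iff_conj
    by (simp_all only: zero_less_divide_iff min.cobounded1 min.coboundedI2) auto
  have L': "2 * L + 1 > 0" using L by simp
  obtain N where N: "\<And>n \<psi> \<psi>1. n \<ge> N \<Longrightarrow> amsler n \<psi> \<psi>1 \<Longrightarrow> \<exists>z0. z0 > (2 * L + 1) + 1 / \<epsilon> \<and> z0 < amsler.Z \<psi> \<and>
    (\<forall>a. \<bar>a\<bar> \<le> 2 * L + 1 \<longrightarrow> \<bar>amsler.q \<psi> (z0 + a) - sep A a\<bar> \<le> \<epsilon> \<and> \<bar>amsler.q1 \<psi>1 (z0 + a) - sep1 A a\<bar> \<le> \<epsilon>)"
    using amsler_pendulum_limit[OF A L' \<epsilon>(1)] by blast
  show ?thesis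
  proof (intro exI[of _ N] allI impI)
    fix n \<psi> \<psi>1 assume "n \<ge> N" and am: "amsler n \<psi> \<psi>1"
    then interpret amsler n \<psi> \<psi>1 by simp
    obtain z0 where z0: "z0 > (2 * L + 1) + 1 / \<epsilon>" "z0 < Z"
      and close: "\<And>a. \<bar>a\<bar> \<le> 2 * L + 1 \<Longrightarrow> \<bar>q (z0 + a) - sep A a\<bar> \<le> \<epsilon>"
        "\<And>a. \<bar>a\<bar> \<le> 2 * L + 1 \<Longrightarrow> \<bar>q1 (z0 + a) - sep1 A a\<bar> \<le> \<epsilon>"
      using N[OF \<open>n \<ge> N\<close> am] by blast
    define m where "m = z0 / 2"
    have m2: "2 * m = z0" by (simp add: m_def)
    have "1 / \<epsilon> > 0" using \<epsilon> by simp
    moreover have "1 / \<epsilon> \<ge> 2 * L" using \<epsilon>(1,3) L by (simp add: field_simps)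
    ultimately have m: "2 * m - 2 * L > 1 / \<epsilon>" "m > L" using z0 m2 by linarith+
    have e4: "4 * L\<^sup>2 / (2 * m - 2 * L) \<le> 4 * L\<^sup>2 * \<epsilon>" "2 * L / (m - L) \<le> 4 * L * \<epsilon>"
    proof -
      have "1 / (2 * m - 2 * L) \<le> \<epsilon>" using m \<epsilon>(1) by (simp add: field_simps)
      then have "4 * L\<^sup>2 * (1 / (2 * m - 2 * L)) \<le> 4 * L\<^sup>2 * \<epsilon>" "4 * L * (1 / (2 * m - 2 * L)) \<le> 4 * L * \<epsilon>"
        using L by (intro mult_left_mono; simp)+
      moreover have "2 * L / (m - L) = 4 * L * (1 / (2 * m - 2 * L))" using m by (simp add: field_simps)
      ultimately show "4 * L\<^sup>2 / (2 * m - 2 * L) \<le> 4 * L\<^sup>2 * \<epsilon>" "2 * L / (m - L) \<le> 4 * L * \<epsilon>" by simp_all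
    qed
    have e8: "16 * L\<^sup>2 * \<epsilon> + 16 * L * \<epsilon> \<le> \<eta>"
      using \<epsilon>(4) p by (simp add: pos_le_divide_eq algebra_simps)
    have e1: "4 * L\<^sup>2 * \<epsilon> \<le> 1" using \<epsilon>(5) L by (simp add: pos_le_divide_eq algebra_simps)
    show "\<exists>m>L. \<forall>s t. \<bar>s\<bar> \<le> L \<and> \<bar>t\<bar> \<le> L \<longrightarrow>
      \<bar>\<psi> ((m + s) * (m + t)) - sep A (s + t)\<bar> \<le> \<eta> \<and>
      \<bar>(m + t) * \<psi>1 ((m + s) * (m + t)) - sep1 A (s + t)\<bar> \<le> \<eta> \<and>
      (sep A (s + t) < pi - \<eta> \<longrightarrow> (m + s, m + t) \<in> amsler_domain (amsler.Z \<psi>))"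
    proof (intro exI[of _ m] conjI allI impI m(2); elim conjE)
      fix s t assume st: "\<bar>s\<bar> \<le> L" "\<bar>t\<bar> \<le> L"
      define r where "r = sqrt ((m + s) * (m + t))"
      note B = sqrt_chart_bounds[OF m(2) st, folded r_def]
      define a where "a = 2 * r - z0"
      have pos: "m + s > 0" "m + t > 0" using m st by linarith+
      have a: "a \<le> s + t" "s + t - a \<le> 4 * L\<^sup>2 * \<epsilon>"
        using B(1,2) m2 e4(1) by (auto simp: a_def)
      have aL: "\<bar>a\<bar> \<le> 2 * L + 1" using a st e1 unfolding abs_le_iff by linarith
      have z: "z0 + a = 2 * r" by (simp add: a_def)
      have r2: "(2 * r)\<^sup>2 / 4 = (m + s) * (m + t)" using pos by (simp add: r_def power_mult_distrib)
      have r0: "r > 0" using pos by (simp add: r_def)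
      have c: "\<bar>\<psi> ((m + s) * (m + t)) - sep A a\<bar> \<le> \<epsilon>" "\<bar>r * \<psi>1 ((m + s) * (m + t)) - sep1 A a\<bar> \<le> \<epsilon>"
        using close[OF aL] unfolding z q_def q1_def r2 by simp_all
      have l: "\<bar>sep A a - sep A (s + t)\<bar> \<le> 8 * L\<^sup>2 * \<epsilon>" "\<bar>sep1 A a - sep1 A (s + t)\<bar> \<le> 4 * L\<^sup>2 * \<epsilon>"
      proof -
        have "\<bar>a - (s + t)\<bar> \<le> 4 * L\<^sup>2 * \<epsilon>" using a by linarith
        then show "\<bar>sep A a - sep A (s + t)\<bar> \<le> 8 * L\<^sup>2 * \<epsilon>" "\<bar>sep1 A a - sep1 A (s + t)\<bar> \<le> 4 * L\<^sup>2 * \<epsilon>"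
          using sep_lipschitz[of A a "s + t"] sep1_lipschitz[of A a "s + t"] by simp_all
      qed
      have e0: "0 \<le> 16 * L * \<epsilon>" "0 \<le> 8 * L\<^sup>2 * \<epsilon>" using L \<epsilon> by simp_all
      have hL: "8 * L\<^sup>2 * \<epsilon> + 8 * L * \<epsilon> \<le> \<eta> / 2" using e8 by linarith
      show "\<bar>\<psi> ((m + s) * (m + t)) - sep A (s + t)\<bar> \<le> \<eta>"
        using c(1) l(1) hL \<epsilon>(2) e0 by linarith
      have "\<bar>((m + t) / r - 1) * q1 (2 * r)\<bar> \<le> (4 * L * \<epsilon>) * 2"
        unfolding abs_mult using B(3) e4(2) q1_le_2(2)[of "2 * r"] r0 by (intro mult_mono) auto
      moreover have "((m + t) / r - 1) * q1 (2 * r) = (m + t) * \<psi>1 ((m + s) * (m + t)) - r * \<psi>1 ((m + s) * (m + t))"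
        unfolding q1_def r2 using r0 by (simp add: field_simps)
      ultimately have k: "\<bar>(m + t) * \<psi>1 ((m + s) * (m + t)) - r * \<psi>1 ((m + s) * (m + t))\<bar> \<le> 8 * L * \<epsilon>" by simp
      show "\<bar>(m + t) * \<psi>1 ((m + s) * (m + t)) - sep1 A (s + t)\<bar> \<le> \<eta>"
        using c(2) l(2) hL \<epsilon>(2) e0 k by linarith
      assume less: "sep A (s + t) < pi - \<eta>"
      \<comment> \<open>If the edge came first, the separatrix would be within
        \<open>\<epsilon>\<close> of \<open>pi\<close> at \<open>Z - z0\<close>, and by monotonicity
        also at \<open>s + t\<close>, against the margin \<open>\<eta>\<close>.\<close>
      have "2 * r < Z"
      proof (rule ccontr)
        assume "\<not> 2 * r < Z"
        then have Zr: "Z - z0 \<le> a" "0 < Z - z0" using z0 by (auto simp: a_def)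
        then have "\<bar>Z - z0\<bar> \<le> 2 * L + 1" using aL by linarith
        from close(1)[OF this] have "\<bar>pi - sep A (Z - z0)\<bar> \<le> \<epsilon>" using Z(2) by simp
        moreover have "sep A (Z - z0) \<le> sep A (s + t)" using Zr a by (intro sep_mono) auto
        ultimately show False using less \<epsilon>(2) \<eta> by linarith
      qed
      then show "(m + s, m + t) \<in> amsler_domain (amsler.Z \<psi>)"
        using pos by (simp add: amsler_domain_def r_def)
    qed
  qed
qed

section \<open>Frames of the hyperboloid and the disk chart\<close>

text \<open>The index is the Minkowski coordinate, with 1 as the time direction, and
  \<open>n 1 u v \<ge> 1\<close> selects the upper sheet. The relations are those between different
  solutions, since these are the conserved ones.\<close>

definition hyperbolic_frame :: "(real \<Rightarrow> real \<Rightarrow> real) \<Rightarrow> (real \<Rightarrow> real \<Rightarrow> real) \<Rightarrow> (3 \<Rightarrow> real \<Rightarrow> real \<Rightarrow> real) \<Rightarrow>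
    (3 \<Rightarrow> real \<Rightarrow> real \<Rightarrow> real) \<Rightarrow> (3 \<Rightarrow> real \<Rightarrow> real \<Rightarrow> real) \<Rightarrow> bool" where
  "hyperbolic_frame \<phi> \<phi>1 n p s \<longleftrightarrow> (\<forall>i. frame_system 1 \<phi> \<phi>1 (n i) (p i) (s i)) \<and>
    (\<forall>u v. n 1 u v \<ge> 1) \<and>
    (\<forall>i j u v. n i u v * n j u v - (p i u v * p j u v + s i u v * s j u v)
       = (if i = j then (if i = 1 then 1 else - 1) else 0))"

lemma hyperbolic_frame_rows:
  assumes "hyperbolic_frame \<phi> \<phi>1 n p s"
  shows "n 1 u v * n 1 u v - (n 2 u v * n 2 u v + n 3 u v * n 3 u v) = 1"
    "p 1 u v * p 1 u v - (p 2 u v * p 2 u v + p 3 u v * p 3 u v) = -1"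
    "s 1 u v * s 1 u v - (s 2 u v * s 2 u v + s 3 u v * s 3 u v) = -1"
    "n 1 u v * p 1 u v - (n 2 u v * p 2 u v + n 3 u v * p 3 u v) = 0"
    "n 1 u v * s 1 u v - (n 2 u v * s 2 u v + n 3 u v * s 3 u v) = 0"
    "p 1 u v * s 1 u v - (p 2 u v * s 2 u v + p 3 u v * s 3 u v) = 0"
proof -
  define M :: "real^3^3" where "M = vector [\<chi> i. n i u v, \<chi> i. p i u v, \<chi> i. s i u v]"
  have "M$1$i * M$1$j - 1 * (M$2$i * M$2$j + M$3$i * M$3$j)
      = (if i = j then (if i = 1 then 1 else - 1) else 0)" for i j
    using assms by (simp add: hyperbolic_frame_def M_def)
  from pseudo_orthogonal_rows[of 1 M, OF _ this]
  have r: "M$k$1 * M$l$1 - 1 * (M$k$2 * M$l$2 + M$k$3 * M$l$3) = (if k = l then (if k = 1 then 1 else - 1) else 0)" for k l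
    by simp
  show "n 1 u v * n 1 u v - (n 2 u v * n 2 u v + n 3 u v * n 3 u v) = 1"
    "p 1 u v * p 1 u v - (p 2 u v * p 2 u v + p 3 u v * p 3 u v) = -1"
    "s 1 u v * s 1 u v - (s 2 u v * s 2 u v + s 3 u v * s 3 u v) = -1"
    "n 1 u v * p 1 u v - (n 2 u v * p 2 u v + n 3 u v * p 3 u v) = 0"
    "n 1 u v * s 1 u v - (n 2 u v * s 2 u v + n 3 u v * s 3 u v) = 0"
    "p 1 u v * s 1 u v - (p 2 u v * s 2 u v + p 3 u v * s 3 u v) = 0"
    using r[of 1 1] r[of 2 2] r[of 3 3] r[of 1 2] r[of 1 3] r[of 2 3] by (simp_all add: M_def)
qed

text \<open>The relations propagate from one point by conservation. They give
  \<open>n 1 u v * n 1 u v \<ge> 1\<close>, so \<open>n 1\<close> has no zero, and along a segment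
  from the base point its sign cannot change.\<close>

lemma hyperbolic_frameI:
  assumes F: "\<And>i. frame_system 1 \<phi> \<phi>1 (n i) (p i) (s i)"
    and base: "\<And>i j. n i a b * n j a b - (p i a b * p j a b + s i a b * s j a b)
       = (if i = j then (if i = 1 then 1 else - 1) else 0)"
    and pos: "n 1 a b > 0"
  shows "hyperbolic_frame \<phi> \<phi>1 n p s"
proof -
  have form: "n i u v * n j u v - (p i u v * p j u v + s i u v * s j u v)
       = (if i = j then (if i = 1 then 1 else - 1) else 0)" for i j u v
    using frame_system_form_const[OF F[of i] F[of j], of u v a b] base[of i j] by simp
  have sq: "n 1 u v * n 1 u v \<ge> 1" for u v
    using form[of 1 u v 1] by (simp add: algebra_simps add_increasing2)
  have "n 1 u v \<ge> 1" for u v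
  proof (rule ccontr)
    assume neg: "\<not> n 1 u v \<ge> 1"
    have "n 1 u v \<le> 0"
    proof (rule ccontr)
      assume "\<not> n 1 u v \<le> 0"
      then have "n 1 u v * n 1 u v < 1 * 1" using neg by (intro mult_strict_mono) auto
      then show False using sq[of u v] by simp
    qed
    define h where "h t = n 1 (a + t * (u - a)) (b + t * (v - b))" for t
    have hc: "continuous_on {0..1} h"
      unfolding h_def by (intro cont2_compose[OF frame_systemD(1)[OF F]] continuous_intros)
    have "h 1 \<le> 0" "0 \<le> h 0" using \<open>n 1 u v \<le> 0\<close> pos by (auto simp: h_def)
    then obtain t where "h t = 0" using IVT2'[of h 1 0 0] hc by auto
    then show False using sq[of "a + t * (u - a)" "b + t * (v - b)"] by (simp add: h_def)
  qed
  then show ?thesis using F form by (simp add: hyperbolic_frame_def)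
qed

text \<open>The derivative of the stereographic coordinate \<open>nk / (1 + n1)\<close> when
  \<open>n1\<close> and \<open>nk\<close> move with velocities \<open>p1\<close> and
  \<open>pk\<close>. It is written with products of reciprocals so that the error estimates for
  products apply directly.\<close>

definition chart_deriv :: "real \<Rightarrow> real \<Rightarrow> real \<Rightarrow> real \<Rightarrow> real" where
  "chart_deriv n1 nk p1 pk = pk * (1 / (1 + n1)) - nk * p1 * (1 / (1 + n1)) * (1 / (1 + n1))"

lemma quotient_rule_expand:
  fixes D :: real
  shows "D \<noteq> 0 \<Longrightarrow> (x * D - y * z) / (D * D) = x * (1 / D) - y * z * (1 / D) * (1 / D)"
  by (simp add: field_simps)

lemma disk_chart_deriv:
  assumes H: "hyperbolic_frame \<phi> \<phi>1 n p s"
  shows "((\<lambda>u. n k u v / (1 + n 1 u v)) has_real_derivative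
      chart_deriv (n 1 u v) (n k u v) (p 1 u v) (p k u v)) (at u)"
    "((\<lambda>v. n k u v / (1 + n 1 u v)) has_real_derivative
      cos (\<phi> u v) * chart_deriv (n 1 u v) (n k u v) (p 1 u v) (p k u v)
      + sin (\<phi> u v) * chart_deriv (n 1 u v) (n k u v) (s 1 u v) (s k u v)) (at v)"
proof -
  have F: "frame_system 1 \<phi> \<phi>1 (n i) (p i) (s i)" for i using H by (simp add: hyperbolic_frame_def)
  have "n 1 u v \<ge> 1" using H by (simp add: hyperbolic_frame_def)
  then have nz: "1 + n 1 u v \<noteq> 0" by linarith
  show "((\<lambda>u. n k u v / (1 + n 1 u v)) has_real_derivative
      chart_deriv (n 1 u v) (n k u v) (p 1 u v) (p k u v)) (at u)"
    using DERIV_divide[OF frame_systemD(4)[OF F] DERIV_add[OF DERIV_const[of 1] frame_systemD(4)[OF F]] nz]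
    unfolding quotient_rule_expand[OF nz] by (simp add: chart_deriv_def)
  show "((\<lambda>v. n k u v / (1 + n 1 u v)) has_real_derivative
      cos (\<phi> u v) * chart_deriv (n 1 u v) (n k u v) (p 1 u v) (p k u v)
      + sin (\<phi> u v) * chart_deriv (n 1 u v) (n k u v) (s 1 u v) (s k u v)) (at v)"
    using DERIV_divide[OF frame_systemD(7)[OF F] DERIV_add[OF DERIV_const[of 1] frame_systemD(7)[OF F]] nz]
    unfolding quotient_rule_expand[OF nz] chart_deriv_def by (rule back_subst) (simp add: algebra_simps)
qed

text \<open>The disk chart is the stereographic projection of the hyperboloid, so the images of the
  orthonormal frame are orthogonal vectors of length \<open>(1 - |z|\<^sup>2) / 2 = 1 / (1 + n\<^sub>1)\<close>.\<close>

lemma chart_deriv_inner: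
  assumes n: "n1 * n1 - (n2 * n2 + n3 * n3) = 1" "n1 \<ge> 1"
    and p: "n1 * p1 - (n2 * p2 + n3 * p3) = 0" and s: "n1 * s1 - (n2 * s2 + n3 * s3) = 0"
  shows "chart_deriv n1 n2 p1 p2 * chart_deriv n1 n2 s1 s2 + chart_deriv n1 n3 p1 p3 * chart_deriv n1 n3 s1 s3
     = (p2 * s2 + p3 * s3 - p1 * s1) / (1 + n1)\<^sup>2"
proof -
  define i where "i = 1 / (1 + n1)"
  have i: "i * (1 + n1) = 1" using n(2) by (simp add: i_def)
  have "chart_deriv n1 n2 p1 p2 * chart_deriv n1 n2 s1 s2 + chart_deriv n1 n3 p1 p3 * chart_deriv n1 n3 s1 s3
     = i\<^sup>2 * ((p2 * s2 + p3 * s3) - i * s1 * (n2 * p2 + n3 * p3) - i * p1 * (n2 * s2 + n3 * s3)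
        + i * i * p1 * s1 * (n2 * n2 + n3 * n3))"
    unfolding chart_deriv_def i_def[symmetric] by (simp add: power2_eq_square algebra_simps)
  also have "n2 * p2 + n3 * p3 = n1 * p1" using p by simp
  also have "n2 * s2 + n3 * s3 = n1 * s1" using s by simp
  also have "n2 * n2 + n3 * n3 = n1 * n1 - 1" using n by simp
  also have "i * i * p1 * s1 * (n1 * n1 - 1) = (i * (1 + n1)) * (i * p1 * s1 * (n1 - 1))"
    by (simp add: algebra_simps)
  also have "\<dots> = i * p1 * s1 * (n1 - 1)" unfolding i by simp
  also have "p2 * s2 + p3 * s3 - i * s1 * (n1 * p1) - i * p1 * (n1 * s1) + i * p1 * s1 * (n1 - 1)
     = p2 * s2 + p3 * s3 - (i * (1 + n1)) * (p1 * s1)" by (simp add: algebra_simps)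
  also have "\<dots> = p2 * s2 + p3 * s3 - p1 * s1" unfolding i by simp
  finally show ?thesis by (simp add: i_def power_divide)
qed

section \<open>The pseudosphere\<close>

text \<open>With \<open>X = u - v\<close> and \<open>Y = cosh (u + v - A)\<close> the first
  components are \<open>1 / Y\<close>, \<open>X / Y\<close> and
  \<open>(X\<^sup>2 + Y\<^sup>2) / Y\<close>: the coordinates of the upper half plane point
  \<open>(X, Y)\<close> on the hyperboloid, in a basis with two null vectors.\<close>

lemma pseudosphere_solutions:
  fixes A :: real
  defines "sg \<equiv> \<lambda>u v. 1 / cosh (u + v - A)" and "th \<equiv> \<lambda>u v. sinh (u + v - A) / cosh (u + v - A)"
    and "ch \<equiv> \<lambda>u v. cosh (u + v - A)" and "sh \<equiv> \<lambda>u v. sinh (u + v - A)"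
  shows "frame_system 1 (\<lambda>u v. sep A (u + v)) (\<lambda>u v. sep1 A (u + v)) (\<lambda>u v. sg u v)
      (\<lambda>u v. - (sg u v * th u v)) (\<lambda>u v. sg u v * sg u v)" (is ?t1)
    "frame_system 1 (\<lambda>u v. sep A (u + v)) (\<lambda>u v. sep1 A (u + v)) (\<lambda>u v. (u - v) * sg u v)
      (\<lambda>u v. sg u v - (u - v) * sg u v * th u v) (\<lambda>u v. (u - v) * sg u v * sg u v + th u v)" (is ?t2)
    "frame_system 1 (\<lambda>u v. sep A (u + v)) (\<lambda>u v. sep1 A (u + v)) (\<lambda>u v. (u - v) * (u - v) * sg u v + ch u v)
      (\<lambda>u v. 2 * (u - v) * sg u v - (u - v) * (u - v) * sg u v * th u v + sh u v)
      (\<lambda>u v. (u - v) * (u - v) * sg u v * sg u v + 2 * (u - v) * th u v - 1)" (is ?t3)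
proof -
  have nz: "cosh x \<noteq> 0" for x :: real using cosh_real_pos[of x] by simp
  have c: "cont2 sg" "cont2 th" "cont2 ch" "cont2 sh"
    unfolding cont2_def sg_def th_def ch_def sh_def using nz by (auto intro!: continuous_intros)
  have csq: "sinh x * sinh x = cosh x * cosh x - 1" for x :: real
    using cosh_square_eq[of x] by (simp add: power2_eq_square)
  have id: "th u v * th u v = 1 - sg u v * sg u v" "ch u v * sg u v = 1" "sh u v * sg u v = th u v" for u v
    using nz[of "u + v - A"] csq[of "u + v - A"] by (simp_all add: sg_def th_def ch_def sh_def field_simps)
  have id2: "sg u v * ch u v = 1" "sg u v * sh u v = th u v" for u v
    using id(2,3)[of u v] by (simp_all add: mult.commute)
  have id': "th u v * (th u v * x) = x - sg u v * (sg u v * x)" "ch u v * (sg u v * x) = x" "sh u v * (sg u v * x) = th u v * x"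
     "sg u v * (ch u v * x) = x" "sg u v * (sh u v * x) = th u v * x" for u v x
    by (simp_all add: mult.assoc[symmetric] id id2 left_diff_distrib)
  have du: "((\<lambda>u. sg u v) has_real_derivative - (sg u v * th u v)) (at u)"
    "((\<lambda>u. th u v) has_real_derivative sg u v * sg u v) (at u)"
    "((\<lambda>u. ch u v) has_real_derivative sh u v) (at u)" "((\<lambda>u. sh u v) has_real_derivative ch u v) (at u)" for u v
    unfolding sg_def th_def ch_def sh_def using nz[of "u + v - A"] csq[of "u + v - A"]
    by (auto intro!: derivative_eq_intros simp: field_simps)
  have dv: "((\<lambda>v. sg u v) has_real_derivative - (sg u v * th u v)) (at v)"
    "((\<lambda>v. th u v) has_real_derivative sg u v * sg u v) (at v)"
    "((\<lambda>v. ch u v) has_real_derivative sh u v) (at v)" "((\<lambda>v. sh u v) has_real_derivative ch u v) (at v)" for u v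
    unfolding sg_def th_def ch_def sh_def using nz[of "u + v - A"] csq[of "u + v - A"]
    by (auto intro!: derivative_eq_intros simp: field_simps)
  have trig: "cos (sep A (u + v)) = 1 - 2 * (sg u v * sg u v)" "sin (sep A (u + v)) = - 2 * (sg u v * th u v)"
    "sep1 A (u + v) = 2 * sg u v" for u v
    by (simp_all add: sep_trig sep1_def sg_def th_def power2_eq_square)
  show ?t1
    unfolding frame_system_def trig
    using c by (auto simp: cont2_def algebra_simps id id2 id' intro!: continuous_intros derivative_eq_intros du dv)
  show ?t2
    unfolding frame_system_def trig
    using c by (auto simp: cont2_def algebra_simps id id2 id' intro!: continuous_intros derivative_eq_intros du dv)
  show ?t3
    unfolding frame_system_def trig
    using c by (auto simp: cont2_def algebra_simps id id2 id' intro!: continuous_intros derivative_eq_intros du dv)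
qed

text \<open>The point \<open>(X, Y)\<close> of the half plane, rescaled by \<open>1 / cosh A\<close>
  and written in Minkowski coordinates. The rescaling is an isometry and moves the image of
  \<open>u = v = 0\<close> to the point (1, 0, 0), the centre of the disk.\<close>

definition ps_n :: "real \<Rightarrow> 3 \<Rightarrow> real \<Rightarrow> real \<Rightarrow> real" where
  "ps_n A j u v = (let x = u + v - A; b = u - v; k = cosh A in
     if j = 2 then b * (1 / cosh x)
     else 1 / (2 * k) * (b * b * (1 / cosh x) + cosh x) + (if j = 1 then 1 else - 1) * (k / 2) * (1 / cosh x))"

lemma pseudosphere_frame:
  obtains p s where "hyperbolic_frame (\<lambda>u v. sep A (u + v)) (\<lambda>u v. sep1 A (u + v)) (ps_n A) p s"
proof -
  let ?F = "frame_system 1 (\<lambda>u v. sep A (u + v)) (\<lambda>u v. sep1 A (u + v))"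
  note S = pseudosphere_solutions[of A]
  define k where "k = cosh A"
  have k: "k > 0" by (simp add: k_def cosh_real_pos)
  define p where "p j u v = (let x = u + v - A; b = u - v in
     if j = 2 then 1 / cosh x - b * (1 / cosh x) * (sinh x / cosh x)
     else 1 / (2 * k) * (2 * b * (1 / cosh x) - b * b * (1 / cosh x) * (sinh x / cosh x) + sinh x)
       + (if j = 1 then 1 else - 1) * (k / 2) * - (1 / cosh x * (sinh x / cosh x)))" for j :: 3 and u v
  define s where "s j u v = (let x = u + v - A; b = u - v in
     if j = 2 then b * (1 / cosh x) * (1 / cosh x) + sinh x / cosh x
     else 1 / (2 * k) * (b * b * (1 / cosh x) * (1 / cosh x) + 2 * b * (sinh x / cosh x) - 1)
       + (if j = 1 then 1 else - 1) * (k / 2) * (1 / cosh x * (1 / cosh x)))" for j :: 3 and u v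
  have 2: "?F (ps_n A 2) (p 2) (s 2)"
    using S(2) unfolding ps_n_def[abs_def] p_def[abs_def] s_def[abs_def] Let_def by simp
  have 13: "?F (ps_n A j) (p j) (s j)" if "j \<noteq> 2" for j
    using frame_system_lincomb[OF S(3) S(1), of "1 / (2 * k)" "(if j = 1 then 1 else - 1) * (k / 2)"] that
    unfolding ps_n_def[abs_def] p_def[abs_def] s_def[abs_def] Let_def k_def by simp
  have F: "?F (ps_n A j) (p j) (s j)" for j
    using 2 13 by (cases "j = 2") auto
  have base: "ps_n A i 0 0 * ps_n A j 0 0 - (p i 0 0 * p j 0 0 + s i 0 0 * s j 0 0)
       = (if i = j then (if i = 1 then 1 else - 1) else 0)" for i j
  proof -
    define S where "S = sinh A"
    have S2: "S * S = k * k - 1" using cosh_square_eq[of A] by (simp add: S_def k_def power2_eq_square)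
    have v: "ps_n A 1 0 0 = 1" "ps_n A 2 0 0 = 0" "ps_n A 3 0 0 = 0"
      "p 1 0 0 = 0" "p 2 0 0 = 1 / k" "p 3 0 0 = - S / k" "s 1 0 0 = 0" "s 2 0 0 = - S / k" "s 3 0 0 = - 1 / k"
      using k by (simp_all add: ps_n_def p_def s_def Let_def k_def[symmetric] S_def[symmetric] field_simps S2)
    have "\<forall>i j. ps_n A i 0 0 * ps_n A j 0 0 - (p i 0 0 * p j 0 0 + s i 0 0 * s j 0 0)
       = (if i = j then (if i = 1 then 1 else - 1) else (0::real))"
      unfolding forall_3 v using k by (simp add: field_simps S2)
    then show ?thesis by blast
  qed
  have "ps_n A 1 0 0 = 1" using k by (simp add: ps_n_def Let_def k_def[symmetric])
  then have "hyperbolic_frame (\<lambda>u v. sep A (u + v)) (\<lambda>u v. sep1 A (u + v)) (ps_n A) p s"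
    by (intro hyperbolic_frameI[where a = 0 and b = 0] F base) simp
  then show ?thesis by (rule that)
qed

section \<open>Comparison of frames\<close>

text \<open>Gronwall's inequality for the Euclidean square of the difference, as the conserved form
  is indefinite: along \<open>v = 0\<close>, and from there in the \<open>v\<close>-direction. The
  terms rotating \<open>p\<close> and \<open>s\<close> with the factor \<open>\<phi>1\<close> cancel
  in the \<open>u\<close>-derivative, so only the difference of the coefficients has to be
  small.\<close>

lemma frame_comparison:
  assumes F: "frame_system 1 \<phi> \<phi>1 n p s" and G: "frame_system 1 \<phi>0 \<phi>01 n0 p0 s0"
    and init: "n 0 0 = n0 0 0" "p 0 0 = p0 0 0" "s 0 0 = s0 0 0"
    and close: "\<And>u v. \<bar>u\<bar> \<le> L \<Longrightarrow> \<bar>v\<bar> \<le> L \<Longrightarrow> \<bar>\<phi> u v - \<phi>0 u v\<bar> \<le> \<eta> \<and> \<bar>\<phi>1 u v - \<phi>01 u v\<bar> \<le> \<eta>"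
    and bound: "\<And>u v. \<bar>u\<bar> \<le> L \<Longrightarrow> \<bar>v\<bar> \<le> L \<Longrightarrow> \<bar>n0 u v\<bar> \<le> K \<and> \<bar>p0 u v\<bar> \<le> K \<and> \<bar>s0 u v\<bar> \<le> K"
    and uv: "\<bar>u\<bar> \<le> L" "\<bar>v\<bar> \<le> L"
  shows "(n u v - n0 u v)\<^sup>2 + (p u v - p0 u v)\<^sup>2 + (s u v - s0 u v)\<^sup>2
     \<le> \<eta>\<^sup>2 * ((2 * K\<^sup>2 * L * exp (3 * L) + 4 * K\<^sup>2 * L) * exp (6 * L))"
proof -
  have L: "L \<ge> 0" using uv by linarith
  have \<eta>: "\<eta> \<ge> 0" and K: "K \<ge> 0" using close[OF uv] bound[OF uv] by linarith+
  define a where "a u v = n u v - n0 u v" for u v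
  define b where "b u v = p u v - p0 u v" for u v
  define c where "c u v = s u v - s0 u v" for u v
  define y where "y u v = (a u v)\<^sup>2 + (b u v)\<^sup>2 + (c u v)\<^sup>2" for u v
  have young: "\<bar>2 * x * w\<bar> \<le> x\<^sup>2 + d\<^sup>2" if "\<bar>w\<bar> \<le> d" for x w d :: real
  proof -
    have "\<bar>2 * x * w\<bar> \<le> 2 * \<bar>x\<bar> * d" using that by (simp add: abs_mult mult_left_mono)
    also have "\<dots> \<le> x\<^sup>2 + d\<^sup>2" using sum_squares_bound[of "\<bar>x\<bar>" d] by simp
    finally show ?thesis .
  qed
  have prod: "\<bar>x * w\<bar> \<le> \<eta> * K" if "\<bar>x\<bar> \<le> \<eta>" "\<bar>w\<bar> \<le> K" for x w :: real
    using that \<eta> unfolding abs_mult by (intro mult_mono) auto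
  have y0: "y u 0 \<le> (y 0 0 + 2 * (\<eta> * K)\<^sup>2 * L) * exp (3 * L)"
  proof (rule gronwall[of L "\<lambda>u. y u 0" "\<lambda>u. 4 * (a u 0 * b u 0) - 2 * b u 0 * ((\<phi>1 u 0 - \<phi>01 u 0) * s0 u 0)
      + 2 * c u 0 * ((\<phi>1 u 0 - \<phi>01 u 0) * p0 u 0)"])
    fix u assume u: "\<bar>u\<bar> \<le> L"
    show "((\<lambda>u. y u 0) has_real_derivative 4 * (a u 0 * b u 0) - 2 * b u 0 * ((\<phi>1 u 0 - \<phi>01 u 0) * s0 u 0)
      + 2 * c u 0 * ((\<phi>1 u 0 - \<phi>01 u 0) * p0 u 0)) (at u)"
      unfolding y_def a_def b_def c_def
      by (rule derivative_eq_intros frame_systemD(4-6)[OF F] frame_systemD(4-6)[OF G] refl)+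
        (simp add: algebra_simps)
    have B: "\<bar>\<phi>1 u 0 - \<phi>01 u 0\<bar> \<le> \<eta>" "\<bar>s0 u 0\<bar> \<le> K" "\<bar>p0 u 0\<bar> \<le> K"
      using close[OF u] bound[OF u] L by auto
    have "\<bar>4 * (a u 0 * b u 0)\<bar> \<le> 2 * (a u 0)\<^sup>2 + 2 * (b u 0)\<^sup>2"
      using young[of "b u 0" "\<bar>a u 0\<bar>" "a u 0"] young[OF order_refl, of "a u 0" "b u 0"] by (simp add: abs_mult)
    moreover note young[OF prod[OF B(1,2)], of "b u 0"] young[OF prod[OF B(1,3)], of "c u 0"]
    moreover have "(a u 0)\<^sup>2 \<ge> 0" "(c u 0)\<^sup>2 \<ge> 0" by auto
    ultimately show "\<bar>4 * (a u 0 * b u 0) - 2 * b u 0 * ((\<phi>1 u 0 - \<phi>01 u 0) * s0 u 0)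
      + 2 * c u 0 * ((\<phi>1 u 0 - \<phi>01 u 0) * p0 u 0)\<bar> \<le> 3 * y u 0 + 2 * (\<eta> * K)\<^sup>2"
      unfolding y_def distrib_left by linarith
  qed (use uv in \<open>auto simp: y_def\<close>)
  have "y u v \<le> (y u 0 + 4 * (\<eta> * K)\<^sup>2 * L) * exp (6 * L)"
  proof (rule gronwall[of L "\<lambda>v. y u v" "\<lambda>v. 2 * (2 * a u v * (cos (\<phi> u v) * b u v)) + 2 * (2 * a u v * (sin (\<phi> u v) * c u v))
      + 2 * a u v * ((cos (\<phi> u v) - cos (\<phi>0 u v)) * p0 u v) + 2 * a u v * ((sin (\<phi> u v) - sin (\<phi>0 u v)) * s0 u v)
      + 2 * b u v * ((cos (\<phi> u v) - cos (\<phi>0 u v)) * n0 u v) + 2 * c u v * ((sin (\<phi> u v) - sin (\<phi>0 u v)) * n0 u v)"])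
    fix v assume v: "\<bar>v\<bar> \<le> L"
    show "((\<lambda>v. y u v) has_real_derivative 2 * (2 * a u v * (cos (\<phi> u v) * b u v)) + 2 * (2 * a u v * (sin (\<phi> u v) * c u v))
      + 2 * a u v * ((cos (\<phi> u v) - cos (\<phi>0 u v)) * p0 u v) + 2 * a u v * ((sin (\<phi> u v) - sin (\<phi>0 u v)) * s0 u v)
      + 2 * b u v * ((cos (\<phi> u v) - cos (\<phi>0 u v)) * n0 u v) + 2 * c u v * ((sin (\<phi> u v) - sin (\<phi>0 u v)) * n0 u v)) (at v)"
      unfolding y_def a_def b_def c_def
      by (rule derivative_eq_intros frame_systemD(7-9)[OF F] frame_systemD(7-9)[OF G] refl)+
        (simp add: algebra_simps)
    have B: "\<bar>cos (\<phi> u v) - cos (\<phi>0 u v)\<bar> \<le> \<eta>" "\<bar>sin (\<phi> u v) - sin (\<phi>0 u v)\<bar> \<le> \<eta>"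
      "\<bar>n0 u v\<bar> \<le> K" "\<bar>p0 u v\<bar> \<le> K" "\<bar>s0 u v\<bar> \<le> K"
      using close[OF uv(1) v] bound[OF uv(1) v] abs_cos_diff_le[of "\<phi> u v" "\<phi>0 u v"] abs_sin_diff_le[of "\<phi> u v" "\<phi>0 u v"] by auto
    have w: "\<bar>cos (\<phi> u v) * b u v\<bar> \<le> \<bar>b u v\<bar>" "\<bar>sin (\<phi> u v) * c u v\<bar> \<le> \<bar>c u v\<bar>"
      unfolding abs_mult by (auto intro!: mult_left_le_one_le)
    have six: "\<bar>2 * x1 + 2 * x2 + x3 + x4 + x5 + x6\<bar> \<le> 2 * c1 + 2 * c2 + c3 + c4 + c5 + c6"
      if "\<bar>x1\<bar> \<le> c1" "\<bar>x2\<bar> \<le> c2" "\<bar>x3\<bar> \<le> c3" "\<bar>x4\<bar> \<le> c4" "\<bar>x5\<bar> \<le> c5" "\<bar>x6\<bar> \<le> c6"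
      for x1 x2 x3 x4 x5 x6 c1 c2 c3 c4 c5 c6 :: real
      using that unfolding abs_le_iff by linarith
    note six[OF young[OF w(1), of "a u v"] young[OF w(2), of "a u v"]
      young[OF prod[OF B(1,4)], of "a u v"] young[OF prod[OF B(2,5)], of "a u v"]
      young[OF prod[OF B(1,3)], of "b u v"] young[OF prod[OF B(2,3)], of "c u v"]]
    also have "2 * ((a u v)\<^sup>2 + \<bar>b u v\<bar>\<^sup>2) + 2 * ((a u v)\<^sup>2 + \<bar>c u v\<bar>\<^sup>2) + ((a u v)\<^sup>2 + (\<eta> * K)\<^sup>2)
        + ((a u v)\<^sup>2 + (\<eta> * K)\<^sup>2) + ((b u v)\<^sup>2 + (\<eta> * K)\<^sup>2) + ((c u v)\<^sup>2 + (\<eta> * K)\<^sup>2)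
      \<le> 6 * y u v + 4 * (\<eta> * K)\<^sup>2"
      by (simp add: y_def)
    finally show "\<bar>2 * (2 * a u v * (cos (\<phi> u v) * b u v)) + 2 * (2 * a u v * (sin (\<phi> u v) * c u v))
      + 2 * a u v * ((cos (\<phi> u v) - cos (\<phi>0 u v)) * p0 u v) + 2 * a u v * ((sin (\<phi> u v) - sin (\<phi>0 u v)) * s0 u v)
      + 2 * b u v * ((cos (\<phi> u v) - cos (\<phi>0 u v)) * n0 u v) + 2 * c u v * ((sin (\<phi> u v) - sin (\<phi>0 u v)) * n0 u v)\<bar>
      \<le> 6 * y u v + 4 * (\<eta> * K)\<^sup>2" .
  qed (use uv in \<open>auto simp: y_def\<close>)
  also have "\<dots> \<le> (2 * (\<eta> * K)\<^sup>2 * L * exp (3 * L) + 4 * (\<eta> * K)\<^sup>2 * L) * exp (6 * L)"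
    using y0 init by (intro mult_right_mono add_right_mono) (auto simp: y_def a_def b_def c_def)
  also have "\<dots> = \<eta>\<^sup>2 * ((2 * K\<^sup>2 * L * exp (3 * L) + 4 * K\<^sup>2 * L) * exp (6 * L))"
    by (simp add: power_mult_distrib algebra_simps)
  finally show ?thesis by (simp add: y_def a_def b_def c_def)
qed

section \<open>Error estimates for the charts\<close>

text \<open>Both numbers carry the common bound \<open>K\<close>, since the error of a product
  involves the size of the factors.\<close>

definition close :: "real \<Rightarrow> real \<Rightarrow> real \<Rightarrow> real \<Rightarrow> bool" where
  "close K \<epsilon> x x' \<longleftrightarrow> \<bar>x\<bar> \<le> K \<and> \<bar>x'\<bar> \<le> K \<and> \<bar>x - x'\<bar> \<le> \<epsilon>"

lemma close_mult:
  assumes "close K \<epsilon> x x'" "close K' \<epsilon>' y y'"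
  shows "close (K * K') (K * \<epsilon>' + \<epsilon> * K') (x * y) (x' * y')"
proof -
  have K: "0 \<le> K" "0 \<le> K'" "0 \<le> \<epsilon>" using assms by (auto simp: close_def)
  have "x * y - x' * y' = x * (y - y') + (x - x') * y'" by (simp add: algebra_simps)
  also have "\<bar>\<dots>\<bar> \<le> \<bar>x\<bar> * \<bar>y - y'\<bar> + \<bar>x - x'\<bar> * \<bar>y'\<bar>" unfolding abs_mult[symmetric] by (rule abs_triangle_ineq)
  also have "\<dots> \<le> K * \<epsilon>' + \<epsilon> * K'" using assms K by (intro add_mono mult_mono) (auto simp: close_def)
  finally show ?thesis using assms K unfolding close_def abs_mult by (auto intro!: mult_mono)
qed

lemma close_add: "close K \<epsilon> x x' \<Longrightarrow> close K' \<epsilon>' y y' \<Longrightarrow> close (K + K') (\<epsilon> + \<epsilon>') (x + y) (x' + y')"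
  unfolding close_def by auto

lemma close_diff: "close K \<epsilon> x x' \<Longrightarrow> close K' \<epsilon>' y y' \<Longrightarrow> close (K + K') (\<epsilon> + \<epsilon>') (x - y) (x' - y')"
  unfolding close_def by auto

lemma close_mono: "close K \<epsilon> x x' \<Longrightarrow> K \<le> K' \<Longrightarrow> \<epsilon> \<le> \<epsilon>' \<Longrightarrow> close K' \<epsilon>' x x'"
  unfolding close_def by auto

lemma close_recip:
  assumes "n1 \<ge> 1" "n1' \<ge> 1" "close K \<epsilon> n1 n1'"
  shows "close 1 \<epsilon> (1 / (1 + n1)) (1 / (1 + n1'))"
proof -
  have "1 / (1 + n1) - 1 / (1 + n1') = (n1' - n1) / ((1 + n1) * (1 + n1'))"
    using assms by (simp add: field_simps)
  also have "\<bar>\<dots>\<bar> \<le> \<bar>n1' - n1\<bar> / 1"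
  proof -
    have "1 * 1 \<le> (1 + n1) * (1 + n1')" using assms by (intro mult_mono) auto
    then show ?thesis using assms unfolding abs_divide by (intro frac_le) auto
  qed
  also have "\<dots> \<le> \<epsilon>" using assms by (auto simp: close_def abs_minus_commute)
  finally show ?thesis using assms by (auto simp: close_def divide_le_eq)
qed

lemma close_chart_deriv:
  assumes K: "K \<ge> 1" and n: "n1 \<ge> 1" "n1' \<ge> 1" "close K \<epsilon> n1 n1'" "close K \<epsilon> nk nk'"
    and p: "close K \<epsilon> p1 p1'" "close K \<epsilon> pk pk'"
  shows "close (2 * K\<^sup>2) (6 * K\<^sup>2 * \<epsilon>) (chart_deriv n1 nk p1 pk) (chart_deriv n1' nk' p1' pk')"
proof -
  note i = close_recip[OF n(1-3)]
  have "\<epsilon> \<ge> 0" using p by (auto simp: close_def)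
  have KK: "K \<le> K\<^sup>2" using K by (simp add: self_le_power)
  have 1: "1 \<le> K\<^sup>2" using K by simp
  show ?thesis
    unfolding chart_deriv_def
  proof (rule close_mono[OF close_diff[OF close_mult[OF p(2) i] close_mult[OF close_mult[OF close_mult[OF n(4) p(1)] i] i]]])
    show "K * 1 + K * K * 1 * 1 \<le> 2 * K\<^sup>2" using KK by (simp add: power2_eq_square)
    have "K * \<epsilon> \<le> K\<^sup>2 * \<epsilon>" "1 * \<epsilon> \<le> K\<^sup>2 * \<epsilon>"
      using mult_right_mono[OF KK \<open>\<epsilon> \<ge> 0\<close>] mult_right_mono[OF 1 \<open>\<epsilon> \<ge> 0\<close>] by auto
    then show "K * \<epsilon> + \<epsilon> * 1 + (K * K * 1 * \<epsilon> + (K * K * \<epsilon> + (K * \<epsilon> + \<epsilon> * K) * 1) * 1) \<le> 6 * K\<^sup>2 * \<epsilon>"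
      by (simp add: power2_eq_square algebra_simps)
  qed
qed

lemma lipschitz_square:
  fixes h :: "real \<Rightarrow> real \<Rightarrow> real"
  assumes du: "\<And>u v. ((\<lambda>u. h u v) has_real_derivative hu u v) (at u)"
    and dv: "\<And>u v. ((\<lambda>v. h u v) has_real_derivative hv u v) (at v)"
    and le: "\<And>u v. \<bar>u\<bar> \<le> L \<Longrightarrow> \<bar>v\<bar> \<le> L \<Longrightarrow> \<bar>hu u v\<bar> \<le> M \<and> \<bar>hv u v\<bar> \<le> M"
    and uv: "\<bar>u\<bar> \<le> L" "\<bar>v\<bar> \<le> L" "\<bar>u'\<bar> \<le> L" "\<bar>v'\<bar> \<le> L"
  shows "\<bar>h u v - h u' v'\<bar> \<le> M * (\<bar>u - u'\<bar> + \<bar>v - v'\<bar>)"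
proof -
  have "norm (h u v - h u' v) \<le> M * norm (u - u')"
    by (rule field_differentiable_bound[of "{-L..L}" "\<lambda>u. h u v" "\<lambda>u. hu u v"])
      (use du le uv in \<open>auto simp: abs_le_iff intro: has_field_derivative_at_within\<close>)
  moreover have "norm (h u' v - h u' v') \<le> M * norm (v - v')"
    by (rule field_differentiable_bound[of "{-L..L}" "\<lambda>v. h u' v" "\<lambda>v. hv u' v"])
      (use dv le uv in \<open>auto simp: abs_le_iff intro: has_field_derivative_at_within\<close>)
  ultimately show ?thesis by (simp add: distrib_left)
qed

text \<open>Both partial derivatives of the difference of the two charts are of order
  \<open>\<epsilon>\<close>. A small Lipschitz constant of the difference, and not just a small
  difference, is what makes the perturbed chart invertible.\<close>

lemma disk_chart_difference_lipschitz:
  assumes H: "hyperbolic_frame \<phi> \<phi>1 n p s" and H0: "hyperbolic_frame \<phi>0 \<phi>01 n0 p0 s0" and K: "K \<ge> 1"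
    and cl: "\<And>i u v. \<bar>u\<bar> \<le> L \<Longrightarrow> \<bar>v\<bar> \<le> L \<Longrightarrow> close K \<epsilon> (n i u v) (n0 i u v) \<and> close K \<epsilon> (p i u v) (p0 i u v) \<and>
       close K \<epsilon> (s i u v) (s0 i u v)"
    and \<phi>: "\<And>u v. \<bar>u\<bar> \<le> L \<Longrightarrow> \<bar>v\<bar> \<le> L \<Longrightarrow> \<bar>\<phi> u v - \<phi>0 u v\<bar> \<le> \<epsilon>"
    and uv: "\<bar>u\<bar> \<le> L" "\<bar>v\<bar> \<le> L" "\<bar>u'\<bar> \<le> L" "\<bar>v'\<bar> \<le> L"
  shows "\<bar>(n k u v / (1 + n 1 u v) - n0 k u v / (1 + n0 1 u v)) - (n k u' v' / (1 + n 1 u' v') - n0 k u' v' / (1 + n0 1 u' v'))\<bar>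
    \<le> 16 * K\<^sup>2 * \<epsilon> * (\<bar>u - u'\<bar> + \<bar>v - v'\<bar>)"
proof (rule lipschitz_square[of "\<lambda>u v. n k u v / (1 + n 1 u v) - n0 k u v / (1 + n0 1 u v)", OF DERIV_diff[OF disk_chart_deriv(1)[OF H] disk_chart_deriv(1)[OF H0]]
      DERIV_diff[OF disk_chart_deriv(2)[OF H] disk_chart_deriv(2)[OF H0]] _ uv])
  fix u v assume uv: "\<bar>u\<bar> \<le> L" "\<bar>v\<bar> \<le> L"
  have n1: "n 1 u v \<ge> 1" "n0 1 u v \<ge> 1" using H H0 by (auto simp: hyperbolic_frame_def)
  have \<epsilon>: "\<epsilon> \<ge> 0" using \<phi>[OF uv] by linarith
  have cs: "close 1 \<epsilon> (cos (\<phi> u v)) (cos (\<phi>0 u v))" "close 1 \<epsilon> (sin (\<phi> u v)) (sin (\<phi>0 u v))"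
    using abs_cos_diff_le[of "\<phi> u v" "\<phi>0 u v"] abs_sin_diff_le[of "\<phi> u v" "\<phi>0 u v"] \<phi>[OF uv] by (auto simp: close_def)
  have P: "close (2 * K\<^sup>2) (6 * K\<^sup>2 * \<epsilon>) (chart_deriv (n 1 u v) (n k u v) (p 1 u v) (p k u v))
      (chart_deriv (n0 1 u v) (n0 k u v) (p0 1 u v) (p0 k u v))"
    and S: "close (2 * K\<^sup>2) (6 * K\<^sup>2 * \<epsilon>) (chart_deriv (n 1 u v) (n k u v) (s 1 u v) (s k u v))
      (chart_deriv (n0 1 u v) (n0 k u v) (s0 1 u v) (s0 k u v))"
    using cl[OF uv] by (auto intro!: close_chart_deriv K n1)
  have six: "6 * K\<^sup>2 * \<epsilon> \<le> 16 * K\<^sup>2 * \<epsilon>" using \<epsilon> by (intro mult_right_mono) auto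
  \<comment> \<open>The \<open>v\<close>-derivative consists of two products, each with an error of
    \<open>6 + 2\<close> units \<open>K\<^sup>2 * \<epsilon>\<close>; this is the larger of the two
    partial derivatives' errors.\<close>
  have eq: "1 * (6 * K\<^sup>2 * \<epsilon>) + \<epsilon> * (2 * K\<^sup>2) + (1 * (6 * K\<^sup>2 * \<epsilon>) + \<epsilon> * (2 * K\<^sup>2)) = 16 * K\<^sup>2 * \<epsilon>" by simp
  show "\<bar>chart_deriv (n 1 u v) (n k u v) (p 1 u v) (p k u v) - chart_deriv (n0 1 u v) (n0 k u v) (p0 1 u v) (p0 k u v)\<bar> \<le> 16 * K\<^sup>2 * \<epsilon> \<and>
    \<bar>cos (\<phi> u v) * chart_deriv (n 1 u v) (n k u v) (p 1 u v) (p k u v) + sin (\<phi> u v) * chart_deriv (n 1 u v) (n k u v) (s 1 u v) (s k u v)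
     - (cos (\<phi>0 u v) * chart_deriv (n0 1 u v) (n0 k u v) (p0 1 u v) (p0 k u v) + sin (\<phi>0 u v) * chart_deriv (n0 1 u v) (n0 k u v) (s0 1 u v) (s0 k u v))\<bar> \<le> 16 * K\<^sup>2 * \<epsilon>"
    using close_add[OF close_mult[OF cs(1) P] close_mult[OF cs(2) S], unfolded close_def eq] P[unfolded close_def] six by (meson order_trans)
qed

text \<open>The inverse of the disk chart of the pseudosphere, through the half plane coordinates
  \<open>cosh (u + v - A) / cosh A\<close> and \<open>(u - v) / cosh A\<close>.\<close>

lemma pseudosphere_chart_inverse:
  fixes \<rho> :: real
  assumes \<rho>: "0 < \<rho>" "\<rho> < 1"
  obtains A \<Lambda> :: real and e1 e2 :: "real^2 \<Rightarrow> real" where "A > 0" "\<Lambda> > 0" "e1 0 = 0" "e2 0 = 0"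
    "\<And>z. norm z \<le> \<rho> \<Longrightarrow> ps_n A 2 (e1 z) (e2 z) / (1 + ps_n A 1 (e1 z) (e2 z)) = z $ 1"
    "\<And>z. norm z \<le> \<rho> \<Longrightarrow> ps_n A 3 (e1 z) (e2 z) / (1 + ps_n A 1 (e1 z) (e2 z)) = z $ 2"
    "\<And>z z'. norm z \<le> \<rho> \<Longrightarrow> norm z' \<le> \<rho> \<Longrightarrow> \<bar>e1 z - e1 z'\<bar> + \<bar>e2 z - e2 z'\<bar> \<le> \<Lambda> * norm (z - z')"
    "\<And>z. norm z \<le> \<rho> \<Longrightarrow> e1 z + e2 z \<le> A - arcosh 2"
proof -
  \<comment> \<open>On the ball of radius \<open>\<rho>\<close> the height \<open>W\<close> below is
    at least \<open>(1 - \<rho>) / (1 + \<rho>) = 2 / k\<close>. Hence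
    \<open>k * W z \<ge> 2\<close>, away from the value 1 where \<open>arcosh\<close> fails to be
    Lipschitz.\<close>
  define k where "k = 2 * (1 + \<rho>) / (1 - \<rho>)"
  have k: "k \<ge> 2" using \<rho> by (simp add: k_def field_simps)
  define A where "A = arcosh k"
  have cA: "cosh A = k" using k by (simp add: A_def cosh_arcosh_real)
  have A: "A > 0" using k by (simp add: A_def)
  define w where "w z = (norm z)\<^sup>2" for z :: "real^2"
  define d where "d z = 1 + w z - 2 * z $ 2" for z :: "real^2"
  \<comment> \<open>The Poisson kernel at the boundary point (0, 1), which is the height in the half
    plane model. \<open>a\<close> and \<open>b\<close> are to be \<open>u + v\<close> and
    \<open>u - v\<close>; the minus sign before \<open>arcosh\<close> chooses the branch before the
    edge.\<close>
  define W where "W z = (1 - w z) / d z" for z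
  define a where "a z = A - arcosh (k * W z)" for z
  define b where "b z = 2 * k * z $ 1 / d z" for z
  have w: "w z = z $ 1 * z $ 1 + z $ 2 * z $ 2" for z
    by (simp add: w_def norm_vec_def L2_set_def sum_2 power2_eq_square)
  define \<delta> where "\<delta> = (1 - \<rho>)\<^sup>2"
  have \<delta>: "\<delta> > 0" "\<delta> \<le> 1" using \<rho> by (auto simp: \<delta>_def power_le_one)
  have comp: "\<bar>z $ i\<bar> \<le> norm z" for z :: "real^2" and i by (rule component_le_norm_cart)
  have d_ge: "d z \<ge> \<delta>" if "norm z \<le> \<rho>" for z
  proof -
    have "1 - \<rho> \<le> 1 - z $ 2" using comp[of z 2] that by linarith
    then have "(1 - \<rho>)\<^sup>2 \<le> (1 - z $ 2)\<^sup>2" using \<rho> by (intro power_mono) auto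
    moreover have "d z = z $ 1 * z $ 1 + (1 - z $ 2)\<^sup>2" by (simp add: d_def w power2_eq_square algebra_simps)
    ultimately show ?thesis unfolding \<delta>_def using zero_le_square[of "z $ 1"] by linarith
  qed
  have w_le: "0 \<le> w z" "w z \<le> \<rho>\<^sup>2" "w z < 1" if "norm z \<le> \<rho>" for z
  proof -
    show "0 \<le> w z" "w z \<le> \<rho>\<^sup>2" using that by (auto simp: w_def intro: power_mono)
    moreover have "\<rho>\<^sup>2 < 1" using \<rho> by (simp add: power_less_one_iff)
    ultimately show "w z < 1" by simp
  qed
  have W_ge: "k * W z \<ge> 2" if z: "norm z \<le> \<rho>" for z
  proof -
    have "d z \<le> (1 + \<rho>)\<^sup>2"
      using comp[of z 2] z w_le(2)[OF z] by (simp add: d_def power2_eq_square algebra_simps)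
    then have "(1 - \<rho>\<^sup>2) / (1 + \<rho>)\<^sup>2 \<le> W z"
      unfolding W_def using w_le[OF z] d_ge[OF z] \<delta> by (intro frac_le) auto
    moreover have "(1 - \<rho>\<^sup>2) / (1 + \<rho>)\<^sup>2 = 2 / k"
      using \<rho> by (simp add: k_def power2_eq_square divide_simps) (simp add: algebra_simps)
    ultimately show ?thesis using k by (simp add: field_simps)
  qed
  define M where "M = 10 / \<delta>\<^sup>2"
  have M: "M > 0" using \<delta> by (simp add: M_def)
  have lip_w: "\<bar>w z - w z'\<bar> \<le> 2 * norm (z - z')" if "norm z \<le> \<rho>" "norm z' \<le> \<rho>" for z z'
  proof -
    have "w z - w z' = (norm z + norm z') * (norm z - norm z')" by (simp add: w_def power2_eq_square algebra_simps)
    also have "\<bar>\<dots>\<bar> \<le> 2 * norm (z - z')"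
      unfolding abs_mult using that \<rho> norm_triangle_ineq3[of z z'] by (intro mult_mono) auto
    finally show ?thesis .
  qed
  have lip_d: "\<bar>d z - d z'\<bar> \<le> 4 * norm (z - z')" if "norm z \<le> \<rho>" "norm z' \<le> \<rho>" for z z'
    using lip_w[OF that] comp[of "z - z'" 2] unfolding d_def by (simp add: abs_le_iff)
  have lip_quot: "\<bar>f z / d z - f z' / d z'\<bar> \<le> M * norm (z - z')"
    if z: "norm z \<le> \<rho>" "norm z' \<le> \<rho>" and f: "\<bar>f z - f z'\<bar> \<le> 2 * norm (z - z')" "\<bar>f z'\<bar> \<le> 1" for f z z'
  proof -
    have D: "d z > 0" "d z' > 0" using d_ge[OF z(1)] d_ge[OF z(2)] \<delta> by linarith+
    have "f z / d z - f z' / d z' = (f z - f z') / d z + f z' * (d z' - d z) / (d z * d z')"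
      using D by (simp add: field_simps)
    also have "\<bar>\<dots>\<bar> \<le> \<bar>(f z - f z') / d z\<bar> + \<bar>f z' * (d z' - d z) / (d z * d z')\<bar>" by (rule abs_triangle_ineq)
    also have "\<bar>(f z - f z') / d z\<bar> \<le> 2 * norm (z - z') / \<delta>\<^sup>2"
    proof -
      have "\<delta>\<^sup>2 \<le> \<delta>" using \<delta> by (simp add: power2_eq_square mult_left_le)
      then show ?thesis unfolding abs_divide using f D d_ge[OF z(1)] \<delta> by (intro frac_le) auto
    qed
    also have "\<bar>f z' * (d z' - d z) / (d z * d z')\<bar> \<le> 1 * (4 * norm (z - z')) / \<delta>\<^sup>2"
    proof -
      have "\<delta> * \<delta> \<le> d z * d z'" using d_ge[OF z(1)] d_ge[OF z(2)] \<delta> by (intro mult_mono) auto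
      then show ?thesis
        unfolding abs_divide abs_mult using f D \<delta> lip_d[OF z]
        by (intro frac_le mult_mono) (auto simp: power2_eq_square abs_minus_commute)
    qed
    also have "2 * norm (z - z') / \<delta>\<^sup>2 + 1 * (4 * norm (z - z')) / \<delta>\<^sup>2 \<le> M * norm (z - z')"
      using \<delta> by (simp add: M_def field_simps)
    finally show ?thesis by simp
  qed
  have lip_b: "\<bar>b z - b z'\<bar> \<le> 2 * k * M * norm (z - z')" if z: "norm z \<le> \<rho>" "norm z' \<le> \<rho>" for z z'
  proof -
    have "\<bar>z $ 1 / d z - z' $ 1 / d z'\<bar> \<le> M * norm (z - z')"
    proof (rule lip_quot[OF z])
      show "\<bar>z $ 1 - z' $ 1\<bar> \<le> 2 * norm (z - z')" using comp[of "z - z'" 1] norm_ge_zero[of "z - z'"] by simp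
      show "\<bar>z' $ 1\<bar> \<le> 1" using comp[of z' 1] z \<rho> by linarith
    qed
    moreover have "b z - b z' = 2 * k * (z $ 1 / d z - z' $ 1 / d z')" by (simp add: b_def algebra_simps)
    ultimately show ?thesis using k by (simp add: abs_mult mult_left_mono)
  qed
  have lip_a: "\<bar>a z - a z'\<bar> \<le> k * M * norm (z - z')" if z: "norm z \<le> \<rho>" "norm z' \<le> \<rho>" for z z'
  proof -
    have "norm (arcosh (k * W z) - arcosh (k * W z')) \<le> 1 * norm (k * W z - k * W z')"
    proof (rule field_differentiable_bound[of "{2..}" arcosh "\<lambda>x. 1 / sqrt (x\<^sup>2 - 1)"])
      fix x :: real assume x: "x \<in> {2..}"
      show "(arcosh has_real_derivative 1 / sqrt (x\<^sup>2 - 1)) (at x within {2..})"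
        using x arcosh_real_has_field_derivative[of x] by auto
      have "2\<^sup>2 \<le> x\<^sup>2" using x by (intro power_mono) auto
      then show "norm (1 / sqrt (x\<^sup>2 - 1)) \<le> 1" by (simp add: divide_le_eq)
    qed (use W_ge[OF z(1)] W_ge[OF z(2)] in auto)
    moreover have "\<bar>W z - W z'\<bar> \<le> M * norm (z - z')"
      unfolding W_def
    proof (rule lip_quot[OF z])
      show "\<bar>1 - w z - (1 - w z')\<bar> \<le> 2 * norm (z - z')" using lip_w[OF z] by simp
      show "\<bar>1 - w z'\<bar> \<le> 1" using w_le[OF z(2)] by simp
    qed
    then have "\<bar>k * W z - k * W z'\<bar> \<le> k * (M * norm (z - z'))"
      using k unfolding right_diff_distrib[symmetric] abs_mult by simp
    ultimately show ?thesis by (simp add: a_def abs_minus_commute mult.assoc)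
  qed
  define e1 where "e1 z = (a z + b z) / 2" for z
  define e2 where "e2 z = (a z - b z) / 2" for z
  have chart: "ps_n A 2 (e1 z) (e2 z) / (1 + ps_n A 1 (e1 z) (e2 z)) = z $ 1"
    "ps_n A 3 (e1 z) (e2 z) / (1 + ps_n A 1 (e1 z) (e2 z)) = z $ 2" if z: "norm z \<le> \<rho>" for z
  proof -
    have s: "e1 z + e2 z - A = - arcosh (k * W z)" and t: "e1 z - e2 z = b z"
      by (simp_all add: e1_def e2_def a_def field_simps)
    have ch: "cosh (e1 z + e2 z - A) = k * W z"
      unfolding s using W_ge[OF z] by (simp add: cosh_arcosh_real)
    define x where "x = z $ 1"
    define y where "y = z $ 2"
    define v where "v = 1 - w z"
    define D where "D = d z"
    have v: "v > 0" and D: "D > 0" using w_le[OF z] d_ge[OF z] \<delta> by (auto simp: v_def D_def)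
    have WD: "W z = v / D" "b z = 2 * k * x / D" by (simp_all add: W_def v_def D_def b_def x_def)
    have k0: "k > 0" using k by simp
    have wv: "w z = 1 - v" and Dv: "D = 2 - v - 2 * y" by (simp_all add: v_def D_def d_def y_def)
    have xy: "x * x = 1 - v - y * y" using w[of z] by (simp add: x_def y_def wv)
    \<comment> \<open>This identity turns the half plane form of the time coordinate into
      \<open>(1 + (norm z)\<^sup>2) / (1 - (norm z)\<^sup>2)\<close>, which is
      \<open>(2 - v) / v\<close>.\<close>
    have key: "4 * (x * x) + v * v + D * D = 2 * (2 - v) * D"
      unfolding xy Dv by (simp add: algebra_simps)
    have N2: "ps_n A 2 (e1 z) (e2 z) = 2 * x / v"
      unfolding ps_n_def Let_def ch t WD using v D k0 by simp
    have X: "1 / (2 * k) * (b z * b z * (1 / (k * W z)) + k * W z) = (4 * (x * x) + v * v) / (2 * v * D)"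
      unfolding WD using v D k0 by (simp add: field_simps)
    have Y: "k / 2 * (1 / (k * W z)) = D * D / (2 * v * D)"
      unfolding WD using v D k0 by (simp add: field_simps)
    have N1: "ps_n A 1 (e1 z) (e2 z) = (2 - v) / v"
    proof -
      have "ps_n A 1 (e1 z) (e2 z) = (4 * (x * x) + v * v + D * D) / (2 * v * D)"
        unfolding ps_n_def Let_def ch t cA using X Y by (simp add: add_divide_distrib)
      also have "\<dots> = (2 * D * (2 - v)) / (2 * D * v)" unfolding key by (simp only: mult.assoc mult.commute mult.left_commute)
      also have "\<dots> = (2 - v) / v" using D by simp
      finally show ?thesis .
    qed
    have N3: "ps_n A 3 (e1 z) (e2 z) = 2 * y / v"
    proof -
      have "ps_n A 3 (e1 z) (e2 z) = ps_n A 1 (e1 z) (e2 z) - 2 * (D * D / (2 * v * D))"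
        unfolding ps_n_def Let_def ch t cA using Y by simp
      also have "\<dots> = (2 - v - D) / v" unfolding N1 using v D by (simp add: field_simps)
      finally show ?thesis by (simp add: Dv)
    qed
    have "1 + (2 - v) / v = 2 / v" using v by (simp add: field_simps)
    then show "ps_n A 2 (e1 z) (e2 z) / (1 + ps_n A 1 (e1 z) (e2 z)) = z $ 1"
      "ps_n A 3 (e1 z) (e2 z) / (1 + ps_n A 1 (e1 z) (e2 z)) = z $ 2"
      unfolding N1 N2 N3 using v by (simp_all add: x_def y_def)
  qed
  show ?thesis
  proof (rule that[OF A, of "3 * k * M" e1 e2])
    show "3 * k * M > 0" using k M by simp
    have "a 0 = 0" "b 0 = 0" by (simp_all add: a_def b_def W_def d_def w_def A_def)
    then show "e1 0 = 0" "e2 0 = 0" by (simp_all add: e1_def e2_def)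
    show "\<bar>e1 z - e1 z'\<bar> + \<bar>e2 z - e2 z'\<bar> \<le> 3 * k * M * norm (z - z')" if z: "norm z \<le> \<rho>" "norm z' \<le> \<rho>" for z z'
    proof -
      have "\<bar>e1 z - e1 z'\<bar> + \<bar>e2 z - e2 z'\<bar> \<le> \<bar>a z - a z'\<bar> + \<bar>b z - b z'\<bar>"
        unfolding e1_def e2_def by (simp add: abs_if field_simps)
      also have "\<dots> \<le> k * M * norm (z - z') + 2 * k * M * norm (z - z')"
        by (intro add_mono lip_a lip_b z)
      finally show ?thesis by (simp add: algebra_simps)
    qed
    show "e1 z + e2 z \<le> A - arcosh 2" if z: "norm z \<le> \<rho>" for z
    proof -
      have "arcosh 2 \<le> arcosh (k * W z)" using W_ge[OF z] arcosh_less_iff_real[of "k * W z" 2] by (simp add: not_less[symmetric] del: arcosh_less_iff_real)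
      then show ?thesis by (simp add: e1_def e2_def a_def field_simps)
    qed
  qed (use chart in auto)
qed

section \<open>Inverting the perturbed chart\<close>

lemma frame_system_shift:
  assumes F: "frame_system e \<phi> \<phi>1 n p s"
  shows "frame_system e (\<lambda>u v. \<phi> (a + u) (b + v)) (\<lambda>u v. \<phi>1 (a + u) (b + v)) (\<lambda>u v. n (a + u) (b + v))
    (\<lambda>u v. p (a + u) (b + v)) (\<lambda>u v. s (a + u) (b + v))"
proof -
  have c: "cont2 (\<lambda>u v. f (a + u) (b + v))" if "cont2 f" for f
    unfolding cont2_def by (intro cont2_compose[OF that] continuous_intros)
  have d: "((\<lambda>x. f (c + x)) has_real_derivative D) (at x)" if "(f has_real_derivative D) (at (c + x))" for f D c x
    using that DERIV_shift[of f D x c] by (simp add: add.commute)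
  show ?thesis
    unfolding frame_system_def
    by (intro conjI allI c frame_systemD(1-3)[OF F] d[of "\<lambda>u. n u _"] d[of "\<lambda>u. p u _"] d[of "\<lambda>u. s u _"] d[of "n _"] d[of "p _"] d[of "s _"]
      frame_systemD(4-9)[OF F])
qed

lemma hyperbolic_frame_shift:
  assumes "hyperbolic_frame \<phi> \<phi>1 n p s"
  shows "hyperbolic_frame (\<lambda>u v. \<phi> (a + u) (b + v)) (\<lambda>u v. \<phi>1 (a + u) (b + v)) (\<lambda>i u v. n i (a + u) (b + v))
    (\<lambda>i u v. p i (a + u) (b + v)) (\<lambda>i u v. s i (a + u) (b + v))"
  using assms unfolding hyperbolic_frame_def by (auto intro: frame_system_shift)

text \<open>Brouwer's theorem gives preimages: \<open>\<delta> \<le> \<rho>' - \<rho>\<close> keeps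
  \<open>x + (y - F y)\<close> in the larger ball. The bound \<open>\<delta> \<le> 1 / 2\<close>
  makes \<open>F\<close> expand distances by at least 1/2, so the chosen preimages depend on
  \<open>z\<close> with Lipschitz constant 2.\<close>

lemma perturbed_identity_inverse:
  fixes F :: "'a::euclidean_space \<Rightarrow> 'a"
  assumes \<rho>: "0 < \<rho>" "\<rho> < \<rho>'" and F0: "F 0 = 0" and \<delta>: "0 \<le> \<delta>" "\<delta> \<le> 1 / 2" "\<delta> \<le> \<rho>' - \<rho>" "\<rho>' \<le> 1"
    and lip: "\<And>z z'. norm z \<le> \<rho>' \<Longrightarrow> norm z' \<le> \<rho>' \<Longrightarrow> norm ((F z - z) - (F z' - z')) \<le> \<delta> * norm (z - z')"
  obtains G where "\<And>z. norm z \<le> \<rho> \<Longrightarrow> norm (G z) \<le> \<rho>' \<and> F (G z) = z"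
    "\<And>z z'. norm z \<le> \<rho> \<Longrightarrow> norm z' \<le> \<rho> \<Longrightarrow> norm (G z - G z') \<le> 2 * norm (z - z')"
proof -
  have "continuous_on (cball 0 \<rho>') (\<lambda>z. F z - z)"
  proof (rule lipschitz_on_continuous_on[where L = \<delta>], rule lipschitz_onI)
    show "dist (F z - z) (F z' - z') \<le> \<delta> * dist z z'" if "z \<in> cball 0 \<rho>'" "z' \<in> cball 0 \<rho>'" for z z'
      using lip[of z z'] that by (simp add: dist_norm)
  qed (rule \<delta>)
  then have "continuous_on (cball 0 \<rho>') (\<lambda>z. (F z - z) + z)" by (intro continuous_on_add continuous_on_id)
  then have cont: "continuous_on (cball 0 \<rho>') F" by simp
  have "\<exists>y\<in>cball 0 \<rho>'. F y = z" if z: "z \<in> cball 0 \<rho>" for z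
  proof (rule brouwer_surjective[OF _ _ _ cont _ z])
    show "x + (y - F y) \<in> cball 0 \<rho>'" if "x \<in> cball 0 \<rho>" "y \<in> cball 0 \<rho>'" for x y
    proof -
      have "norm (y - F y) \<le> \<delta> * norm y" using lip[of y 0] that \<rho> F0 by (simp add: norm_minus_commute)
      also have "\<dots> \<le> (\<rho>' - \<rho>) * 1" using that \<rho> \<delta> by (intro mult_mono) auto
      finally show ?thesis using that norm_triangle_ineq[of x "y - F y"] by simp
    qed
  qed (use \<rho> in auto)
  then obtain G where G: "\<And>z. norm z \<le> \<rho> \<Longrightarrow> norm (G z) \<le> \<rho>' \<and> F (G z) = z"
    by (metis mem_cball_0)
  show ?thesis
  proof (rule that[OF G])
    fix z z' :: 'a assume z: "norm z \<le> \<rho>" "norm z' \<le> \<rho>"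
    have "norm ((z - G z) - (z' - G z')) \<le> \<delta> * norm (G z - G z')"
      using lip[of "G z" "G z'"] G[OF z(1)] G[OF z(2)] by simp
    also have "\<dots> \<le> 1 / 2 * norm (G z - G z')" using \<delta> by (intro mult_right_mono) auto
    finally have "norm ((z - G z) - (z' - G z')) \<le> norm (G z - G z') / 2" by simp
    moreover have "norm (G z - G z') \<le> norm (z - z') + norm ((z - G z) - (z' - G z'))"
      using norm_triangle_ineq4[of "z - z'" "(z - G z) - (z' - G z')"] by (simp add: algebra_simps)
    ultimately show "norm (G z - G z') \<le> 2 * norm (z - z')" by simp
  qed
qed

text \<open>The chart of the Amsler piece at \<open>(m, m)\<close>, composed with the inverse
  \<open>(e1, e2)\<close> of the pseudosphere chart, is a small Lipschitz perturbation
  \<open>F\<close> of the identity. Its right inverse \<open>G\<close> yields the coordinates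
  \<open>m + e1 (G z)\<close> and \<open>m + e2 (G z)\<close>. The radius \<open>\<rho>'\<close> is
  larger than \<open>\<rho>\<close> to leave room for \<open>G\<close>.\<close>

lemma hyperbolic_disk_chart:
  assumes \<rho>: "0 < \<rho>" "\<rho> < 1"
  obtains k \<psi> \<psi>1 n p s and y1 y2 :: "real^2 \<Rightarrow> real" where "amsler k \<psi> \<psi>1"
    "hyperbolic_frame (\<lambda>u v. \<psi> (u * v)) (\<lambda>u v. v * \<psi>1 (u * v)) n p s"
    "continuous_on (cball 0 \<rho>) y1" "continuous_on (cball 0 \<rho>) y2"
    "\<And>z. norm z \<le> \<rho> \<Longrightarrow> (y1 z, y2 z) \<in> amsler_domain (amsler.Z \<psi>)"
    "\<And>z. norm z \<le> \<rho> \<Longrightarrow> n 2 (y1 z) (y2 z) / (1 + n 1 (y1 z) (y2 z)) = z $ 1"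
    "\<And>z. norm z \<le> \<rho> \<Longrightarrow> n 3 (y1 z) (y2 z) / (1 + n 1 (y1 z) (y2 z)) = z $ 2"
proof -
  define \<rho>' where "\<rho>' = (1 + \<rho>) / 2"
  have \<rho>': "0 < \<rho>'" "\<rho> < \<rho>'" "\<rho>' < 1" using \<rho> by (auto simp: \<rho>'_def)
  obtain A \<Lambda> :: real and e1 e2 :: "real^2 \<Rightarrow> real" where A: "A > 0" "\<Lambda> > 0" and e0: "e1 0 = 0" "e2 0 = 0"
    and ch: "\<And>z. norm z \<le> \<rho>' \<Longrightarrow> ps_n A 2 (e1 z) (e2 z) / (1 + ps_n A 1 (e1 z) (e2 z)) = z $ 1"
      "\<And>z. norm z \<le> \<rho>' \<Longrightarrow> ps_n A 3 (e1 z) (e2 z) / (1 + ps_n A 1 (e1 z) (e2 z)) = z $ 2"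
    and elip: "\<And>z z'. norm z \<le> \<rho>' \<Longrightarrow> norm z' \<le> \<rho>' \<Longrightarrow> \<bar>e1 z - e1 z'\<bar> + \<bar>e2 z - e2 z'\<bar> \<le> \<Lambda> * norm (z - z')"
    and edge: "\<And>z. norm z \<le> \<rho>' \<Longrightarrow> e1 z + e2 z \<le> A - arcosh 2"
    using pseudosphere_chart_inverse[OF \<rho>'(1,3)] by blast
  obtain p0 s0 where H0: "hyperbolic_frame (\<lambda>u v. sep A (u + v)) (\<lambda>u v. sep1 A (u + v)) (ps_n A) p0 s0"
    by (rule pseudosphere_frame)
  define n0 where "n0 = ps_n A"
  note H0 = H0[folded n0_def] and ch = ch[folded n0_def]
  have F0: "frame_system 1 (\<lambda>u v. sep A (u + v)) (\<lambda>u v. sep1 A (u + v)) (n0 i) (p0 i) (s0 i)" for i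
    using H0 by (simp add: hyperbolic_frame_def)
  \<comment> \<open>Since \<open>e1\<close> and \<open>e2\<close> vanish at 0 and the ball has
    radius below 1, their Lipschitz constant also bounds their values.\<close>
  define L where "L = \<Lambda>"
  have L: "L > 0" using A by (simp add: L_def)
  have eL: "\<bar>e1 z\<bar> \<le> L" "\<bar>e2 z\<bar> \<le> L" if "norm z \<le> \<rho>'" for z
  proof -
    have "\<bar>e1 z\<bar> + \<bar>e2 z\<bar> \<le> \<Lambda> * norm z" using elip[OF that, of 0] e0 \<rho>' by simp
    also have "\<dots> \<le> \<Lambda> * 1" using that \<rho>' A by (intro mult_left_mono) auto
    finally show "\<bar>e1 z\<bar> \<le> L" "\<bar>e2 z\<bar> \<le> L" by (auto simp: L_def)
  qed
  have "\<exists>B. \<forall>u v. \<bar>u\<bar> \<le> L \<longrightarrow> \<bar>v\<bar> \<le> L \<longrightarrow> \<bar>f u v\<bar> \<le> B" if "cont2 f" for f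
  proof -
    have "compact ((\<lambda>z. f (fst z) (snd z)) ` cbox (-L, -L) (L, L))"
      by (intro compact_continuous_image continuous_on_subset[OF that[unfolded cont2_def]] compact_cbox) auto
    then obtain B where "\<forall>x\<in>(\<lambda>z. f (fst z) (snd z)) ` cbox (-L, -L) (L, L). norm x \<le> B"
      using compact_imp_bounded bounded_iff by blast
    then have B: "\<bar>f (fst z) (snd z)\<bar> \<le> B" if "z \<in> cbox (-L, -L) (L, L)" for z
      using that by auto
    have "\<bar>f u v\<bar> \<le> B" if "\<bar>u\<bar> \<le> L" "\<bar>v\<bar> \<le> L" for u v
      using B[of "(u, v)"] that by (auto simp: cbox_Pair_eq abs_le_iff)
    then show ?thesis by blast
  qed
  then have "\<forall>i. \<exists>B. \<forall>u v. \<bar>u\<bar> \<le> L \<longrightarrow> \<bar>v\<bar> \<le> L \<longrightarrow> \<bar>n0 i u v\<bar> \<le> B"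
    "\<forall>i. \<exists>B. \<forall>u v. \<bar>u\<bar> \<le> L \<longrightarrow> \<bar>v\<bar> \<le> L \<longrightarrow> \<bar>p0 i u v\<bar> \<le> B"
    "\<forall>i. \<exists>B. \<forall>u v. \<bar>u\<bar> \<le> L \<longrightarrow> \<bar>v\<bar> \<le> L \<longrightarrow> \<bar>s0 i u v\<bar> \<le> B"
    using frame_systemD(1-3)[OF F0] by blast+
  then obtain B1 B2 B3 :: "3 \<Rightarrow> real" where B: "\<And>i u v. \<bar>u\<bar> \<le> L \<Longrightarrow> \<bar>v\<bar> \<le> L \<Longrightarrow> \<bar>n0 i u v\<bar> \<le> B1 i"
    "\<And>i u v. \<bar>u\<bar> \<le> L \<Longrightarrow> \<bar>v\<bar> \<le> L \<Longrightarrow> \<bar>p0 i u v\<bar> \<le> B2 i"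
    "\<And>i u v. \<bar>u\<bar> \<le> L \<Longrightarrow> \<bar>v\<bar> \<le> L \<Longrightarrow> \<bar>s0 i u v\<bar> \<le> B3 i"
    by metis
  define K0 where "K0 = (\<Sum>i\<in>UNIV. \<bar>B1 i\<bar> + \<bar>B2 i\<bar> + \<bar>B3 i\<bar>)"
  have K0: "\<bar>n0 i u v\<bar> \<le> K0 \<and> \<bar>p0 i u v\<bar> \<le> K0 \<and> \<bar>s0 i u v\<bar> \<le> K0" if "\<bar>u\<bar> \<le> L" "\<bar>v\<bar> \<le> L" for i u v
  proof -
    have "\<bar>B1 i\<bar> + \<bar>B2 i\<bar> + \<bar>B3 i\<bar> \<le> K0"
      unfolding K0_def by (rule member_le_sum[of i UNIV]) auto
    then show ?thesis using B(1)[OF that, of i] B(2)[OF that, of i] B(3)[OF that, of i] by linarith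
  qed
  have K0pos: "K0 \<ge> 0" using K0[of 0 0 1] L by auto
  \<comment> \<open>One more than the bound of the reference frame, so that it also bounds the frame
    of the Amsler piece, whose error is at most \<open>\<epsilon> \<le> 1\<close>.\<close>
  define K where "K = K0 + 1"
  have K: "K \<ge> 1" using K0pos by (simp add: K_def)
  define C where "C = (2 * K\<^sup>2 * L * exp (3 * L) + 4 * K\<^sup>2 * L) * exp (6 * L)"
  have C: "C \<ge> 0" using L by (simp add: C_def)
  define \<delta> where "\<delta> = min (1 / 2) (\<rho>' - \<rho>)"
  have \<delta>: "0 < \<delta>" "\<delta> \<le> 1 / 2" "\<delta> \<le> \<rho>' - \<rho>"
  proof -
    show "0 < \<delta>" using \<rho>' by (simp add: \<delta>_def)
    show "\<delta> \<le> 1 / 2" "\<delta> \<le> \<rho>' - \<rho>" unfolding \<delta>_def by (rule min.cobounded1, rule min.cobounded2)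
  qed
  \<comment> \<open>Each of the two components of \<open>F z - z\<close> then has Lipschitz constant
    at most \<open>\<delta> / 2\<close>.\<close>
  define \<epsilon> where "\<epsilon> = min 1 (\<delta> / (2 * (16 * K\<^sup>2 * \<Lambda>)))"
  have p16: "16 * K\<^sup>2 * \<Lambda> > 0" using K A by simp
  have \<epsilon>: "0 < \<epsilon>" "\<epsilon> \<le> 1" "\<epsilon> \<le> \<delta> / (2 * (16 * K\<^sup>2 * \<Lambda>))" 
  proof -
    show "0 < \<epsilon>" using p16 \<delta> by (simp add: \<epsilon>_def)
    show "\<epsilon> \<le> 1" "\<epsilon> \<le> \<delta> / (2 * (16 * K\<^sup>2 * \<Lambda>))" unfolding \<epsilon>_def by (rule min.cobounded1, rule min.cobounded2)
  qed
  have \<epsilon>16: "16 * K\<^sup>2 * \<epsilon> * \<Lambda> \<le> \<delta> / 2" using \<epsilon>(3) p16 by (simp add: pos_le_divide_eq algebra_simps)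
  \<comment> \<open>The largest angle of the pseudosphere over the ball; its distance to
    \<open>pi\<close> is the margin to the edge, of which \<open>\<eta>\<close> uses at most half.
    The other bounds on \<open>\<eta>\<close> give
    \<open>\<eta>\<^sup>2 * C \<le> \<epsilon>\<^sup>2\<close> for the frames and
    \<open>\<eta> \<le> \<epsilon>\<close> for the angle.\<close>
  define g where "g = sep A (A - arcosh 2)"
  have g: "g < pi" unfolding g_def by (rule sep_less_pi) simp
  define \<eta> where "\<eta> = min (\<epsilon> / (sqrt C + 1)) (min \<epsilon> ((pi - g) / 2))"
  have \<eta>: "0 < \<eta>" "\<eta> \<le> \<epsilon>" "g < pi - \<eta>" "\<eta> \<le> \<epsilon> / (sqrt C + 1)"
  proof -
    have "0 < \<epsilon> / (sqrt C + 1)" "0 < (pi - g) / 2" using \<epsilon> g C by (simp_all add: add_nonneg_pos)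
    then show "0 < \<eta>" using \<epsilon> by (simp add: \<eta>_def)
    have m: "\<eta> \<le> min \<epsilon> ((pi - g) / 2)" "\<eta> \<le> \<epsilon> / (sqrt C + 1)"
      unfolding \<eta>_def by (rule min.cobounded2, rule min.cobounded1)
    then show "\<eta> \<le> \<epsilon>" "\<eta> \<le> \<epsilon> / (sqrt C + 1)" by simp_all
    have "\<eta> \<le> (pi - g) / 2" by (rule order_trans[OF m(1) min.cobounded2])
    then show "g < pi - \<eta>" using g by simp
  qed
  have \<eta>C: "\<eta>\<^sup>2 * C \<le> \<epsilon>\<^sup>2"
  proof -
    have "\<eta> * sqrt C \<le> \<eta> * (sqrt C + 1)" using \<eta> by simp
    also have "\<dots> \<le> \<epsilon>" using \<eta>(4) C by (simp add: pos_le_divide_eq add_nonneg_pos)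
    finally have "(\<eta> * sqrt C)\<^sup>2 \<le> \<epsilon>\<^sup>2" using \<eta> C by (intro power_mono) auto
    then show ?thesis using C by (simp add: power_mult_distrib)
  qed
  obtain N where N: "\<And>k \<psi> \<psi>1. k \<ge> N \<Longrightarrow> amsler k \<psi> \<psi>1 \<Longrightarrow> \<exists>m>L. \<forall>s t. \<bar>s\<bar> \<le> L \<and> \<bar>t\<bar> \<le> L \<longrightarrow>
    \<bar>\<psi> ((m + s) * (m + t)) - sep A (s + t)\<bar> \<le> \<eta> \<and>
    \<bar>(m + t) * \<psi>1 ((m + s) * (m + t)) - sep1 A (s + t)\<bar> \<le> \<eta> \<and>
    (sep A (s + t) < pi - \<eta> \<longrightarrow> (m + s, m + t) \<in> amsler_domain (amsler.Z \<psi>))"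
    using amsler_chart_limit[OF A(1) L \<eta>(1)] by blast
  define k where "k = max N 2"
  obtain \<psi> \<psi>1 where am: "amsler k \<psi> \<psi>1" using amsler_exists[of k] by (auto simp: k_def)
  then interpret amsler k \<psi> \<psi>1 .
  obtain m where m: "m > L"
    and lim: "\<And>s t. \<bar>s\<bar> \<le> L \<Longrightarrow> \<bar>t\<bar> \<le> L \<Longrightarrow> \<bar>\<psi> ((m + s) * (m + t)) - sep A (s + t)\<bar> \<le> \<eta> \<and>
      \<bar>(m + t) * \<psi>1 ((m + s) * (m + t)) - sep1 A (s + t)\<bar> \<le> \<eta>"
    and dom: "\<And>s t. \<bar>s\<bar> \<le> L \<Longrightarrow> \<bar>t\<bar> \<le> L \<Longrightarrow> sep A (s + t) < pi - \<eta> \<Longrightarrow> (m + s, m + t) \<in> amsler_domain Z"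
    using N[OF _ am] by (auto simp: k_def)
  \<comment> \<open>The frame over the Amsler angle is prescribed at \<open>(m, m)\<close>, where it
    is to agree with the pseudosphere frame at the origin.\<close>
  have "\<forall>i. \<exists>n p s. frame_system 1 (\<lambda>u v. \<psi> (u * v)) (\<lambda>u v. v * \<psi>1 (u * v)) n p s \<and>
      n m m = n0 i 0 0 \<and> p m m = p0 i 0 0 \<and> s m m = s0 i 0 0"
  proof
    fix i
    show "\<exists>n p s. frame_system 1 (\<lambda>u v. \<psi> (u * v)) (\<lambda>u v. v * \<psi>1 (u * v)) n p s \<and>
      n m m = n0 i 0 0 \<and> p m m = p0 i 0 0 \<and> s m m = s0 i 0 0"
      by (rule frame_system_exists[of 1 m m "n0 i 0 0" "p0 i 0 0" "s0 i 0 0"]) auto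
  qed
  then obtain n p s where F: "\<And>i. frame_system 1 (\<lambda>u v. \<psi> (u * v)) (\<lambda>u v. v * \<psi>1 (u * v)) (n i) (p i) (s i)"
    and init: "\<And>i. n i m m = n0 i 0 0" "\<And>i. p i m m = p0 i 0 0" "\<And>i. s i m m = s0 i 0 0"
    unfolding choice_iff by blast
  have H: "hyperbolic_frame (\<lambda>u v. \<psi> (u * v)) (\<lambda>u v. v * \<psi>1 (u * v)) n p s"
  proof (rule hyperbolic_frameI[OF F, where a = m and b = m])
    have "n0 1 0 0 \<ge> 1" using H0 by (simp add: hyperbolic_frame_def)
    then show "n 1 m m > 0" by (simp add: init)
  qed (use H0 in \<open>simp add: hyperbolic_frame_def init\<close>)
  note Hs = hyperbolic_frame_shift[OF H, of m m]
  define n' where "n' i u v = n i (m + u) (m + v)" for i u v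
  define p' where "p' i u v = p i (m + u) (m + v)" for i u v
  define s' where "s' i u v = s i (m + u) (m + v)" for i u v
  have Hs: "hyperbolic_frame (\<lambda>u v. \<psi> ((m + u) * (m + v))) (\<lambda>u v. (m + v) * \<psi>1 ((m + u) * (m + v))) n' p' s'"
    using Hs unfolding n'_def[abs_def] p'_def[abs_def] s'_def[abs_def] .
  then have Fs: "frame_system 1 (\<lambda>u v. \<psi> ((m + u) * (m + v))) (\<lambda>u v. (m + v) * \<psi>1 ((m + u) * (m + v))) (n' i) (p' i) (s' i)" for i
    by (simp add: hyperbolic_frame_def)
  have cl: "close K \<epsilon> (n' i u v) (n0 i u v) \<and> close K \<epsilon> (p' i u v) (p0 i u v) \<and> close K \<epsilon> (s' i u v) (s0 i u v)"
    if uv: "\<bar>u\<bar> \<le> L" "\<bar>v\<bar> \<le> L" for i u v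
  proof -
    have "(n' i u v - n0 i u v)\<^sup>2 + (p' i u v - p0 i u v)\<^sup>2 + (s' i u v - s0 i u v)\<^sup>2 \<le> \<eta>\<^sup>2 * C"
      unfolding C_def
    proof (rule frame_comparison[OF Fs F0])
      show "\<bar>n0 i a b\<bar> \<le> K \<and> \<bar>p0 i a b\<bar> \<le> K \<and> \<bar>s0 i a b\<bar> \<le> K" if "\<bar>a\<bar> \<le> L" "\<bar>b\<bar> \<le> L" for a b
        using K0[OF that, of i] unfolding K_def by linarith
    qed (use uv lim in \<open>auto simp: n'_def p'_def s'_def init\<close>)
    then have sum: "(n' i u v - n0 i u v)\<^sup>2 + (p' i u v - p0 i u v)\<^sup>2 + (s' i u v - s0 i u v)\<^sup>2 \<le> \<epsilon>\<^sup>2" using \<eta>C by linarith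
    have "(n' i u v - n0 i u v)\<^sup>2 \<ge> 0" "(p' i u v - p0 i u v)\<^sup>2 \<ge> 0" "(s' i u v - s0 i u v)\<^sup>2 \<ge> 0" by auto
    with sum have "(n' i u v - n0 i u v)\<^sup>2 \<le> \<epsilon>\<^sup>2" "(p' i u v - p0 i u v)\<^sup>2 \<le> \<epsilon>\<^sup>2" "(s' i u v - s0 i u v)\<^sup>2 \<le> \<epsilon>\<^sup>2" by linarith+
    then have "\<bar>n' i u v - n0 i u v\<bar> \<le> \<epsilon>" "\<bar>p' i u v - p0 i u v\<bar> \<le> \<epsilon>" "\<bar>s' i u v - s0 i u v\<bar> \<le> \<epsilon>"
      using \<epsilon> by (simp_all add: abs_le_square_iff[symmetric])
    then show ?thesis
      using K0[OF uv, of i] \<epsilon>(2) unfolding close_def K_def by (simp add: abs_le_iff)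
  qed
  define f where "f i u v = n' i u v / (1 + n' 1 u v)" for i u v
  define f0 where "f0 i u v = n0 i u v / (1 + n0 1 u v)" for i u v
  define F where "F z = (vector [f 2 (e1 z) (e2 z), f 3 (e1 z) (e2 z)] :: real^2)" for z
  have Fcomp: "F z $ 1 = f 2 (e1 z) (e2 z)" "F z $ 2 = f 3 (e1 z) (e2 z)" for z by (simp_all add: F_def)
  have lip: "norm ((F z - z) - (F z' - z')) \<le> \<delta> * norm (z - z')" if z: "norm z \<le> \<rho>'" "norm z' \<le> \<rho>'" for z z'
  proof -
    have c: "\<bar>(f i (e1 z) (e2 z) - f0 i (e1 z) (e2 z)) - (f i (e1 z') (e2 z') - f0 i (e1 z') (e2 z'))\<bar> \<le> \<delta> / 2 * norm (z - z')" for i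
    proof -
      have "\<bar>(f i (e1 z) (e2 z) - f0 i (e1 z) (e2 z)) - (f i (e1 z') (e2 z') - f0 i (e1 z') (e2 z'))\<bar>
          \<le> 16 * K\<^sup>2 * \<epsilon> * (\<bar>e1 z - e1 z'\<bar> + \<bar>e2 z - e2 z'\<bar>)"
        unfolding f_def f0_def
        by (rule disk_chart_difference_lipschitz[OF Hs H0 K cl]) (use lim \<eta>(2) eL z in \<open>auto intro: order_trans\<close>)
      also have "\<dots> \<le> 16 * K\<^sup>2 * \<epsilon> * (\<Lambda> * norm (z - z'))"
        using \<epsilon> by (intro mult_left_mono elip z) auto
      also have "\<dots> \<le> \<delta> / 2 * norm (z - z')"
        using mult_right_mono[OF \<epsilon>16, of "norm (z - z')"] by (simp add: mult.assoc)
      finally show ?thesis .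
    qed
    have "norm ((F z - z) - (F z' - z')) \<le> \<bar>((F z - z) - (F z' - z')) $ 1\<bar> + \<bar>((F z - z) - (F z' - z')) $ 2\<bar>"
      using norm_le_l1_cart[of "(F z - z) - (F z' - z')"] by (simp only: sum_2)
    also have "\<dots> \<le> \<delta> / 2 * norm (z - z') + \<delta> / 2 * norm (z - z')"
      using c[of 2] c[of 3] ch[OF z(1)] ch[OF z(2)] by (simp add: Fcomp f0_def add_mono)
    finally show ?thesis by simp
  qed
  have "F 0 = 0"
  proof -
    have "f i 0 0 = f0 i 0 0" for i by (simp add: f_def f0_def n'_def init)
    then have "F 0 $ 1 = 0" "F 0 $ 2 = 0" using ch[of 0] \<rho>' by (simp_all add: Fcomp e0 f0_def)
    then show ?thesis by (simp add: vec_eq_iff forall_2)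
  qed
  then obtain G where G: "\<And>z. norm z \<le> \<rho> \<Longrightarrow> norm (G z) \<le> \<rho>' \<and> F (G z) = z"
    and Glip: "\<And>z z'. norm z \<le> \<rho> \<Longrightarrow> norm z' \<le> \<rho> \<Longrightarrow> norm (G z - G z') \<le> 2 * norm (z - z')"
    using perturbed_identity_inverse[OF \<rho>(1) \<rho>'(2) _ _ \<delta>(2,3) _ lip] \<rho>' \<delta> by (metis less_imp_le)
  have ylip: "\<bar>e1 (G z) - e1 (G z')\<bar> + \<bar>e2 (G z) - e2 (G z')\<bar> \<le> \<Lambda> * 2 * norm (z - z')"
    if z: "norm z \<le> \<rho>" "norm z' \<le> \<rho>" for z z'
  proof -
    have "\<bar>e1 (G z) - e1 (G z')\<bar> + \<bar>e2 (G z) - e2 (G z')\<bar> \<le> \<Lambda> * norm (G z - G z')" using elip G z by blast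
    also have "\<dots> \<le> \<Lambda> * (2 * norm (z - z'))" using Glip[OF z] A by (intro mult_left_mono) auto
    finally show ?thesis by simp
  qed
  show ?thesis
  proof (rule that[OF am H, of "\<lambda>z. m + e1 (G z)" "\<lambda>z. m + e2 (G z)"])
    have "continuous_on (cball 0 \<rho>) (\<lambda>z. e1 (G z))" "continuous_on (cball 0 \<rho>) (\<lambda>z. e2 (G z))"
      using ylip A by (auto intro!: lipschitz_on_continuous_on[where L = "\<Lambda> * 2"] lipschitz_onI simp: dist_norm)
        (smt (verit))+
    then show "continuous_on (cball 0 \<rho>) (\<lambda>z. m + e1 (G z))" "continuous_on (cball 0 \<rho>) (\<lambda>z. m + e2 (G z))"
      by (intro continuous_intros; simp)+
    fix z :: "real^2" assume z: "norm z \<le> \<rho>"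
    have Gz: "norm (G z) \<le> \<rho>'" "F (G z) = z" using G[OF z] by auto
    have "sep A (e1 (G z) + e2 (G z)) \<le> g" unfolding g_def by (intro sep_mono edge Gz)
    then show "(m + e1 (G z), m + e2 (G z)) \<in> amsler_domain Z"
      using dom eL Gz \<eta>(3) by simp
    show "n 2 (m + e1 (G z)) (m + e2 (G z)) / (1 + n 1 (m + e1 (G z)) (m + e2 (G z))) = z $ 1"
      "n 3 (m + e1 (G z)) (m + e2 (G z)) / (1 + n 1 (m + e1 (G z)) (m + e2 (G z))) = z $ 2"
      using Fcomp[of "G z"] Gz by (simp_all add: f_def n'_def)
  qed
qed

section \<open>The isometric immersion\<close>

text \<open>A predicate with hidden partial derivatives: for the second derivatives of the immersion
  only their existence and continuity matter.\<close>

definition C1_2 :: "(real \<Rightarrow> real \<Rightarrow> real) \<Rightarrow> bool" where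
  "C1_2 f \<longleftrightarrow> cont2 f \<and> (\<exists>fu fv. cont2 fu \<and> cont2 fv \<and>
    (\<forall>u v. ((\<lambda>u. f u v) has_real_derivative fu u v) (at u) \<and> ((\<lambda>v. f u v) has_real_derivative fv u v) (at v)))"

lemma C1_2I:
  assumes "cont2 f" "cont2 fu" "cont2 fv" "\<And>u v. ((\<lambda>u. f u v) has_real_derivative fu u v) (at u)"
    "\<And>u v. ((\<lambda>v. f u v) has_real_derivative fv u v) (at v)"
  shows "C1_2 f"
  using assms unfolding C1_2_def by blast

lemma C1_2_mult:
  assumes "C1_2 f" "C1_2 g"
  shows "C1_2 (\<lambda>u v. f u v * g u v)"
proof -
  obtain fu fv gu gv where
    f: "cont2 f" "cont2 fu" "cont2 fv" "\<And>u v. ((\<lambda>u. f u v) has_real_derivative fu u v) (at u)"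
      "\<And>u v. ((\<lambda>v. f u v) has_real_derivative fv u v) (at v)" and
    g: "cont2 g" "cont2 gu" "cont2 gv" "\<And>u v. ((\<lambda>u. g u v) has_real_derivative gu u v) (at u)"
      "\<And>u v. ((\<lambda>v. g u v) has_real_derivative gv u v) (at v)"
    using assms unfolding C1_2_def by blast
  show ?thesis
    by (rule C1_2I[OF _ _ _ DERIV_mult[OF f(4) g(4)] DERIV_mult[OF f(5) g(5)]])
      (use f(1-3) g(1-3) in \<open>auto simp: cont2_def intro!: continuous_intros\<close>)
qed

lemma C1_2_diff:
  assumes "C1_2 f" "C1_2 g"
  shows "C1_2 (\<lambda>u v. f u v - g u v)"
proof -
  obtain fu fv gu gv where
    f: "cont2 f" "cont2 fu" "cont2 fv" "\<And>u v. ((\<lambda>u. f u v) has_real_derivative fu u v) (at u)"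
      "\<And>u v. ((\<lambda>v. f u v) has_real_derivative fv u v) (at v)" and
    g: "cont2 g" "cont2 gu" "cont2 gv" "\<And>u v. ((\<lambda>u. g u v) has_real_derivative gu u v) (at u)"
      "\<And>u v. ((\<lambda>v. g u v) has_real_derivative gv u v) (at v)"
    using assms unfolding C1_2_def by blast
  show ?thesis
    by (rule C1_2I[OF _ _ _ DERIV_diff[OF f(4) g(4)] DERIV_diff[OF f(5) g(5)]])
      (use f(1-3) g(1-3) in \<open>auto simp: cont2_def intro!: continuous_intros\<close>)
qed

lemma C1_2_add_const:
  assumes "C1_2 f"
  shows "C1_2 (\<lambda>u v. c + f u v)"
proof -
  obtain fu fv where
    f: "cont2 f" "cont2 fu" "cont2 fv" "\<And>u v. ((\<lambda>u. f u v) has_real_derivative fu u v) (at u)"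
      "\<And>u v. ((\<lambda>v. f u v) has_real_derivative fv u v) (at v)"
    using assms unfolding C1_2_def by blast
  show ?thesis
    by (rule C1_2I[of _ fu fv])
      (use f(1-3) in \<open>auto simp: cont2_def intro!: continuous_intros derivative_eq_intros f(4,5)\<close>)
qed

text \<open>Partial derivatives yield the total derivative as soon as one of them, here the one in
  \<open>v\<close>, is continuous.\<close>

lemma has_derivative_2_variables:
  fixes h :: "real \<Rightarrow> real \<Rightarrow> real"
  assumes hu: "\<And>u v. ((\<lambda>u. h u v) has_real_derivative hu u v) (at u)"
    and hv: "\<And>u v. ((\<lambda>v. h u v) has_real_derivative hv u v) (at v)" and c: "cont2 hv"
  shows "((\<lambda>z. h (fst z) (snd z)) has_derivative (\<lambda>w. hu a b * fst w + hv a b * snd w)) (at (a, b))"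
proof -
  have "((\<lambda>(x, y). h x y) has_derivative (\<lambda>(tx, ty). hu a b * tx + blinfun_apply (blinfun_mult_right (hv a b)) ty))
      (at (a, b) within UNIV \<times> UNIV)"
  proof (rule has_derivative_partialsI)
    show "((\<lambda>x. h x b) has_derivative (*) (hu a b)) (at a within UNIV)"
      using hu[of b a] by (simp add: has_field_derivative_def)
    show "((\<lambda>y. h x y) has_derivative blinfun_apply (blinfun_mult_right (hv x y))) (at y within UNIV)" for x y
      using hv[of x y] by (simp add: has_field_derivative_eq_has_derivative_blinfun)
    have "isCont (\<lambda>z. hv (fst z) (snd z)) (a, b)"
      using c by (simp add: cont2_def continuous_on_eq_continuous_at)
    then have "isCont (\<lambda>z. blinfun_mult_right (hv (fst z) (snd z))) (a, b)"
      by (rule bounded_linear.isCont[OF bounded_linear_blinfun_mult_right])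
    then show "continuous (at (a, b) within UNIV \<times> UNIV) (\<lambda>(x, y). blinfun_mult_right (hv x y))"
      unfolding case_prod_unfold by simp
  qed auto
  then show ?thesis unfolding case_prod_unfold by simp
qed

section \<open>Hyperbolic disks inside the unit disk\<close>

lemma hyperbolic_disk_open:
  assumes p: "p \<in> hyperbolic_plane"
  shows "open (hyperbolic_disk p R)"
proof -
  have "hyperbolic_disk p R = ball 0 1 \<inter> (\<lambda>q. hyperbolic_dist p q) -` {..<R}"
    by (auto simp: hyperbolic_disk_def hyperbolic_plane_def)
  moreover have "continuous_on (ball 0 1) (\<lambda>q. hyperbolic_dist p q)"
    unfolding hyperbolic_dist_def
  proof -
    have np: "(norm p)\<^sup>2 < 1" using p by (simp add: hyperbolic_plane_def power_less_one_iff)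
    have nq: "(norm q)\<^sup>2 < 1" if "q \<in> ball 0 1" for q :: "real^2" using that by (simp add: power_less_one_iff)
    have "\<forall>q\<in>ball (0 :: real^2) 1. (1 - (norm p)\<^sup>2) * (1 - (norm q)\<^sup>2) \<noteq> 0"
    proof
      fix q :: "real^2" assume "q \<in> ball 0 1"
      from nq[OF this] show "(1 - (norm p)\<^sup>2) * (1 - (norm q)\<^sup>2) \<noteq> 0" using np by simp
    qed
    then have c: "continuous_on (ball 0 1) (\<lambda>q. 1 + 2 * (norm (p - q))\<^sup>2 / ((1 - (norm p)\<^sup>2) * (1 - (norm q)\<^sup>2)))"
      by (intro continuous_intros) auto
    have ge: "1 \<le> 1 + 2 * (norm (p - q))\<^sup>2 / ((1 - (norm p)\<^sup>2) * (1 - (norm q)\<^sup>2))" if "q \<in> ball 0 1" for q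
      using np nq[OF that] by simp
    show "continuous_on (ball 0 1) (\<lambda>q. arcosh (1 + 2 * (norm (p - q))\<^sup>2 / ((1 - (norm p)\<^sup>2) * (1 - (norm q)\<^sup>2))))"
      by (rule continuous_on_compose2[OF continuous_on_arcosh[OF order_refl] c])
        (use ge in \<open>auto simp del: le_add_same_cancel1\<close>)
  qed
  ultimately show ?thesis by (simp add: continuous_open_preimage)
qed

text \<open>A point \<open>q\<close> of the disk that is not within \<open>(1 + norm p) / 2\<close>
  of the origin has Euclidean distance at least \<open>g\<close> from \<open>p\<close>. The bounded
  hyperbolic distance then forces \<open>1 - (norm q)\<^sup>2\<close> above the fixed
  \<open>\<kappa>\<close>.\<close>

lemma hyperbolic_disk_subset:
  assumes p: "p \<in> hyperbolic_plane" and R: "R > 0"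
  obtains \<rho> where "0 < \<rho>" "\<rho> < 1" "hyperbolic_disk p R \<subseteq> cball 0 \<rho>"
proof -
  have np: "norm p < 1" using p by (simp add: hyperbolic_plane_def)
  define P where "P = 1 - (norm p)\<^sup>2"
  have P: "0 < P" "P \<le> 1" using np by (auto simp: P_def power_less_one_iff)
  define c where "c = cosh R"
  have c: "c > 1" using cosh_real_strict_mono[of 0 R] R by (simp add: c_def)
  define g where "g = (1 - norm p) / 2"
  have g: "g > 0" using np by (simp add: g_def)
  define \<kappa> where "\<kappa> = 2 * g\<^sup>2 / (c - 1)"
  have \<kappa>: "\<kappa> > 0" using g c by (simp add: \<kappa>_def)
  define \<rho> where "\<rho> = max ((1 + norm p) / 2) (sqrt (max 0 (1 - \<kappa>)))"
  have \<rho>: "0 < \<rho>" "\<rho> < 1" using np \<kappa> by (auto simp: \<rho>_def less_max_iff_disj add_pos_nonneg)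
  have "norm q \<le> \<rho>" if q: "q \<in> hyperbolic_disk p R" for q
  proof (cases "norm q \<le> (1 + norm p) / 2")
    case False
    define Q where "Q = 1 - (norm q)\<^sup>2"
    define X where "X = 1 + 2 * (norm (p - q))\<^sup>2 / (P * Q)"
    have nq: "norm q < 1" using q by (simp add: hyperbolic_disk_def hyperbolic_plane_def)
    then have Q: "Q > 0" by (simp add: Q_def power_less_one_iff)
    have X1: "X \<ge> 1" using P Q by (simp add: X_def)
    have "arcosh X < R" using q by (simp add: hyperbolic_disk_def hyperbolic_dist_def X_def P_def Q_def)
    then have "cosh (arcosh X) < cosh R" using X1 by (intro cosh_real_strict_mono) auto
    then have "2 * (norm (p - q))\<^sup>2 / (P * Q) < c - 1" using X1 by (simp add: c_def X_def)
    then have "2 * (norm (p - q))\<^sup>2 < (c - 1) * (P * Q)" using P Q by (simp add: pos_divide_less_eq)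
    also have "\<dots> \<le> (c - 1) * (1 * Q)" using c P Q by (intro mult_left_mono mult_right_mono) auto
    finally have 1: "2 * (norm (p - q))\<^sup>2 < (c - 1) * Q" by simp
    have "g \<le> norm (p - q)"
      using False norm_triangle_ineq2[of q p] by (simp add: g_def norm_minus_commute)
    then have "g\<^sup>2 \<le> (norm (p - q))\<^sup>2" using g by (intro power_mono) auto
    then have "2 * g\<^sup>2 < (c - 1) * Q" using 1 by simp
    then have "\<kappa> < Q" using c by (simp add: \<kappa>_def pos_divide_less_eq mult.commute)
    then have "(norm q)\<^sup>2 \<le> max 0 (1 - \<kappa>)" by (simp add: Q_def)
    then have "norm q \<le> sqrt (max 0 (1 - \<kappa>))" by (rule real_le_rsqrt)
    then show ?thesis by (simp add: \<rho>_def)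
  qed (unfold \<rho>_def, rule max.coboundedI1)
  then have "hyperbolic_disk p R \<subseteq> cball 0 \<rho>" by auto
  then show ?thesis by (rule that[OF \<rho>])
qed

lemma vector_derivative_component:
  fixes f :: "real \<Rightarrow> real^'n"
  assumes "(f has_vector_derivative f') F"
  shows "((\<lambda>t. f t $ k) has_real_derivative f' $ k) F"
  using bounded_linear.has_vector_derivative[OF bounded_linear_vec_nth assms]
  by (simp add: has_real_derivative_iff_has_vector_derivative)

lemma frame_system_C1_2:
  assumes F: "frame_system e \<phi> \<phi>1 n p s" and c: "cont2 \<phi>" "cont2 \<phi>1"
  shows "C1_2 n" "C1_2 p" "C1_2 s"
proof -
  note D = frame_systemD[OF F]
  show "C1_2 n"
    by (rule C1_2I[OF D(1) _ _ D(4,7)]) (use D(1-3) c in \<open>auto simp: cont2_def intro!: continuous_intros\<close>)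
  show "C1_2 p"
    by (rule C1_2I[OF D(2) _ _ D(5,8)]) (use D(1-3) c in \<open>auto simp: cont2_def intro!: continuous_intros\<close>)
  show "C1_2 s"
    by (rule C1_2I[OF D(3) _ _ D(6,9)]) (use D(1-3) c in \<open>auto simp: cont2_def intro!: continuous_intros\<close>)
qed

text \<open>The spatial Minkowski coordinate that belongs to a coordinate of the disk.\<close>

definition idx :: "2 \<Rightarrow> 3" where "idx i = (if i = 1 then 2 else 3)"

text \<open>For the coordinate field \<open>\<partial>\<^sub>i\<close> of the disk, \<open>lift n p i\<close> and \<open>lift n s i\<close> are its components in
  the orthonormal frame \<open>p, s\<close> of the surface.\<close>

definition lift :: "(3 \<Rightarrow> real \<Rightarrow> real \<Rightarrow> real) \<Rightarrow> (3 \<Rightarrow> real \<Rightarrow> real \<Rightarrow> real) \<Rightarrow> 2 \<Rightarrow> real \<Rightarrow> real \<Rightarrow> real" where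
  "lift n p i u v = (1 + n 1 u v) * p (idx i) u v - n (idx i) u v * p 1 u v"

text \<open>The relations between different coordinates express \<open>p a * p b + s a * s b\<close>
  through \<open>n\<close>. The conformal factor \<open>(1 + n 1 u v)\<^sup>2\<close> that remains
  is that of the metric of the unit disk.\<close>

lemma lift_orthogonal:
  assumes H: "hyperbolic_frame \<phi> \<phi>1 n p s"
  shows "lift n p i u v * lift n p j u v + lift n s i u v * lift n s j u v = (if i = j then (1 + n 1 u v)\<^sup>2 else 0)"
proof -
  have col: "p a u v * p b u v + s a u v * s b u v = n a u v * n b u v - (if a = b then (if a = 1 then 1 else - 1) else 0)" for a b
  proof -
    have "n a u v * n b u v - (p a u v * p b u v + s a u v * s b u v) = (if a = b then (if a = 1 then 1 else - 1) else 0)"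
      using H unfolding hyperbolic_frame_def by blast
    then show ?thesis by (simp add: algebra_simps)
  qed
  define a where "a = idx i"
  define b where "b = idx j"
  have ab: "a \<noteq> 1" "b \<noteq> 1" "a = b \<longleftrightarrow> i = j" using exhaust_2[of i] exhaust_2[of j] by (auto simp: a_def b_def idx_def)
  define l where "l = 1 + n 1 u v"
  have "lift n p i u v * lift n p j u v + lift n s i u v * lift n s j u v
    = l * l * (p a u v * p b u v + s a u v * s b u v) - l * n b u v * (p a u v * p 1 u v + s a u v * s 1 u v)
      - l * n a u v * (p 1 u v * p b u v + s 1 u v * s b u v) + n a u v * n b u v * (p 1 u v * p 1 u v + s 1 u v * s 1 u v)"
    unfolding lift_def a_def[symmetric] b_def[symmetric] l_def[symmetric] by (simp add: algebra_simps)
  also have "\<dots> = (if i = j then l * l else 0)"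
    unfolding col using ab by (simp add: l_def algebra_simps)
  finally show ?thesis by (simp add: l_def power2_eq_square)
qed

text \<open>The chart differential is conformal in the frame \<open>p\<close>, \<open>s\<close>, so
  its inverse is a multiple of its transpose. This is why the components of \<open>lift\<close> are
  chart derivatives up to a factor.\<close>

lemma lift_chart_deriv:
  assumes "n 1 u v \<ge> 1"
  shows "lift n p i u v = (1 + n 1 u v)\<^sup>2 * chart_deriv (n 1 u v) (n (idx i) u v) (p 1 u v) (p (idx i) u v)"
proof -
  have "l * x - y * w = l\<^sup>2 * (x * (1 / l) - y * w * (1 / l) * (1 / l))" if "l \<noteq> 0" for l x y w :: real
    using that by (simp add: power2_eq_square field_simps)
  from this[of "1 + n 1 u v"] show ?thesis using assms by (simp add: lift_def chart_deriv_def)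
qed

text \<open>The coordinates \<open>y1\<close>, \<open>y2\<close> are already known to be continuous,
  so a left inverse of the differential of the chart gives their derivative. In the orthonormal
  frame \<open>h\<close> has the derivative \<open>hu\<close> along \<open>p\<close> and
  \<open>(hv - cos \<phi> * hu) / sin \<phi>\<close> along \<open>s\<close>, because the
  \<open>v\<close>-direction is \<open>cos \<phi> * p + sin \<phi> * s\<close>.\<close>

lemma disk_chart_inverse_derivative:
  fixes y1 y2 :: "real^2 \<Rightarrow> real"
  assumes H: "hyperbolic_frame \<phi> \<phi>1 n p s" and \<phi>: "cont2 \<phi>" "cont2 \<phi>1"
    and U: "open U" "z \<in> U" and y: "continuous_on U y1" "continuous_on U y2"
    and inv: "\<And>z. z \<in> U \<Longrightarrow> n 2 (y1 z) (y2 z) / (1 + n 1 (y1 z) (y2 z)) = z $ 1"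
      "\<And>z. z \<in> U \<Longrightarrow> n 3 (y1 z) (y2 z) / (1 + n 1 (y1 z) (y2 z)) = z $ 2"
    and sin: "sin (\<phi> (y1 z) (y2 z)) \<noteq> 0"
    and hu: "\<And>u v. ((\<lambda>u. h u v) has_real_derivative hu u v) (at u)"
    and hv: "\<And>u v. ((\<lambda>v. h u v) has_real_derivative hv u v) (at v)" and hc: "cont2 hv"
  shows "((\<lambda>z. h (y1 z) (y2 z)) has_derivative (\<lambda>w. \<Sum>i\<in>UNIV.
     (let u = y1 z; v = y2 z in hu u v * lift n p i u v
        + (hv u v - cos (\<phi> u v) * hu u v) / sin (\<phi> u v) * lift n s i u v) * w $ i)) (at z)"
proof -
  define u where "u = y1 z"
  define v where "v = y2 z"
  define C where "C = cos (\<phi> u v)"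
  define S where "S = sin (\<phi> u v)"
  have S: "S \<noteq> 0" using sin by (simp add: S_def u_def v_def)
  have n1: "n 1 u v \<ge> 1" for u v using H by (simp add: hyperbolic_frame_def)
  have F: "frame_system 1 \<phi> \<phi>1 (n i) (p i) (s i)" for i using H by (simp add: hyperbolic_frame_def)
  have nc: "cont2 (n i)" "cont2 (p i)" "cont2 (s i)" for i using frame_systemD(1-3)[OF F] by auto
  define cp where "cp k = chart_deriv (n 1 u v) (n k u v) (p 1 u v) (p k u v)" for k
  define cs where "cs k = chart_deriv (n 1 u v) (n k u v) (s 1 u v) (s k u v)" for k
  define f where "f w = (vector [n 2 (fst w) (snd w) / (1 + n 1 (fst w) (snd w)), n 3 (fst w) (snd w) / (1 + n 1 (fst w) (snd w))] :: real^2)" for w :: "real \<times> real"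
  define f' where "f' w = (vector [cp 2 * fst w + (C * cp 2 + S * cs 2) * snd w, cp 3 * fst w + (C * cp 3 + S * cs 3) * snd w] :: real^2)" for w :: "real \<times> real"
  define tp where "tp w = lift n p 1 u v * w $ 1 + lift n p 2 u v * w $ 2" for w :: "real^2"
  define ts where "ts w = lift n s 1 u v * w $ 1 + lift n s 2 u v * w $ 2" for w :: "real^2"
  define g' where "g' w = (tp w - C / S * ts w, 1 / S * ts w)" for w :: "real^2"
  have nz: "1 + n 1 a b \<noteq> 0" for a b using n1[of a b] by linarith
  have comp: "((\<lambda>w. n k (fst w) (snd w) / (1 + n 1 (fst w) (snd w))) has_derivative
      (\<lambda>w. cp k * fst w + (C * cp k + S * cs k) * snd w)) (at (u, v))" for k
    unfolding cp_def cs_def C_def S_def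
  proof (rule has_derivative_2_variables[OF disk_chart_deriv[OF H]])
    show "cont2 (\<lambda>u v. cos (\<phi> u v) * chart_deriv (n 1 u v) (n k u v) (p 1 u v) (p k u v)
      + sin (\<phi> u v) * chart_deriv (n 1 u v) (n k u v) (s 1 u v) (s k u v))"
      using nc \<phi> nz unfolding cont2_def chart_deriv_def by (auto intro!: continuous_intros)
  qed
  have "(f has_derivative f') (at (u, v))"
  proof (subst has_derivative_componentwise_within, intro ballI)
    fix b :: "real^2" assume "b \<in> Basis"
    then obtain i where b: "b = axis i 1" by (auto simp: Basis_vec_def)
    show "((\<lambda>x. f x \<bullet> b) has_derivative (\<lambda>x. f' x \<bullet> b)) (at (u, v))"
      using comp[of 2] comp[of 3] exhaust_2[of i] by (auto simp: b inner_axis f_def f'_def)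
  qed
  then have fd: "(f has_derivative f') (at (y1 z, y2 z))" by (simp add: u_def v_def)
  have lp: "lift n p i u v = (1 + n 1 u v)\<^sup>2 * cp (idx i)" "lift n s i u v = (1 + n 1 u v)\<^sup>2 * cs (idx i)" for i
    unfolding cp_def cs_def by (simp_all add: lift_chart_deriv n1)
  note R = hyperbolic_frame_rows[OF H, of u v]
  have np: "(1 + n 1 u v)\<^sup>2 \<noteq> 0" using nz by simp
  have inn: "cp 2 * cp 2 + cp 3 * cp 3 = 1 / (1 + n 1 u v)\<^sup>2" "cs 2 * cs 2 + cs 3 * cs 3 = 1 / (1 + n 1 u v)\<^sup>2"
    "cp 2 * cs 2 + cp 3 * cs 3 = 0"
  proof -
    have "p 2 u v * p 2 u v + p 3 u v * p 3 u v - p 1 u v * p 1 u v = 1"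
      "s 2 u v * s 2 u v + s 3 u v * s 3 u v - s 1 u v * s 1 u v = 1"
      "p 2 u v * s 2 u v + p 3 u v * s 3 u v - p 1 u v * s 1 u v = 0" using R(2,3,6) by linarith+
    then show "cp 2 * cp 2 + cp 3 * cp 3 = 1 / (1 + n 1 u v)\<^sup>2" "cs 2 * cs 2 + cs 3 * cs 3 = 1 / (1 + n 1 u v)\<^sup>2"
      "cp 2 * cs 2 + cp 3 * cs 3 = 0"
      unfolding cp_def cs_def
      using chart_deriv_inner[OF R(1) n1 R(4) R(4)] chart_deriv_inner[OF R(1) n1 R(5) R(5)] chart_deriv_inner[OF R(1) n1 R(4) R(5)]
      by simp_all
  qed
  \<comment> \<open>The components of a vector in the orthonormal frame are recovered from its image
    in the disk; solving for the \<open>u\<close>- and \<open>v\<close>-parts gives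
    \<open>g'\<close>, which needs \<open>S \<noteq> 0\<close>.\<close>
  have tf: "tp (f' w) = fst w + C * snd w" "ts (f' w) = S * snd w" for w
  proof -
    define l where "l = (1 + n 1 u v)\<^sup>2"
    have "tp (f' w) = l * (cp 2 * cp 2 + cp 3 * cp 3) * (fst w + C * snd w) + l * (cp 2 * cs 2 + cp 3 * cs 3) * (S * snd w)"
      "ts (f' w) = l * (cp 2 * cs 2 + cp 3 * cs 3) * (fst w + C * snd w) + l * (cs 2 * cs 2 + cs 3 * cs 3) * (S * snd w)"
      unfolding tp_def ts_def f'_def lp l_def[symmetric] by (simp_all add: idx_def algebra_simps)
    then show "tp (f' w) = fst w + C * snd w" "ts (f' w) = S * snd w"
      unfolding inn using np by (simp_all add: l_def)
  qed
  have gd: "((\<lambda>z. (y1 z, y2 z)) has_derivative g') (at z)"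
  proof (rule has_derivative_inverse_basic[where f = f and y = z and T = U])
    show "(f has_derivative f') (at (y1 z, y2 z))" by (rule fd)
    show "bounded_linear g'"
      unfolding g'_def tp_def ts_def
      by (intro bounded_linear_Pair bounded_linear_sub bounded_linear_add bounded_linear_const_mult bounded_linear_vec_nth)
    show "g' \<circ> f' = id" using S by (auto simp: fun_eq_iff g'_def tf)
    have "isCont y1 z" "isCont y2 z" using y U by (auto simp: continuous_on_eq_continuous_at)
    then show "continuous (at z) (\<lambda>z. (y1 z, y2 z))" by (intro continuous_Pair)
    show "f (y1 z, y2 z) = z" if "z \<in> U" for z
      using inv[OF that] by (simp add: f_def vec_eq_iff forall_2)
  qed (use U in auto)
  have "((\<lambda>z. h (fst (y1 z, y2 z)) (snd (y1 z, y2 z))) has_derivative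
      (\<lambda>w. hu u v * fst (g' w) + hv u v * snd (g' w))) (at z)"
    by (rule has_derivative_compose[OF gd, of "\<lambda>z. h (fst z) (snd z)"])
      (use has_derivative_2_variables[OF hu hv hc, of u v] in \<open>simp add: u_def v_def\<close>)
  moreover have "(\<lambda>w. hu u v * fst (g' w) + hv u v * snd (g' w)) = (\<lambda>w. \<Sum>i\<in>UNIV.
      (let u = y1 z; v = y2 z in hu u v * lift n p i u v
        + (hv u v - cos (\<phi> u v) * hu u v) / sin (\<phi> u v) * lift n s i u v) * w $ i)"
    unfolding Let_def u_def[symmetric] v_def[symmetric] C_def[symmetric] S_def[symmetric] sum_2 g'_def tp_def ts_def
    using S by (simp add: fun_eq_iff field_simps)
  ultimately show ?thesis by simp
qed

theorem proposition7p1: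
  fixes p :: "real^2" and R :: real
  assumes "p \<in> hyperbolic_plane" and "R > 0"
  shows "\<exists>(n::nat) S (x :: real^2 \<Rightarrow> real^3).
           n \<ge> 2 \<and> periodic_amsler_surface n S \<and>
           W22_isometric_immersion (hyperbolic_disk p R) hyperbolic_metric x \<and>
           x ` hyperbolic_disk p R \<subseteq> S"
proof -
  define \<Omega> where "\<Omega> = hyperbolic_disk p R"
  have \<Omega>: "open \<Omega>" unfolding \<Omega>_def by (rule hyperbolic_disk_open[OF assms(1)])
  obtain \<rho>0 where \<rho>0: "0 < \<rho>0" "\<rho>0 < 1" "\<Omega> \<subseteq> cball 0 \<rho>0"
    using hyperbolic_disk_subset[OF assms] unfolding \<Omega>_def by blast
  \<comment> \<open>A slightly larger ball, so that the immersion is twice continuously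
    differentiable on a neighbourhood of a compact set containing the disk.\<close>
  define \<rho> where "\<rho> = (1 + \<rho>0) / 2"
  have \<rho>: "0 < \<rho>" "\<rho> < 1" "\<rho>0 < \<rho>" using \<rho>0 by (auto simp: \<rho>_def)
  define U where "U = ball (0 :: real^2) \<rho>"
  have U: "open U" "cball 0 \<rho>0 \<subseteq> U" using \<rho> by (auto simp: U_def)
  obtain k \<psi> \<psi>1 n q s and y1 y2 :: "real^2 \<Rightarrow> real" where am: "amsler k \<psi> \<psi>1"
    and H: "hyperbolic_frame (\<lambda>u v. \<psi> (u * v)) (\<lambda>u v. v * \<psi>1 (u * v)) n q s"
    and y': "continuous_on (cball 0 \<rho>) y1" "continuous_on (cball 0 \<rho>) y2"
    and dom: "\<And>z. norm z \<le> \<rho> \<Longrightarrow> (y1 z, y2 z) \<in> amsler_domain (amsler.Z \<psi>)"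
    and inv: "\<And>z. norm z \<le> \<rho> \<Longrightarrow> n 2 (y1 z) (y2 z) / (1 + n 1 (y1 z) (y2 z)) = z $ 1"
      "\<And>z. norm z \<le> \<rho> \<Longrightarrow> n 3 (y1 z) (y2 z) / (1 + n 1 (y1 z) (y2 z)) = z $ 2"
    by (rule hyperbolic_disk_chart[OF \<rho>(1,2)]) blast
  interpret amsler k \<psi> \<psi>1 by (rule am)
  obtain r N P S :: "real \<Rightarrow> real \<Rightarrow> real^3" where
    piece: "amsler_piece k ((\<lambda>(u, v). r u v) ` amsler_domain Z)" and
    r_u: "\<And>u v. ((\<lambda>u. r u v) has_vector_derivative S u v) (at u)" and
    r_v: "\<And>u v. ((\<lambda>v. r u v) has_vector_derivative cos (\<psi> (u * v)) *\<^sub>R S u v - sin (\<psi> (u * v)) *\<^sub>R P u v) (at v)" and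
    P_u: "\<And>u v. ((\<lambda>u. P u v) has_vector_derivative - N u v - (v * \<psi>1 (u * v)) *\<^sub>R S u v) (at u)" and
    S_u: "\<And>u v. ((\<lambda>u. S u v) has_vector_derivative (v * \<psi>1 (u * v)) *\<^sub>R P u v) (at u)" and
    P_v: "\<And>u v. ((\<lambda>v. P u v) has_vector_derivative cos (\<psi> (u * v)) *\<^sub>R N u v) (at v)" and
    S_v: "\<And>u v. ((\<lambda>v. S u v) has_vector_derivative sin (\<psi> (u * v)) *\<^sub>R N u v) (at v)" and
    cont: "continuous_on UNIV (\<lambda>z. r (fst z) (snd z))" "continuous_on UNIV (\<lambda>z. N (fst z) (snd z))"
      "continuous_on UNIV (\<lambda>z. P (fst z) (snd z))" "continuous_on UNIV (\<lambda>z. S (fst z) (snd z))" and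
    ortho: "\<And>u v. P u v \<bullet> P u v = 1" "\<And>u v. S u v \<bullet> S u v = 1" "\<And>u v. P u v \<bullet> S u v = 0"
    by (rule amsler_piece_param) blast
  define \<phi> where "\<phi> u v = \<psi> (u * v)" for u v
  define \<phi>1 where "\<phi>1 u v = v * \<psi>1 (u * v)" for u v
  have \<phi>c: "cont2 \<phi>" "cont2 \<phi>1" using \<phi>_cont \<phi>1_cont unfolding \<phi>_def[abs_def] \<phi>1_def[abs_def] by auto
  have H: "hyperbolic_frame \<phi> \<phi>1 n q s" using H unfolding \<phi>_def[abs_def] \<phi>1_def[abs_def] .
  have n1: "n 1 u v \<ge> 1" for u v using H by (simp add: hyperbolic_frame_def)
  have Fr: "frame_system 1 \<phi> \<phi>1 (n i) (q i) (s i)" for i using H by (simp add: hyperbolic_frame_def)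
  note nqs = frame_system_C1_2[OF Fr \<phi>c]
  have y: "continuous_on U y1" "continuous_on U y2"
    using y' by (auto intro: continuous_on_subset simp: U_def)
  have invU: "n 2 (y1 z) (y2 z) / (1 + n 1 (y1 z) (y2 z)) = z $ 1"
    "n 3 (y1 z) (y2 z) / (1 + n 1 (y1 z) (y2 z)) = z $ 2" if "z \<in> U" for z
    using inv that by (auto simp: U_def)
  have sin: "sin (\<phi> (y1 z) (y2 z)) \<noteq> 0" if "z \<in> U" for z
    using sin_pos_on_domain[OF dom[of z]] that by (simp add: U_def \<phi>_def)
  \<comment> \<open>The partial derivative in direction \<open>i\<close> of \<open>h\<close>
    composed with the coordinates \<open>y1\<close>, \<open>y2\<close>.\<close>
  define \<Delta> where "\<Delta> hu hv i u v = hu u v * lift n q i u v + (hv u v - cos (\<phi> u v) * hu u v) / sin (\<phi> u v) * lift n s i u v"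
    for hu hv i u v
  have chain: "((\<lambda>z. h (y1 z) (y2 z)) has_derivative (\<lambda>w. \<Sum>i\<in>UNIV. \<Delta> hu hv i (y1 z) (y2 z) * w $ i)) (at z)"
    if "z \<in> U" "\<And>u v. ((\<lambda>u. h u v) has_real_derivative hu u v) (at u)"
      "\<And>u v. ((\<lambda>v. h u v) has_real_derivative hv u v) (at v)" "cont2 hv" for h hu hv z
    unfolding \<Delta>_def
    using disk_chart_inverse_derivative[OF H \<phi>c U(1) that(1) y invU sin[OF that(1)] that(2,3,4)] by (simp add: Let_def)
  have y_comp: "continuous_on U (\<lambda>z. f (y1 z) (y2 z))" if "cont2 f" for f
    by (rule cont2_compose[OF that y])
  have lift_C1: "C1_2 (lift n q i)" "C1_2 (lift n s i)" for i
    unfolding lift_def[abs_def] by (intro C1_2_diff C1_2_mult C1_2_add_const nqs)+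
  have lift_c: "cont2 (lift n q i)" "cont2 (lift n s i)" for i using lift_C1 by (auto simp: C1_2_def)
  have comp_c: "cont2 (\<lambda>u v. f u v $ k)" if "continuous_on UNIV (\<lambda>z. f (fst z) (snd z))" for f :: "real \<Rightarrow> real \<Rightarrow> real^3" and k
    unfolding cont2_def by (intro continuous_on_component that)
  note cc = comp_c[OF cont(1)] comp_c[OF cont(2)] comp_c[OF cont(3)] comp_c[OF cont(4)]
  have cs: "cont2 (\<lambda>u v. cos (\<phi> u v))" "cont2 (\<lambda>u v. sin (\<phi> u v))"
    using \<phi>c unfolding cont2_def by (auto intro: continuous_intros)
  have S_C1: "C1_2 (\<lambda>u v. S u v $ k)" for k
    by (rule C1_2I[OF cc(4) _ _ vector_derivative_component[OF S_u] vector_derivative_component[OF S_v]])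
      (use cont cs \<phi>c in \<open>auto simp: cont2_def \<phi>_def \<phi>1_def intro!: continuous_intros\<close>)
  have P_C1: "C1_2 (\<lambda>u v. P u v $ k)" for k
    by (rule C1_2I[OF cc(3) _ _ vector_derivative_component[OF P_u] vector_derivative_component[OF P_v]])
      (use cont cs \<phi>c in \<open>auto simp: cont2_def \<phi>_def \<phi>1_def intro!: continuous_intros\<close>)
  define x where "x z = r (y1 z) (y2 z)" for z
  \<comment> \<open>The differential of the immersion before inserting \<open>y1\<close>,
    \<open>y2\<close>. As \<open>r_v - cos \<phi> * r_u = - sin \<phi> * P\<close>, the denominator
    cancels, and \<open>J\<close> is continuously differentiable over the whole plane; the chain
    rule can be applied to it again.\<close>
  define J where "J k i u v = S u v $ k * lift n q i u v - P u v $ k * lift n s i u v" for k i u v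
  have J_C1: "C1_2 (J k i)" for k i
    unfolding J_def[abs_def] by (intro C1_2_diff C1_2_mult lift_C1 S_C1 P_C1)
  then have J_c: "cont2 (J k i)" for k i by (simp add: C1_2_def)
  have "\<forall>k i. \<exists>fu fv. cont2 fu \<and> cont2 fv \<and> (\<forall>u v. ((\<lambda>u. J k i u v) has_real_derivative fu u v) (at u) \<and>
      ((\<lambda>v. J k i u v) has_real_derivative fv u v) (at v))"
    using J_C1 unfolding C1_2_def by blast
  then obtain Ju Jv where Jd: "\<And>k i. cont2 (Ju k i)" "\<And>k i. cont2 (Jv k i)"
    "\<And>k i u v. ((\<lambda>u. J k i u v) has_real_derivative Ju k i u v) (at u)"
    "\<And>k i u v. ((\<lambda>v. J k i u v) has_real_derivative Jv k i u v) (at v)"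
    unfolding choice_iff by blast
  have x_d: "((\<lambda>z. x z $ k) has_derivative (\<lambda>w. \<Sum>i\<in>UNIV. J k i (y1 z) (y2 z) * w $ i)) (at z)" if z: "z \<in> U" for k z
  proof -
    let ?hu = "\<lambda>u v. S u v $ k" and ?hv = "\<lambda>u v. (cos (\<psi> (u * v)) *\<^sub>R S u v - sin (\<psi> (u * v)) *\<^sub>R P u v) $ k"
    have "cont2 ?hv" using cont cs by (auto simp: cont2_def \<phi>_def intro!: continuous_intros)
    from chain[OF z vector_derivative_component[OF r_u] vector_derivative_component[OF r_v] this]
    have "((\<lambda>z. r (y1 z) (y2 z) $ k) has_derivative (\<lambda>w. \<Sum>i\<in>UNIV. \<Delta> ?hu ?hv i (y1 z) (y2 z) * w $ i)) (at z)" .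
    moreover have "\<Delta> ?hu ?hv i (y1 z) (y2 z) = J k i (y1 z) (y2 z)" for i
      using sin[OF z] by (simp add: \<Delta>_def J_def \<phi>_def)
    ultimately show ?thesis by (simp add: x_def)
  qed
  have J_d: "((\<lambda>z. J k i (y1 z) (y2 z)) has_derivative (\<lambda>w. \<Sum>j\<in>UNIV. \<Delta> (Ju k i) (Jv k i) j (y1 z) (y2 z) * w $ j)) (at z)"
    if z: "z \<in> U" for k i z
    by (rule chain[OF z Jd(3,4,2)])
  have \<Delta>_c: "continuous_on U (\<lambda>z. \<Delta> (Ju k i) (Jv k i) j (y1 z) (y2 z))" for k i j
    unfolding \<Delta>_def by (intro continuous_intros y_comp Jd lift_c cs ballI sin)
  note W = W22_C2[OF \<Omega> \<rho>0(3) compact_cball U(2) x_d J_d \<Delta>_c]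
  have immersion: "W22_isometric_immersion \<Omega> hyperbolic_metric x"
    unfolding W22_isometric_immersion_def
  proof (intro conjI allI exI)
    have "\<Omega> \<subseteq> U" using \<rho>0(3) U(2) by blast
    then have "continuous_on \<Omega> (\<lambda>z. (y1 z, y2 z))"
      using y by (intro continuous_on_Pair) (auto intro: continuous_on_subset)
    then have "continuous_on \<Omega> (\<lambda>z. r (fst (y1 z, y2 z)) (snd (y1 z, y2 z)))"
      by (rule continuous_on_compose2[OF cont(1)]) simp
    then show "continuous_on \<Omega> x" by (simp add: x_def[abs_def])
    show "W22 \<Omega> (\<lambda>z. x z $ k)" for k by (rule W(1))
    show "weak_partial \<Omega> i (\<lambda>z. x z $ k) (\<lambda>z. (\<chi> k i. J k i (y1 z) (y2 z)) $ k $ i)" for k i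
      using W(2)[of i k] by simp
    have "transpose (\<chi> k i. J k i (y1 z) (y2 z)) ** (\<chi> k i. J k i (y1 z) (y2 z)) = hyperbolic_metric z" if z: "z \<in> \<Omega>" for z
    proof -
      define u where "u = y1 z"
      define v where "v = y2 z"
      have zU: "z \<in> U" using z \<rho>0(3) U(2) by blast
      define l where "l = 1 + n 1 u v"
      have l: "l > 0" using n1[of u v] by (simp add: l_def)
      have "n 1 u v * n 1 u v - 1 = n 2 u v * n 2 u v + n 3 u v * n 3 u v"
        using hyperbolic_frame_rows(1)[OF H, of u v] by linarith
      moreover have "n 1 u v = l - 1" by (simp add: l_def)
      ultimately have "n 2 u v * n 2 u v + n 3 u v * n 3 u v = l * l - 2 * l" by (simp add: algebra_simps)
      moreover have "z $ 1 = n 2 u v / l" "z $ 2 = n 3 u v / l" using invU[OF zU] by (simp_all add: u_def v_def l_def)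
      then have "(norm z)\<^sup>2 = (n 2 u v * n 2 u v + n 3 u v * n 3 u v) / (l * l)"
        by (simp add: norm_vec_def L2_set_def sum_2 power2_eq_square add_divide_distrib)
      ultimately have "(norm z)\<^sup>2 = (l * l - 2 * l) / (l * l)" by simp
      also have "\<dots> = 1 - 2 / l" using l by (simp add: diff_divide_distrib)
      finally have "(norm z)\<^sup>2 = 1 - 2 / l" .
      \<comment> \<open>With \<open>l = 1 + n 1 u v\<close> stereographic projection gives
        \<open>1 - (norm z)\<^sup>2 = 2 / l\<close>.\<close>
      then have met: "4 / (1 - (norm z)\<^sup>2)\<^sup>2 = l\<^sup>2" using l by (simp add: power_divide)
      \<comment> \<open>\<open>S\<close> and \<open>P\<close> are orthonormal in space just as
        \<open>q\<close> and \<open>s\<close> are on the hyperboloid, so the Gram matrix is that of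
        the lifted coordinate fields.\<close>
      have "(\<Sum>k\<in>UNIV. J k i u v * J k j u v) = (if i = j then l\<^sup>2 else 0)" for i j
      proof -
        have "(\<Sum>k\<in>UNIV. J k i u v * J k j u v) = (S u v \<bullet> S u v) * (lift n q i u v * lift n q j u v)
            + (P u v \<bullet> P u v) * (lift n s i u v * lift n s j u v)
            - (P u v \<bullet> S u v) * (lift n q i u v * lift n s j u v + lift n s i u v * lift n q j u v)"
          unfolding J_def inner_vec_def sum_3 by (simp add: algebra_simps)
        then show ?thesis using lift_orthogonal[OF H, of i u v j] by (simp add: ortho l_def)
      qed
      then show ?thesis
        unfolding hyperbolic_metric_def met
        by (simp add: vec_eq_iff matrix_matrix_mult_def transpose_def mat_def u_def v_def)
    qed
    then show "AE z in lebesgue_on \<Omega>. transpose (\<chi> k i. J k i (y1 z) (y2 z)) ** (\<chi> k i. J k i (y1 z) (y2 z)) = hyperbolic_metric z"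
      by (intro AE_I2) simp
  qed
  define Pc where "Pc = (\<lambda>(u, v). r u v) ` amsler_domain Z"
  define Sf where "Sf = (\<Union>i<2 * k. amsler_copy k Pc i)"
  have "periodic_amsler_surface k Sf"
    unfolding periodic_amsler_surface_def Sf_def using n piece Pc_def by blast
  moreover have "x ` \<Omega> \<subseteq> Sf"
  proof -
    have "x z \<in> Pc" if "z \<in> \<Omega>" for z
    proof -
      have "norm z \<le> \<rho>" using that \<rho>0(3) \<rho>(3) by (auto simp: subset_iff)
      from dom[OF this] show ?thesis by (force simp: Pc_def x_def)
    qed
    \<comment> \<open>The piece is its own copy with index 0.\<close>
    moreover have "Pc \<subseteq> Sf" unfolding Sf_def using n by (force intro!: bexI[of _ 0])
    ultimately show ?thesis by blast
  qed
  ultimately show ?thesis using n immersion unfolding \<Omega>_def by blast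
qed

end
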